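(* Let $F\subset\mathbb{R}^d$ be a self-similar set, not contained in any $(d-1)$-dimensional hyperplane, that is both the attractor of an IFS satisfying the open set condition and the attractor of an IFS not satisfying the weak separation property. Let $p=\dim_O F$. Then there are a nontrivial $p$-dimensional cube $Q\subset V_{\mathcal O}$ and a set $C\subset V_{\mathcal O}^\perp$, with $\dim_A C=\dim_A\pi_{V_{\mathcal O}^\perp}(F)$, such that $Q\times C\subset F$.
   Context: IFS and attractor: an IFS is a finite family $\mathcal S=\{S_1,\dots,S_m\}$ of contractive similitudes of $\mathbb{R}^d$, $S_i(x)=c_iO_ix+b_i$ with $c_i\in(0,1)$, $O_i$ a $d\times d$ orthogonal matrix, $b_i\in\mathbb{R}^d$. Its attractor is the unique nonempty compact $F$ with $F=\bigcup_{i=1}^m S_i(F)$; such an $F$ is called a self-similar set. $\mathcal I=\{1,\dots,m\}$, $\mathcal I^\ast=\bigcup_{k\ge1}\mathcal I^k$, and for $\alpha=(i_1,\dots,i_k)\in\mathcal I^\ast$, $S_\alpha=S_{i_1}\circ\cdots\circ S_{i_k}$. Open set condition: an IFS $\{R_1,\dots,R_{m'}\}$ satisfies it if there is a nonempty bounded open set $U$ with $\bigcup_{i=1}^{m'}R_i(U)\subset U$, the union being disjoint. Weak separation property (WSP): let $\mathcal E=\{S_\alpha^{-1}\circ S_\beta:\alpha,\beta\in\mathcal I^\ast,\alpha\ne\beta\}$, inside the group of similitudes with the topology of pointwise convergence. For $F$ not contained in any $(d-1)$-dimensional hyperplane, $\mathcal S$ satisfies the WSP if $I\notin\overline{\mathcal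 E\setminus\{I\}}$, where $I$ is the identity. Overlapping directions: $B(x,R)$ is the closed ball, $\|\cdot\|_\infty$ is the sup norm on $[0,1]^d$ and $\|\cdot\|_{\mathrm{op}}$ the Euclidean operator norm. Suppose $\mathcal S$ does not satisfy the WSP. Take any sequences $\alpha_k,\beta_k\in\mathcal I^\ast$ such that $\Phi_k:=S_{\alpha_k}^{-1}\circ S_{\beta_k}-I$ satisfies $0<\|\Phi_k\|_\infty\to0$ and such that, for some $a\in F$ and $\rho>0$, $\rho\|D\Phi_k\|_{\mathrm{op}}\le\|\Phi_k(a_k)\|$ for all $k$, where $a_k$ is any point of $B(a,\rho)$ minimizing $\|\Phi_k(x)\|$ over $x\in B(a,\rho)$. Any limit point $\omega\in S^{d-1}$ of $\{\Phi_k(a)/\|\Phi_k(a)\|\}_k$, for any such choice of data, is called an overlapping direction for $\mathcal S$. $V_{\mathcal S}$ is the vector subspace of $\mathbb{R}^d$ spanned by all overlapping directions for $\mathcal S$. If $\mathcal S$ satisfies the WSP, $V_{\mathcal S}=\{0\}$. $V_{\mathcal O}$ and overlapping dimension: among all IFSs $\mathcal S$ with attractor $F$ choose one for which $\dim V_{\mathcal S}$ is maximal; the subspace $V_{\mathcal S}$ does not depend on the choice (a union of two IFSs generating $F$ is again an IFS generating $F$), and it is denoted $V_{\mathcal O}$. Set $\dim_O F=\dim V_{\mathcal O}$. $\mathbb{R}^d$ is identified with $V_{\mathcal O}\times V_{\mathcal O}^\perp$, so $Q\times C=\{q+c:q\in Q,c\in C\}$; nontrivial cube means a cube of positive side length.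 $\pi_V$ is the orthogonal projection onto $V$. Assouad dimension: $N_r(E)$ is the minimum number of closed balls of radius $r$ needed to cover $E$, and $\dim_A E$ is the infimum of the $\alpha$ for which there is a constant $c$ such that $\sup_{x\in E}N_r(B(x,R)\cap E)\le c(R/r)^\alpha$ for all $0<r<R$. *)

theory Defs
  imports "HOL-Analysis.Analysis"
begin

section \<open>Iterated function systems\<close>

definition contractive_similitude :: "((real ^ 'd) \<Rightarrow> (real ^ 'd)) \<Rightarrow> bool" where
  "contractive_similitude f \<longleftrightarrow>
     (\<exists>c A b. 0 < c \<and> c < 1 \<and> orthogonal_matrix A \<and> f = (\<lambda>x. c *\<^sub>R (A *v x) + b))"

text \<open>A finite family of maps is represented by a list; its indices are the numbers below
  the length of the list.\<close>

type_synonym 'd ifs = "((real ^ 'd) \<Rightarrow> (real ^ 'd)) list"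

definition is_ifs :: "('d::finite) ifs \<Rightarrow> bool" where
  "is_ifs S \<longleftrightarrow> (\<forall>f \<in> set S. contractive_similitude f)"

text \<open>A list generates at most one set, by the uniqueness of attractors.
  As \<open>F\<close> is nonempty, \<open>S\<close> is nonempty too.\<close>

definition generates :: "('d::finite) ifs \<Rightarrow> (real ^ 'd) set \<Rightarrow> bool" where
  "generates S F \<longleftrightarrow>
     is_ifs S \<and> compact F \<and> F \<noteq> {} \<and> F = (\<Union>i<length S. (S ! i) ` F)"

definition words :: "('d::finite) ifs \<Rightarrow> nat list set" where
  "words S = {\<alpha>. \<alpha> \<noteq> [] \<and> set \<alpha> \<subseteq> {..<length S}}"

definition word_map :: "('d::finite) ifs \<Rightarrow> nat list \<Rightarrow> (real ^ 'd) \<Rightarrow> (real ^ 'd)" where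
  "word_map S \<alpha> = foldr (\<lambda>i g. (S ! i) \<circ> g) \<alpha> id"

definition open_set_condition :: "('d::finite) ifs \<Rightarrow> bool" where
  "open_set_condition S \<longleftrightarrow>
     (\<exists>U. U \<noteq> {} \<and> bounded U \<and> open U \<and> (\<Union>i<length S. (S ! i) ` U) \<subseteq> U \<and>
          disjoint_family_on (\<lambda>i. (S ! i) ` U) {..<length S})"

definition neighbour_maps :: "('d::finite) ifs \<Rightarrow> ((real ^ 'd) \<Rightarrow> (real ^ 'd)) set" where
  "neighbour_maps S =
     {inv (word_map S \<alpha>) \<circ> word_map S \<beta> | \<alpha> \<beta>. \<alpha> \<in> words S \<and> \<beta> \<in> words S \<and> \<alpha> \<noteq> \<beta>}"

text \<open>The topology on the function type is the product topology, that is, the topology of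
  pointwise convergence. Taking the closure among all functions instead of among the similitudes
  does not affect whether the identity belongs to it.\<close>

definition weak_separation :: "('d::finite) ifs \<Rightarrow> bool" where
  "weak_separation S \<longleftrightarrow> id \<notin> closure (neighbour_maps S - {id})"

definition contained_in_hyperplane :: "(real ^ 'd) set \<Rightarrow> bool" where
  "contained_in_hyperplane F \<longleftrightarrow> (\<exists>a b. a \<noteq> 0 \<and> F \<subseteq> {x. a \<bullet> x = b})"


section \<open>Overlapping directions\<close>

definition overlap_map :: "('d::finite) ifs \<Rightarrow> nat list \<Rightarrow> nat list \<Rightarrow> (real ^ 'd) \<Rightarrow> (real ^ 'd)" where
  "overlap_map S \<alpha> \<beta> = (\<lambda>x. (inv (word_map S \<alpha>) \<circ> word_map S \<beta>) x - x)"

definition cube_sup_norm :: "((real ^ 'd) \<Rightarrow> (real ^ 'd)) \<Rightarrow> real" where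
  "cube_sup_norm f = (SUP x \<in> cbox 0 1. norm (f x))"

text \<open>Only meaningful if \<open>S\<close> generates \<open>F\<close>. The maps \<open>\<Phi> k\<close> are affine, so the point at which
  they are differentiated is irrelevant. The minimality of \<open>x k\<close> and the lower bound on
  \<open>norm (\<Phi> k (x k))\<close> imply that \<open>\<Phi> k a\<close> does not vanish. A limit point of a sequence is a limit
  of a subsequence.\<close>

definition overlapping_direction :: "('d::finite) ifs \<Rightarrow> (real ^ 'd) set \<Rightarrow> (real ^ 'd) \<Rightarrow> bool" where
  "overlapping_direction S F \<omega> \<longleftrightarrow>
     \<omega> \<in> sphere 0 1 \<and>
     (\<exists>\<alpha> \<beta> :: nat \<Rightarrow> nat list. \<exists>\<Phi> :: nat \<Rightarrow> (real ^ 'd) \<Rightarrow> (real ^ 'd). \<exists>a \<rho> x s.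
        (\<forall>k. \<alpha> k \<in> words S \<and> \<beta> k \<in> words S \<and> \<Phi> k = overlap_map S (\<alpha> k) (\<beta> k)) \<and>
        (\<forall>k. 0 < cube_sup_norm (\<Phi> k)) \<and>
        (\<lambda>k. cube_sup_norm (\<Phi> k)) \<longlonglongrightarrow> 0 \<and>
        a \<in> F \<and> 0 < \<rho> \<and>
        (\<forall>k. x k \<in> cball a \<rho> \<and> (\<forall>y \<in> cball a \<rho>. norm (\<Phi> k (x k)) \<le> norm (\<Phi> k y))) \<and>
        (\<forall>k. \<rho> * onorm (frechet_derivative (\<Phi> k) (at a)) \<le> norm (\<Phi> k (x k))) \<and>
        strict_mono (s :: nat \<Rightarrow> nat) \<and>
        ((\<lambda>k. \<Phi> k a /\<^sub>R norm (\<Phi> k a)) \<circ> s) \<longlonglongrightarrow> \<omega>)"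

definition overlap_space_of :: "('d::finite) ifs \<Rightarrow> (real ^ 'd) set \<Rightarrow> (real ^ 'd) set" where
  "overlap_space_of S F =
     (if weak_separation S then {0} else span {\<omega>. overlapping_direction S F \<omega>})"

text \<open>The maximum exists because dimensions are bounded by that of the ambient space; the
  independence of the choice is \<open>overlap_space_eqI\<close> below.\<close>

definition overlap_space :: "(real ^ 'd) set \<Rightarrow> (real ^ 'd) set" where
  "overlap_space F =
     overlap_space_of (ARG_MAX (\<lambda>S. dim (overlap_space_of S F)) S. generates S F) F"

definition overlap_dim :: "(real ^ 'd) set \<Rightarrow> nat" where
  "overlap_dim F = dim (overlap_space F)"


section \<open>Cubes, projections and Assouad dimension\<close>

definition nontrivial_cube :: "nat \<Rightarrow> (real ^ 'd) set \<Rightarrow> bool" where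
  "nontrivial_cube p Q \<longleftrightarrow>
     (\<exists>B x l. finite B \<and> card B = p \<and> pairwise orthogonal B \<and> (\<forall>b \<in> B. norm b = 1) \<and> 0 < l \<and>
        Q = {x + (\<Sum>b\<in>B. t b *\<^sub>R b) | t. \<forall>b \<in> B. 0 \<le> t b \<and> t b \<le> l})"

definition orthogonal_projection :: "(real ^ 'd) set \<Rightarrow> (real ^ 'd) \<Rightarrow> (real ^ 'd)" where
  "orthogonal_projection V x = (THE y. y \<in> V \<and> (\<forall>v \<in> V. orthogonal (x - y) v))"

definition covering_number :: "real \<Rightarrow> (real ^ 'd) set \<Rightarrow> nat" where
  "covering_number r E = (LEAST n. \<exists>T. finite T \<and> card T = n \<and> E \<subseteq> (\<Union>z\<in>T. cball z r))"

text \<open>With the exponent ranging over all reals, the dimension of the empty set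
  is \<open>-\<infinity>\<close>, while that of a nonempty set is nonnegative.\<close>

definition assouad_dim :: "(real ^ 'd) set \<Rightarrow> ereal" where
  "assouad_dim E = Inf {ereal s | s. \<exists>c :: real. \<forall>r R. 0 < r \<and> r < R \<longrightarrow>
     (\<forall>x\<in>E. real (covering_number r (cball x R \<inter> E)) \<le> c * (R / r) powr s)}"


section \<open>Independence of the chosen family\<close>

lemma word_map_append_left:
  assumes "\<alpha> \<in> words S"
  shows "\<alpha> \<in> words (S @ T)" "word_map (S @ T) \<alpha> = word_map S \<alpha>"
proof -
  show "\<alpha> \<in> words (S @ T)" using assms by (auto simp: words_def)
  have "set \<alpha> \<subseteq> {..<length S} \<Longrightarrow> word_map (S @ T) \<alpha> = word_map S \<alpha>"
    by (induction \<alpha>) (auto simp: word_map_def nth_append)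
  then show "word_map (S @ T) \<alpha> = word_map S \<alpha>" using assms by (auto simp: words_def)
qed

lemma word_map_append_right:
  assumes "\<alpha> \<in> words T"
  shows "map (\<lambda>i. length S + i) \<alpha> \<in> words (S @ T)"
    and "word_map (S @ T) (map (\<lambda>i. length S + i) \<alpha>) = word_map T \<alpha>"
proof -
  show "map (\<lambda>i. length S + i) \<alpha> \<in> words (S @ T)" using assms by (auto simp: words_def)
  show "word_map (S @ T) (map (\<lambda>i. length S + i) \<alpha>) = word_map T \<alpha>"
    by (induction \<alpha>) (auto simp: word_map_def)
qed

lemma overlap_space_of_mono:
  assumes h: "\<And>\<alpha>. \<alpha> \<in> words S \<Longrightarrow> h \<alpha> \<in> words T \<and> word_map T (h \<alpha>) = word_map S \<alpha>"
    and inj: "inj h"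
  shows "overlap_space_of S F \<subseteq> overlap_space_of T F"
proof (cases "weak_separation S")
  case True
  then show ?thesis by (auto simp: overlap_space_of_def span_zero)
next
  case False
  have "neighbour_maps S \<subseteq> neighbour_maps T"
  proof
    fix f assume "f \<in> neighbour_maps S"
    then obtain \<alpha> \<beta> where f: "f = inv (word_map S \<alpha>) \<circ> word_map S \<beta>"
      and ab: "\<alpha> \<in> words S" "\<beta> \<in> words S" "\<alpha> \<noteq> \<beta>"
      unfolding neighbour_maps_def by blast
    have "f = inv (word_map T (h \<alpha>)) \<circ> word_map T (h \<beta>)" using f h ab by simp
    moreover have "h \<alpha> \<in> words T" "h \<beta> \<in> words T" "h \<alpha> \<noteq> h \<beta>"
      using h ab inj by (auto dest: injD)
    ultimately show "f \<in> neighbour_maps T" unfolding neighbour_maps_def by blast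
  qed
  then have "closure (neighbour_maps S - {id}) \<subseteq> closure (neighbour_maps T - {id})"
    by (intro closure_mono) auto
  with False have T: "\<not> weak_separation T" by (auto simp: weak_separation_def)
  have "overlapping_direction T F \<omega>" if dir: "overlapping_direction S F \<omega>" for \<omega>
  proof -
    from dir obtain \<alpha> \<beta> \<Phi> a \<rho> x s where
      1: "\<omega> \<in> sphere 0 1" "\<forall>k. \<alpha> k \<in> words S \<and> \<beta> k \<in> words S \<and> \<Phi> k = overlap_map S (\<alpha> k) (\<beta> k)"
      and 2: "(\<forall>k. 0 < cube_sup_norm (\<Phi> k)) \<and>
        (\<lambda>k. cube_sup_norm (\<Phi> k)) \<longlonglongrightarrow> 0 \<and>
        a \<in> F \<and> 0 < \<rho> \<and>
        (\<forall>k. x k \<in> cball a \<rho> \<and> (\<forall>y \<in> cball a \<rho>. norm (\<Phi> k (x k)) \<le> norm (\<Phi> k y))) \<and>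
        (\<forall>k. \<rho> * onorm (frechet_derivative (\<Phi> k) (at a)) \<le> norm (\<Phi> k (x k))) \<and>
        strict_mono (s :: nat \<Rightarrow> nat) \<and>
        ((\<lambda>k. \<Phi> k a /\<^sub>R norm (\<Phi> k a)) \<circ> s) \<longlonglongrightarrow> \<omega>"
      unfolding overlapping_direction_def by (elim conjE exE) blast
    have 3: "\<forall>k. h (\<alpha> k) \<in> words T \<and> h (\<beta> k) \<in> words T \<and>
                 \<Phi> k = overlap_map T (h (\<alpha> k)) (h (\<beta> k))"
      using 1(2) h by (simp add: overlap_map_def)
    show ?thesis
      unfolding overlapping_direction_def
      by (rule conjI[OF 1(1)], rule exI[of _ "\<lambda>k. h (\<alpha> k)"], rule exI[of _ "\<lambda>k. h (\<beta> k)"],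
          rule exI[of _ \<Phi>], rule exI[of _ a], rule exI[of _ \<rho>], rule exI[of _ x],
          rule exI[of _ s], rule conjI[OF 3 2])
  qed
  then have "{\<omega>. overlapping_direction S F \<omega>} \<subseteq> {\<omega>. overlapping_direction T F \<omega>}"
    by blast
  from span_mono[OF this] show ?thesis
    using False T unfolding overlap_space_of_def by simp
qed

lemma overlap_space_of_append:
  "overlap_space_of S F \<subseteq> overlap_space_of (S @ T) F"
  "overlap_space_of T F \<subseteq> overlap_space_of (S @ T) F"
proof -
  show "overlap_space_of S F \<subseteq> overlap_space_of (S @ T) F"
    by (rule overlap_space_of_mono[where h = id]) (auto intro: word_map_append_left)
  show "overlap_space_of T F \<subseteq> overlap_space_of (S @ T) F"
    by (rule overlap_space_of_mono[where h = "map (\<lambda>i. length S + i)"])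
       (auto intro!: word_map_append_right inj_mapI injI)
qed

lemma generates_append:
  assumes "generates S F" "generates T F"
  shows "generates (S @ T) F"
proof -
  have *: "(\<Union>i<length S. (S ! i) ` F) = (\<Union>f\<in>set S. f ` F)" for S :: "('a::finite) ifs"
    by (auto simp: set_conv_nth)
  from assms show ?thesis unfolding generates_def * is_ifs_def by auto
qed

lemma subspace_overlap_space_of: "subspace (overlap_space_of S F)"
  by (simp add: overlap_space_of_def)

lemma overlap_space_eqI:
  assumes S: "is_arg_max (\<lambda>S. dim (overlap_space_of S F)) (\<lambda>S. generates S F) S"
  shows "overlap_space F = overlap_space_of S F"
proof -
  let ?d = "\<lambda>S. dim (overlap_space_of S F)"
  define T where "T = (ARG_MAX ?d S. generates S F)"
  have T: "is_arg_max ?d (\<lambda>S. generates S F) T"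
    unfolding T_def arg_max_def using S by (rule someI)
  have gen: "generates (S @ T) F"
    using S T by (intro generates_append) (auto simp: is_arg_max_def)
  then have "?d (S @ T) \<le> ?d S" "?d (S @ T) \<le> ?d T"
    using S T by (auto simp: is_arg_max_def not_less)
  then have "overlap_space_of S F = overlap_space_of (S @ T) F"
    and "overlap_space_of T F = overlap_space_of (S @ T) F"
    by (simp_all only: subspace_dim_equal subspace_overlap_space_of overlap_space_of_append)
  then show ?thesis unfolding overlap_space_def T_def by simp
qed

lemma ex_overlap_space:
  assumes "generates S0 F"
  shows "\<exists>S. is_arg_max (\<lambda>S. dim (overlap_space_of S F)) (\<lambda>S. generates S F) S"
proof -
  let ?d = "\<lambda>S. dim (overlap_space_of S F)"
  have "\<forall>S. generates S F \<longrightarrow> ?d S < Suc (DIM(real ^ 'a))"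
    by (intro allI impI) (simp only: less_Suc_eq_le dim_subset_UNIV)
  then obtain S where "generates S F" "\<forall>T. generates T F \<longrightarrow> ?d T \<le> ?d S"
    using ex_has_greatest_nat[of "\<lambda>S. generates S F" S0 ?d] assms by metis
  then show ?thesis by (auto simp: is_arg_max_def not_less)
qed

end

theory Submission
  imports Defs
begin

text \<open>Near an overlapping direction the maps \<open>\<Phi> k\<close> become, after conjugation by long words, nearly
  pure translations: the conjugated translation part is magnified, the linear part is not.
  Composing many such near translations shows that blow-ups of \<open>F\<close> contain approximate copies
  of \<open>P + F\<close>, where \<open>P\<close> is a large parallelepiped in the overlap space \<open>V\<close>, and \<open>P + F\<close> contains the
  product of a ball of \<open>V\<close> with the projection of \<open>F\<close> to the orthogonal complement of \<open>V\<close>. Under the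
  open set condition a bounded piece of a blow-up is covered by a bounded number of similar copies
  of \<open>F\<close>, so in the limit this product is covered by finitely many similar copies of \<open>F\<close>, one
  of which contains a relatively open piece of it. The rotations of all maps preserve \<open>V\<close>, so
  this piece can be pulled back to \<open>F\<close>, and a relatively open piece of the projection contains a
  similar copy of the whole projection.\<close>

text \<open>Three difficulties shape the proof. Rotations of words form only a semigroup, so a
  conjugated near translation points in an uncontrolled direction. Powers of an orthogonal matrix
  recur, hence one of finitely many further words undoes the rotation, at the price of prescribing
  the displacement only up to a fixed factor. Errors are therefore measured relative to the step
  length: their sum depends on the distance covered, not on the number of steps. The resulting
  notion, \<open>translation_dir\<close>, is visibly invariant under rotations of words and, for
  unit vectors, equivalent to being an overlapping direction; this is why rotations preserve V.
  Next, the parallelepiped has to be large because replacing a point of \<open>F\<close> by its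
  projection costs a shift in V comparable to the size of \<open>F\<close>. Finally, the open set
  condition and the overlap space come from different families. A concatenation of them still has
  overlap space V and contains the maps of the family with the open set condition, so the covering
  cylinders have rotations preserving V as well. Limits are taken of the parameters of similitudes,
  which range over a compact set.\<close>

declare transpose_matrix_vector [simp del]

section \<open>Orthogonal matrices as linear isometries\<close>

lemma orthogonal_matrix_inner:
  fixes A :: "real ^ 'n ^ 'n"
  assumes "orthogonal_matrix A"
  shows "(A *v x) \<bullet> (A *v y) = x \<bullet> y"
  by (metis assms orthogonal_matrix dot_lmul_matrix matrix_vector_mul_assoc matrix_vector_mul_lid
      transpose_matrix_vector transpose_transpose)

lemma orthogonal_matrix_norm:
  fixes A :: "real ^ 'n ^ 'n"
  assumes "orthogonal_matrix A"
  shows "norm (A *v x) = norm x"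
  by (simp add: norm_eq_sqrt_inner orthogonal_matrix_inner[OF assms])

lemma orthogonal_matrix_cancel:
  fixes A :: "real ^ 'n ^ 'n"
  assumes "orthogonal_matrix A"
  shows "transpose A *v (A *v x) = x" "A *v (transpose A *v x) = x"
  using assms by (simp_all add: matrix_vector_mul_assoc orthogonal_matrix_def)

text \<open>Expresses orthogonality by equations that are continuous in the matrix, so that it
  passes to limits in \<open>closed_preserving_sims\<close>.\<close>

lemma orthogonal_matrix_iff_norm:
  fixes A :: "real ^ 'n ^ 'n"
  shows "orthogonal_matrix A \<longleftrightarrow> (\<forall>x. norm (A *v x) = norm x)"
  by (metis orthogonal_matrix_norm orthogonal_transformation matrix_of_matrix_vector_mul
      matrix_vector_mul_linear orthogonal_transformation_matrix)

section \<open>Words of similitudes\<close>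

text \<open>The ratio and the rotation are chosen for each map separately, so that two families that
  share a map assign the same rotation to it.\<close>

definition sim_ratio :: "((real ^ 'd) \<Rightarrow> (real ^ 'd)) \<Rightarrow> real" where
  "sim_ratio f =
     (SOME c. \<exists>A b. 0 < c \<and> c < 1 \<and> orthogonal_matrix A \<and> f = (\<lambda>x. c *\<^sub>R (A *v x) + b))"

definition sim_rot :: "((real ^ 'd) \<Rightarrow> (real ^ 'd)) \<Rightarrow> real ^ 'd ^ 'd" where
  "sim_rot f =
     (SOME A. orthogonal_matrix A \<and> (\<exists>b. f = (\<lambda>x. sim_ratio f *\<^sub>R (A *v x) + b)))"

lemma contractive_similitude_data:
  assumes "contractive_similitude f"
  shows "0 < sim_ratio f" "sim_ratio f < 1" "orthogonal_matrix (sim_rot f)"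
    "f x = sim_ratio f *\<^sub>R (sim_rot f *v x) + f 0"
proof -
  have 1: "\<exists>A b. 0 < sim_ratio f \<and> sim_ratio f < 1 \<and> orthogonal_matrix A \<and>
      f = (\<lambda>x. sim_ratio f *\<^sub>R (A *v x) + b)"
    unfolding sim_ratio_def
    by (rule someI_ex) (use assms in \<open>unfold contractive_similitude_def, blast\<close>)
  then show "0 < sim_ratio f" "sim_ratio f < 1" by auto
  have 2: "orthogonal_matrix (sim_rot f) \<and> (\<exists>b. f = (\<lambda>x. sim_ratio f *\<^sub>R (sim_rot f *v x) + b))"
    unfolding sim_rot_def by (rule someI_ex) (use 1 in blast)
  then show "orthogonal_matrix (sim_rot f)" by blast
  from 2 obtain b where b: "f = (\<lambda>x. sim_ratio f *\<^sub>R (sim_rot f *v x) + b)" by blast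
  have "f 0 = b" by (subst b) simp
  with b show "f x = sim_ratio f *\<^sub>R (sim_rot f *v x) + f 0" by metis
qed

text \<open>Unlike \<open>words\<close>, this contains the empty word, which acts as the identity;
  inductions, prefixes and conjugating suffixes require it.\<close>

abbreviation words0 :: "('d::finite) ifs \<Rightarrow> nat list set" where
  "words0 S \<equiv> lists {..<length S}"

definition word_ratio :: "('d::finite) ifs \<Rightarrow> nat list \<Rightarrow> real" where
  "word_ratio S \<alpha> = (\<Prod>i\<leftarrow>\<alpha>. sim_ratio (S ! i))"

definition word_rot :: "('d::finite) ifs \<Rightarrow> nat list \<Rightarrow> real ^ 'd ^ 'd" where
  "word_rot S \<alpha> = foldr (\<lambda>i B. sim_rot (S ! i) ** B) \<alpha> (mat 1)"

lemma words_iff: "\<alpha> \<in> words S \<longleftrightarrow> \<alpha> \<noteq> [] \<and> \<alpha> \<in> words0 S"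
  by (auto simp: words_def)

lemma word_map_simps [simp]:
  "word_map S [] = id" "word_map S (i # \<alpha>) = S ! i \<circ> word_map S \<alpha>"
  "word_map S (\<alpha> @ \<beta>) = word_map S \<alpha> \<circ> word_map S \<beta>"
  by (simp_all add: word_map_def) (induction \<alpha>; simp add: comp_assoc)

lemma word_ratio_simps [simp]:
  "word_ratio S [] = 1" "word_ratio S (i # \<alpha>) = sim_ratio (S ! i) * word_ratio S \<alpha>"
  "word_ratio S (\<alpha> @ \<beta>) = word_ratio S \<alpha> * word_ratio S \<beta>"
  by (simp_all add: word_ratio_def)

lemma word_rot_simps [simp]:
  "word_rot S [] = mat 1" "word_rot S (i # \<alpha>) = sim_rot (S ! i) ** word_rot S \<alpha>"
  "word_rot S (\<alpha> @ \<beta>) = word_rot S \<alpha> ** word_rot S \<beta>"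
  by (simp_all add: word_rot_def) (induction \<alpha>; simp add: matrix_mul_assoc)

locale generating_ifs =
  fixes S :: "('d::finite) ifs" and F :: "(real ^ 'd) set"
  assumes gen: "generates S F"
begin

lemma compact_F: "compact F" and F_ne: "F \<noteq> {}"
  and F_eq: "F = (\<Union>i<length S. (S ! i) ` F)"
  using gen by (auto simp: generates_def)

lemma F_diff_bound: obtains D where "0 < D" "\<And>x y. x \<in> F \<Longrightarrow> y \<in> F \<Longrightarrow> norm (x - y) \<le> D"
    "\<And>x. x \<in> F \<Longrightarrow> norm x \<le> D"
proof -
  obtain B where B: "0 < B" "\<And>x. x \<in> F \<Longrightarrow> norm x \<le> B"
    using compact_F compact_imp_bounded bounded_pos by metis
  show ?thesis
  proof (rule that[of "2 * B"])
    show "norm (x - y) \<le> 2 * B" if "x \<in> F" "y \<in> F" for x y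
      using B(2)[OF that(1)] B(2)[OF that(2)] norm_triangle_ineq4[of x y] by simp
  qed (use B in \<open>force+\<close>)
qed

lemma length_pos: "0 < length S"
  using F_ne F_eq by auto

lemma letter:
  assumes "i < length S"
  shows "0 < sim_ratio (S ! i)" "sim_ratio (S ! i) < 1" "orthogonal_matrix (sim_rot (S ! i))"
    "(S ! i) x = sim_ratio (S ! i) *\<^sub>R (sim_rot (S ! i) *v x) + (S ! i) 0"
proof -
  have "contractive_similitude (S ! i)"
    using gen assms by (auto simp: generates_def is_ifs_def)
  note contractive_similitude_data[OF this]
  then show "0 < sim_ratio (S ! i)" "sim_ratio (S ! i) < 1" "orthogonal_matrix (sim_rot (S ! i))"
    "(S ! i) x = sim_ratio (S ! i) *\<^sub>R (sim_rot (S ! i) *v x) + (S ! i) 0" by blast+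
qed

lemma word_ratio_pos: "\<alpha> \<in> words0 S \<Longrightarrow> 0 < word_ratio S \<alpha>"
  by (induction \<alpha>) (auto simp: letter)

lemma word_ratio_le_1: "\<alpha> \<in> words0 S \<Longrightarrow> word_ratio S \<alpha> \<le> 1"
proof (induction \<alpha>)
  case (Cons i \<alpha>)
  then show ?case
    using mult_le_one[of "sim_ratio (S ! i)" "word_ratio S \<alpha>"] letter[of i] word_ratio_pos[of \<alpha>]
    by fastforce
qed simp

lemma orthogonal_word_rot: "\<alpha> \<in> words0 S \<Longrightarrow> orthogonal_matrix (word_rot S \<alpha>)"
  by (induction \<alpha>) (auto simp: letter orthogonal_matrix_id intro: orthogonal_matrix_mul)

lemma word_map_diff:
  "\<alpha> \<in> words0 S \<Longrightarrow>
    word_map S \<alpha> x - word_map S \<alpha> y = word_ratio S \<alpha> *\<^sub>R (word_rot S \<alpha> *v (x - y))"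
proof (induction \<alpha>)
  case (Cons i \<alpha>)
  then have i: "i < length S" by simp
  have "word_map S (i # \<alpha>) x - word_map S (i # \<alpha>) y =
      sim_ratio (S ! i) *\<^sub>R (sim_rot (S ! i) *v (word_map S \<alpha> x - word_map S \<alpha> y))"
    unfolding word_map_simps comp_apply
    by (subst (1 2) letter(4)[OF i]) (simp add: algebra_simps)
  also have "\<dots> = word_ratio S (i # \<alpha>) *\<^sub>R (word_rot S (i # \<alpha>) *v (x - y))"
    using Cons by (simp add: matrix_vector_mult_scaleR matrix_vector_mul_assoc)
  finally show ?case .
qed simp

lemma word_map_eq:
  assumes "\<alpha> \<in> words0 S"
  shows "word_map S \<alpha> x = word_ratio S \<alpha> *\<^sub>R (word_rot S \<alpha> *v x) + word_map S \<alpha> 0"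
  using word_map_diff[OF assms, of x 0] by (simp add: algebra_simps)

lemma norm_word_map_diff:
  "\<alpha> \<in> words0 S \<Longrightarrow> norm (word_map S \<alpha> x - word_map S \<alpha> y) = word_ratio S \<alpha> * norm (x - y)"
  by (simp add: word_map_diff orthogonal_matrix_norm[OF orthogonal_word_rot]
      less_imp_le[OF word_ratio_pos])

lemma inj_word_map:
  assumes "\<alpha> \<in> words0 S" shows "inj (word_map S \<alpha>)"
proof (rule injI)
  fix x y assume "word_map S \<alpha> x = word_map S \<alpha> y"
  then show "x = y" using norm_word_map_diff[OF assms, of x y] word_ratio_pos[OF assms] by simp
qed

lemma word_map_right_inverse:
  assumes "\<alpha> \<in> words0 S"
  shows "word_map S \<alpha> ((1 / word_ratio S \<alpha>) *\<^sub>R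
    (transpose (word_rot S \<alpha>) *v (y - word_map S \<alpha> 0))) = y"
  by (subst word_map_eq[OF assms])
     (use word_ratio_pos[OF assms] in \<open>simp add: matrix_vector_mult_scaleR
       orthogonal_matrix_cancel[OF orthogonal_word_rot[OF assms]]\<close>)

lemma inv_word_map_eq:
  assumes "\<alpha> \<in> words0 S"
  shows "inv (word_map S \<alpha>) y =
    (1 / word_ratio S \<alpha>) *\<^sub>R (transpose (word_rot S \<alpha>) *v (y - word_map S \<alpha> 0))"
  by (intro inv_f_eq inj_word_map[OF assms] word_map_right_inverse[OF assms])

lemma bij_word_map:
  assumes "\<alpha> \<in> words0 S" shows "bij (word_map S \<alpha>)"
  by (rule bijI[OF inj_word_map[OF assms]], rule surjI, rule word_map_right_inverse[OF assms])

lemma inv_word_map_cancel [simp]: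
  assumes "\<alpha> \<in> words0 S"
  shows "inv (word_map S \<alpha>) (word_map S \<alpha> x) = x" "word_map S \<alpha> (inv (word_map S \<alpha>) x) = x"
  using bij_word_map[OF assms] by (simp_all add: bij_is_inj bij_is_surj surj_f_inv_f)

lemma inv_word_map_diff:
  assumes "\<alpha> \<in> words0 S"
  shows "inv (word_map S \<alpha>) y - inv (word_map S \<alpha>) z =
    (1 / word_ratio S \<alpha>) *\<^sub>R (transpose (word_rot S \<alpha>) *v (y - z))"
  by (simp add: inv_word_map_eq[OF assms] algebra_simps)

lemma word_map_in_F: "\<alpha> \<in> words0 S \<Longrightarrow> x \<in> F \<Longrightarrow> word_map S \<alpha> x \<in> F"
proof (induction \<alpha>)
  case (Cons i \<alpha>)
  then have "(S ! i) (word_map S \<alpha> x) \<in> (\<Union>i<length S. (S ! i) ` F)" by auto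
  then show ?case using F_eq by simp
qed simp

text \<open>Unfolding the self-similarity of \<open>F\<close> n times puts x into the cylinder of a
  word of length n, whose ratio is at most the n-th power of the largest letter ratio.\<close>

lemma small_cylinder:
  assumes "x \<in> F" "0 < e"
  obtains \<gamma> where "\<gamma> \<in> words0 S" "x \<in> word_map S \<gamma> ` F" "word_ratio S \<gamma> < e"
proof -
  define c where "c = Max ((\<lambda>i. sim_ratio (S ! i)) ` {..<length S})"
  have ne: "(\<lambda>i. sim_ratio (S ! i)) ` {..<length S} \<noteq> {}" using length_pos by auto
  have c: "sim_ratio (S ! i) \<le> c" if "i < length S" for i
    unfolding c_def using that by (intro Max_ge) auto
  have c1: "c < 1" unfolding c_def using ne by (subst Max_less_iff) (auto simp: letter)
  have c0: "0 < c" using c[OF length_pos] letter(1)[OF length_pos] by simp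
  have "\<exists>\<gamma> \<in> words0 S. x \<in> word_map S \<gamma> ` F \<and> word_ratio S \<gamma> \<le> c ^ n" for n
    using assms(1)
  proof (induction n arbitrary: x)
    case (Suc n)
    obtain i y where i: "i < length S" "y \<in> F" "x = (S ! i) y" using Suc.prems by (subst (asm) F_eq) blast
    obtain \<gamma> where g: "\<gamma> \<in> words0 S" "y \<in> word_map S \<gamma> ` F" "word_ratio S \<gamma> \<le> c ^ n"
      using Suc.IH[OF i(2)] by auto
    show ?case
    proof (intro bexI[of _ "i # \<gamma>"] conjI)
      show "word_ratio S (i # \<gamma>) \<le> c ^ Suc n"
        using c[OF i(1)] g(3) c0 letter(1)[OF i(1)] word_ratio_pos[OF g(1)] by (auto intro!: mult_mono)
    qed (use i g in auto)
  qed (auto intro!: bexI[of _ "[]"])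
  moreover obtain n where "c ^ n < e" using real_arch_pow_inv[OF assms(2) c1] by blast
  ultimately show ?thesis using that by (meson le_less_trans)
qed

text \<open>A common suffix conjugates the neighbour map by \<open>word_map S \<gamma>\<close>. The
  displacement is sampled in a small cylinder and divided by its ratio, whereas the Lipschitz
  constant of the displacement does not change; hence conjugation makes it relatively more
  constant.\<close>

lemma overlap_map_append:
  assumes "\<alpha> \<in> words0 S" "\<beta> \<in> words0 S" "\<gamma> \<in> words0 S"
  shows "overlap_map S (\<alpha> @ \<gamma>) (\<beta> @ \<gamma>) x = (1 / word_ratio S \<gamma>) *\<^sub>R
    (transpose (word_rot S \<gamma>) *v overlap_map S \<alpha> \<beta> (word_map S \<gamma> x))"
proof -
  have "inv (word_map S (\<alpha> @ \<gamma>)) = inv (word_map S \<gamma>) \<circ> inv (word_map S \<alpha>)"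
    using bij_word_map assms by (simp add: o_inv_distrib)
  then have "overlap_map S (\<alpha> @ \<gamma>) (\<beta> @ \<gamma>) x =
     inv (word_map S \<gamma>) (inv (word_map S \<alpha>) (word_map S \<beta> (word_map S \<gamma> x))) -
     inv (word_map S \<gamma>) (word_map S \<gamma> x)"
    using assms by (simp add: overlap_map_def)
  then show ?thesis by (simp only: inv_word_map_diff[OF assms(3)]) (simp add: overlap_map_def)
qed

end

section \<open>Recurrence of rotations\<close>

text \<open>\<open>norm A\<close> is the Frobenius norm. The factor comes from bounding a norm by
  the sum of the coordinates; it is crude, but only a constant depending on the dimension is
  used.\<close>

lemma norm_matrix_vector_mult_le:
  fixes A :: "real ^ 'n ^ 'n"
  shows "norm (A *v x) \<le> CARD('n) * (norm A * norm x)"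
proof -
  have "\<bar>(A *v x) $ i\<bar> \<le> norm A * norm x" for i
    unfolding matrix_vector_mul_component
    by (rule order_trans[OF Cauchy_Schwarz_ineq2])
       (simp add: mult_right_mono Finite_Cartesian_Product.norm_nth_le)
  then have "(\<Sum>i\<in>UNIV. \<bar>(A *v x) $ i\<bar>) \<le> (\<Sum>i\<in>(UNIV :: 'n set). norm A * norm x)"
    by (intro sum_mono)
  then show ?thesis using norm_le_l1_cart[of "A *v x"] by simp
qed

lemma bounded_linear_matrix_vector_mult_left:
  "bounded_linear (\<lambda>A :: real ^ 'n ^ 'n. A *v x)"
  by (rule bounded_linear_intro[of _ "CARD('n) * norm x"])
     (use norm_matrix_vector_mult_le[of _ x] in
       \<open>simp_all add: matrix_vector_mult_add_rdistrib scaleR_matrix_vector_assoc ac_simps\<close>)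

lemma norm_orthogonal_matrix_le:
  fixes A :: "real ^ 'n ^ 'n"
  assumes "orthogonal_matrix A"
  shows "norm A \<le> CARD('n)"
proof -
  have "norm (A $ i) \<le> 1" for i
    using assms unfolding orthogonal_matrix_orthonormal_rows by (simp add: row_def vec_lambda_eta)
  then have "(\<Sum>i\<in>UNIV. norm (A $ i)) \<le> (\<Sum>i\<in>(UNIV :: 'n set). 1)"
    by (intro sum_mono)
  then show ?thesis
    unfolding norm_vec_def[of A] using L2_set_le_sum[of UNIV "\<lambda>i. norm (A $ i)"] by simp
qed

text \<open>Successive factors \<open>1 / c\<close> cannot jump over the window from
  \<open>c * B\<close> to \<open>B\<close>. The exponent is the last one before \<open>B\<close> is
  exceeded.\<close>

lemma scale_exponent:
  fixes c s B :: real
  assumes "0 < c" "c < 1" "0 < s" "s \<le> B"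
  shows "\<exists>m. c * B \<le> s / c ^ m \<and> s / c ^ m \<le> B"
proof -
  define P where "P m \<longleftrightarrow> B < s / c ^ Suc m" for m
  have "\<exists>m. P m"
  proof -
    obtain n where "B / s < (1 / c) ^ n" using real_arch_pow[of "1 / c"] assms by auto
    also have "\<dots> \<le> (1 / c) ^ Suc n" by (rule power_increasing) (use assms in auto)
    finally show ?thesis using assms unfolding P_def by (auto simp: field_simps)
  qed
  then have P: "P (LEAST m. P m)" by (rule LeastI_ex)
  define m where "m = (LEAST m. P m)"
  have "B < s / c ^ Suc m" using P unfolding m_def[symmetric] by (simp only: P_def)
  then have 1: "c * B \<le> s / c ^ m" using assms by (auto simp: field_simps)
  have "s / c ^ m \<le> B"
  proof (cases m)
    case (Suc j)
    then have "\<not> P j" unfolding m_def by (metis lessI not_less_Least)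
    then show ?thesis by (simp add: P_def Suc)
  qed (use assms in auto)
  with 1 show ?thesis by blast
qed

lemma frechet_derivative_affine:
  fixes f :: "real ^ 'n \<Rightarrow> real ^ 'm"
  assumes "\<And>x y. f x - f y = M *v (x - y)"
  shows "frechet_derivative f (at a) = (*v) M"
proof -
  have "f = (\<lambda>x. f 0 + M *v x)"
  proof
    fix z show "f z = f 0 + M *v z"
      using assms[of z 0] by (metis add.commute diff_add_cancel diff_zero)
  qed
  moreover have "((\<lambda>x. f 0 + M *v x) has_derivative (*v) M) (at a)"
    by (auto intro!: derivative_eq_intros bounded_linear_imp_has_derivative)
  ultimately show ?thesis by (metis frechet_derivative_at)
qed

context generating_ifs
begin

text \<open>By compactness two different powers of the rotation of h are close. Cancelling the
  smaller power leaves a positive power near the identity, and one factor fewer is an approximate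
  inverse that is again the rotation of a word.\<close>

lemma word_approx_inverse:
  assumes h: "h \<in> words0 S" and "0 < \<eta>"
  shows "\<exists>\<tau>\<in>words0 S. \<forall>x. norm (word_rot S \<tau> *v (word_rot S h *v x) - x) \<le> \<eta> * norm x"
proof -
  define w where "w n = concat (replicate n h)" for n
  have w: "w n \<in> words0 S" for n using h by (induction n) (auto simp: w_def)
  define f where "f n = word_rot S (w n)" for n
  have "bounded (range f)"
    using norm_orthogonal_matrix_le[OF orthogonal_word_rot[OF w]]
    by (auto simp: f_def bounded_iff)
  then obtain l r where r: "strict_mono (r :: nat \<Rightarrow> nat)" "(f \<circ> r) \<longlonglongrightarrow> l"
    using bounded_imp_convergent_subsequence by blast
  define e where "e = \<eta> / CARD('d)"
  have "0 < e" using \<open>0 < \<eta>\<close> by (simp add: e_def)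
  then obtain M where M: "\<And>m n. M \<le> m \<Longrightarrow> M \<le> n \<Longrightarrow> norm ((f \<circ> r) m - (f \<circ> r) n) < e"
    using LIMSEQ_imp_Cauchy[OF r(2)] by (metis CauchyD)
  define p where "p = r M"
  have "r M < r (Suc M)" using r(1) by (simp add: strict_mono_def)
  \<comment> \<open>The gap between the two exponents is written as \<open>Suc j\<close>: one copy
    of h is to be inverted, the other j copies form the inverse.\<close>
  then obtain j where j: "r (Suc M) = p + Suc j"
    unfolding p_def using less_imp_Suc_add[of "r M" "r (Suc M)"] by auto
  have fd: "norm (f (p + Suc j) - f p) < e" using M[of "Suc M" M] j by (simp add: p_def)
  have split: "w (p + Suc j) = w p @ w j @ h"
  proof -
    have "replicate (p + Suc j) h = replicate p h @ (replicate j h @ [h])"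
      by (metis replicate_add replicate_Suc replicate_append_same)
    then show ?thesis by (simp only: w_def concat_append) simp
  qed
  show ?thesis
  proof (intro bexI[of _ "w j"] allI)
    fix x
    have "norm (word_rot S (w j) *v (word_rot S h *v x) - x) =
        norm (f p *v (word_rot S (w j) *v (word_rot S h *v x) - x))"
      by (simp add: f_def orthogonal_matrix_norm[OF orthogonal_word_rot[OF w]])
    also have "\<dots> = norm ((f (p + Suc j) - f p) *v x)"
      unfolding f_def split
      by (simp add: algebra_simps matrix_vector_mul_assoc)
    also have "\<dots> \<le> CARD('d) * (norm (f (p + Suc j) - f p) * norm x)"
      by (rule norm_matrix_vector_mult_le)
    also have "\<dots> \<le> CARD('d) * (e * norm x)"
      using fd by (intro mult_left_mono mult_right_mono) auto
    finally show "norm (word_rot S (w j) *v (word_rot S h *v x) - x) \<le> \<eta> * norm x"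
      by (simp add: e_def)
  qed (rule w)
qed

text \<open>Rotations of words have compact closure, so approximate inverses at finitely many
  centres serve all words. Finiteness bounds the ratios of the correcting words away from 0,
  uniformly in h; this bound enters the constant \<open>\<kappa>\<close> of
  \<open>translation_dir\<close>.\<close>

lemma word_approx_inverse_finite:
  assumes "0 < \<eta>"
  obtains N where "finite N" "N \<subseteq> words0 S"
    "\<And>h. h \<in> words0 S \<Longrightarrow>
      \<exists>\<tau>\<in>N. \<forall>x. norm (word_rot S \<tau> *v (word_rot S h *v x) - x) \<le> \<eta> * norm x"
proof -
  define e where "e = \<eta> / 2 / CARD('d)"
  have e: "0 < e" using assms by (simp add: e_def)
  let ?O = "word_rot S ` words0 S"
  have [simp]: "bounded ?O"
    using norm_orthogonal_matrix_le[OF orthogonal_word_rot] by (auto simp: bounded_iff)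
  have cov: "closure ?O \<subseteq> (\<Union>\<alpha>\<in>words0 S. ball (word_rot S \<alpha>) e)"
  proof
    fix A assume "A \<in> closure ?O"
    then obtain \<alpha> where "\<alpha> \<in> words0 S" "dist (word_rot S \<alpha>) A < e"
      using e unfolding closure_approachable by blast
    then show "A \<in> (\<Union>\<alpha>\<in>words0 S. ball (word_rot S \<alpha>) e)" by auto
  qed
  obtain N0 where N0: "N0 \<subseteq> words0 S" "finite N0"
      "closure ?O \<subseteq> (\<Union>\<alpha>\<in>N0. ball (word_rot S \<alpha>) e)"
    by (rule compactE_image[of "closure ?O" "words0 S" "\<lambda>\<alpha>. ball (word_rot S \<alpha>) e"])
       (use cov in auto)
  \<comment> \<open>Half of \<open>\<eta>\<close> pays for inverting the centre n, the other half
    for replacing h by n.\<close>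
  have "\<forall>n\<in>N0. \<exists>\<tau>\<in>words0 S. \<forall>x. norm (word_rot S \<tau> *v (word_rot S n *v x) - x) \<le> \<eta> / 2 * norm x"
    using word_approx_inverse[of _ "\<eta> / 2"] N0(1) assms by auto
  then obtain q where q': "\<forall>n\<in>N0. q n \<in> words0 S \<and>
      (\<forall>x. norm (word_rot S (q n) *v (word_rot S n *v x) - x) \<le> \<eta> / 2 * norm x)"
    using bchoice[of N0 "\<lambda>n \<tau>. \<tau> \<in> words0 S \<and>
      (\<forall>x. norm (word_rot S \<tau> *v (word_rot S n *v x) - x) \<le> \<eta> / 2 * norm x)"] by blast
  then have q: "\<And>n. n \<in> N0 \<Longrightarrow> q n \<in> words0 S"
    "\<And>n x. n \<in> N0 \<Longrightarrow> norm (word_rot S (q n) *v (word_rot S n *v x) - x) \<le> \<eta> / 2 * norm x"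
    by blast+
  show ?thesis
  proof (rule that[of "q ` N0"])
    fix h assume h: "h \<in> words0 S"
    then have "word_rot S h \<in> ?O" by (rule imageI)
    then have "word_rot S h \<in> closure ?O" by (rule subsetD[OF closure_subset])
    then obtain n where n: "n \<in> N0" "norm (word_rot S h - word_rot S n) < e"
      using N0(3) by (auto simp: dist_norm norm_minus_commute)
    have "norm (word_rot S (q n) *v (word_rot S h *v x) - x) \<le> \<eta> * norm x" for x
    proof -
      have "word_rot S (q n) *v (word_rot S h *v x) - x =
          word_rot S (q n) *v ((word_rot S h - word_rot S n) *v x)
          + (word_rot S (q n) *v (word_rot S n *v x) - x)"
        by (simp add: algebra_simps)
      also have "norm \<dots> \<le> norm ((word_rot S h - word_rot S n) *v x) + \<eta> / 2 * norm x"
        using q[OF n(1)] by (intro norm_triangle_mono)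
          (simp_all add: orthogonal_matrix_norm[OF orthogonal_word_rot])
      also have "norm ((word_rot S h - word_rot S n) *v x)
          \<le> CARD('d) * (norm (word_rot S h - word_rot S n) * norm x)"
        by (rule norm_matrix_vector_mult_le)
      also have "\<dots> \<le> CARD('d) * (e * norm x)"
        using n(2) by (intro mult_left_mono mult_right_mono) auto
      also have "\<dots> = \<eta> / 2 * norm x" by (simp add: e_def)
      finally show ?thesis by simp
    qed
    then show "\<exists>\<tau>\<in>q ` N0. \<forall>x. norm (word_rot S \<tau> *v (word_rot S h *v x) - x) \<le> \<eta> * norm x"
      using n(1) by blast
  qed (use q N0 in auto)
qed

section \<open>Overlapping directions and near translations\<close>

text \<open>Both errors are relative to the size \<open>\<delta>\<close> of the displacement. The
  bound on \<open>F\<close> is what composition of steps uses; the Lipschitz bound serves to recover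
  the derivative condition of \<open>overlapping_direction\<close>.\<close>

definition near_translation :: "real \<Rightarrow> real \<Rightarrow> real ^ 'd \<Rightarrow> nat list \<Rightarrow> nat list \<Rightarrow> bool" where
  "near_translation \<eta> \<delta> v \<alpha> \<beta> \<longleftrightarrow> \<alpha> \<in> words S \<and> \<beta> \<in> words S \<and>
     (\<forall>x\<in>F. norm (overlap_map S \<alpha> \<beta> x - \<delta> *\<^sub>R v) \<le> \<eta> * \<delta>) \<and>
     (\<forall>x y. norm (overlap_map S \<alpha> \<beta> x - overlap_map S \<alpha> \<beta> y) \<le> \<eta> * \<delta> * norm (x - y))"

text \<open>The size of the displacement can be prescribed up to a factor that depends on the relative
  error only. This is what allows steps in direction \<open>u\<close> to add up to a given length; uniformity
  in \<open>g\<close> is needed because each step has to compensate for the rotation of the previous blow-up.\<close>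

definition translation_dir :: "real ^ 'd \<Rightarrow> bool" where
  "translation_dir u \<longleftrightarrow> (\<forall>\<eta>>0. \<exists>\<kappa>>0. \<forall>g\<in>words0 S. \<forall>\<delta>0>0. \<exists>\<delta> \<alpha> \<beta>.
     \<kappa> * \<delta>0 \<le> \<delta> \<and> \<delta> \<le> \<delta>0 \<and> near_translation \<eta> \<delta> (word_rot S g *v u) \<alpha> \<beta>)"

lemma translation_dirE:
  assumes "translation_dir u" "0 < \<eta>"
  obtains \<kappa> where "0 < \<kappa>" "\<forall>g\<in>words0 S. \<forall>\<delta>0>0. \<exists>\<delta> \<alpha> \<beta>.
     \<kappa> * \<delta>0 \<le> \<delta> \<and> \<delta> \<le> \<delta>0 \<and> near_translation \<eta> \<delta> (word_rot S g *v u) \<alpha> \<beta>"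
proof -
  have "\<exists>\<kappa>>0. \<forall>g\<in>words0 S. \<forall>\<delta>0>0. \<exists>\<delta> \<alpha> \<beta>.
     \<kappa> * \<delta>0 \<le> \<delta> \<and> \<delta> \<le> \<delta>0 \<and> near_translation \<eta> \<delta> (word_rot S g *v u) \<alpha> \<beta>"
    using assms by (simp add: translation_dir_def)
  then show ?thesis using that by blast
qed

text \<open>The quantifier over all words g absorbs \<open>\<tau>\<close>: the definition is applied
  to \<open>g @ \<tau>\<close>, with the same \<open>\<kappa>\<close>.\<close>

lemma translation_dir_rot:
  assumes "translation_dir u" "\<tau> \<in> words0 S"
  shows "translation_dir (word_rot S \<tau> *v u)"
  unfolding translation_dir_def
proof (intro allI impI)
  fix \<eta> :: real assume "0 < \<eta>"
  obtain \<kappa> where "0 < \<kappa>"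
    and \<kappa>: "\<forall>g\<in>words0 S. \<forall>\<delta>0>0. \<exists>\<delta> \<alpha> \<beta>.
      \<kappa> * \<delta>0 \<le> \<delta> \<and> \<delta> \<le> \<delta>0 \<and> near_translation \<eta> \<delta> (word_rot S g *v u) \<alpha> \<beta>"
    using translation_dirE[OF assms(1) \<open>0 < \<eta>\<close>] by blast
  show "\<exists>\<kappa>>0. \<forall>g\<in>words0 S. \<forall>\<delta>0>0. \<exists>\<delta> \<alpha> \<beta>. \<kappa> * \<delta>0 \<le> \<delta> \<and> \<delta> \<le> \<delta>0 \<and>
     near_translation \<eta> \<delta> (word_rot S g *v (word_rot S \<tau> *v u)) \<alpha> \<beta>"
  proof (rule exI[of _ \<kappa>], intro conjI ballI allI impI)
    fix g and \<delta>0 :: real assume "g \<in> words0 S" "0 < \<delta>0"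
    with \<kappa>[rule_format, of "g @ \<tau>" \<delta>0] assms(2) show "\<exists>\<delta> \<alpha> \<beta>. \<kappa> * \<delta>0 \<le> \<delta> \<and> \<delta> \<le> \<delta>0 \<and>
        near_translation \<eta> \<delta> (word_rot S g *v (word_rot S \<tau> *v u)) \<alpha> \<beta>"
      by (simp add: matrix_vector_mul_assoc)
  qed (rule \<open>0 < \<kappa>\<close>)
qed

lemma overlap_map_affine:
  assumes "\<alpha> \<in> words0 S" "\<beta> \<in> words0 S"
  obtains M where "\<And>x y. overlap_map S \<alpha> \<beta> x - overlap_map S \<alpha> \<beta> y = M *v (x - y)"
proof -
  define M where "M = (word_ratio S \<beta> / word_ratio S \<alpha>) *\<^sub>R
     (transpose (word_rot S \<alpha>) ** word_rot S \<beta>) - mat 1"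
  have "overlap_map S \<alpha> \<beta> x - overlap_map S \<alpha> \<beta> y = M *v (x - y)" for x y
  proof -
    have "overlap_map S \<alpha> \<beta> x - overlap_map S \<alpha> \<beta> y =
      (inv (word_map S \<alpha>) (word_map S \<beta> x) - inv (word_map S \<alpha>) (word_map S \<beta> y)) - (x - y)"
      by (simp add: overlap_map_def)
    also have "\<dots> = M *v (x - y)"
      by (simp only: inv_word_map_diff[OF assms(1)] word_map_diff[OF assms(2)])
        (simp add: M_def matrix_vector_mult_scaleR matrix_vector_mult_diff_rdistrib
          matrix_vector_mul_assoc flip: scaleR_matrix_vector_assoc)
    finally show ?thesis .
  qed
  then show ?thesis by (rule that)
qed

text \<open>An affine map is determined by its values at 0 and at the unit vectors, which are
  vertices of the cube. Smallness on the cube therefore gives smallness at any fixed point.\<close>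

lemma norm_overlap_map_le_cube_sup:
  assumes "\<alpha> \<in> words0 S" "\<beta> \<in> words0 S"
  shows "x \<in> cbox 0 1 \<Longrightarrow> norm (overlap_map S \<alpha> \<beta> x) \<le> cube_sup_norm (overlap_map S \<alpha> \<beta>)"
    and "norm (overlap_map S \<alpha> \<beta> a) \<le>
      (1 + 2 * (\<Sum>i\<in>UNIV. \<bar>a $ i\<bar>)) * cube_sup_norm (overlap_map S \<alpha> \<beta>)"
proof -
  obtain M where M: "\<And>x y. overlap_map S \<alpha> \<beta> x - overlap_map S \<alpha> \<beta> y = M *v (x - y)"
    using overlap_map_affine[OF assms] by blast
  let ?\<Phi> = "overlap_map S \<alpha> \<beta>" and ?s = "cube_sup_norm (overlap_map S \<alpha> \<beta>)"
  define e where "e = ?\<Phi> 0"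
  have eq: "?\<Phi> x = e + M *v x" for x using M[of x 0] unfolding e_def
    by (metis add.commute diff_add_cancel diff_zero)
  have "continuous_on (cbox 0 1) (\<lambda>x. norm (?\<Phi> x))"
    unfolding eq by (intro continuous_intros matrix_vector_mult_linear_continuous_on)
  then have "bdd_above ((\<lambda>x. norm (?\<Phi> x)) ` cbox 0 1)"
    by (intro bounded_imp_bdd_above compact_imp_bounded compact_continuous_image compact_cbox)
  then show *: "norm (?\<Phi> x) \<le> ?s" if "x \<in> cbox 0 1" for x
    unfolding cube_sup_norm_def by (rule cSUP_upper2[OF _ that]) auto
  have 0: "norm (?\<Phi> 0) \<le> ?s" by (rule *) (simp add: mem_box_cart)
  have ax: "norm (M *v axis i 1) \<le> 2 * ?s" for i
  proof -
    have "axis i 1 \<in> cbox 0 (1 :: real ^ 'd)" by (auto simp: mem_box_cart axis_def)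
    from *[OF this] 0 M[of "axis i 1" 0] show ?thesis
      using norm_triangle_ineq4[of "?\<Phi> (axis i 1)" "?\<Phi> 0"] by simp
  qed
  have "M *v a = M *v (\<Sum>i\<in>UNIV. a $ i *\<^sub>R axis i 1)"
    using basis_expansion[of a] by (simp add: scalar_mult_eq_scaleR)
  also have "\<dots> = (\<Sum>i\<in>UNIV. a $ i *\<^sub>R (M *v axis i 1))"
    by (simp add: linear_sum matrix_vector_mult_scaleR)
  also have "norm \<dots> \<le> (\<Sum>i\<in>UNIV. \<bar>a $ i\<bar> * (2 * ?s))"
    by (rule sum_norm_le) (use ax in \<open>auto intro: mult_left_mono\<close>)
  finally have "norm (M *v a) \<le> 2 * (\<Sum>i\<in>UNIV. \<bar>a $ i\<bar>) * ?s"
    by (simp add: sum_distrib_right mult.assoc mult.left_commute sum_distrib_left)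
  moreover have "norm (?\<Phi> a) \<le> norm (?\<Phi> 0) + norm (M *v a)"
    unfolding eq by (simp add: norm_triangle_ineq)
  ultimately show "norm (?\<Phi> a) \<le> (1 + 2 * (\<Sum>i\<in>UNIV. \<bar>a $ i\<bar>)) * ?s"
    using 0 by (simp add: distrib_right)
qed

text \<open>Conjugating \<open>\<Phi> k\<close> by a word \<open>\<gamma>\<close> through \<open>a\<close> makes it nearly constant, conjugating by powers of
  the first letter adjusts its size, and a final conjugation, taken from a finite set because
  rotations recur, restores the direction.\<close>

lemma overlapping_direction_imp_translation_dir:
  assumes "overlapping_direction S F \<omega>"
  shows "translation_dir \<omega>"
proof -
  obtain \<alpha> \<beta> :: "nat \<Rightarrow> nat list" and \<Phi> :: "nat \<Rightarrow> (real ^ 'd) \<Rightarrow> (real ^ 'd)" and a \<rho> x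
     and s :: "nat \<Rightarrow> nat" where "\<omega> \<in> sphere 0 1"
    and w': "\<forall>k. \<alpha> k \<in> words S \<and> \<beta> k \<in> words S \<and> \<Phi> k = overlap_map S (\<alpha> k) (\<beta> k)"
    and pos: "\<forall>k. 0 < cube_sup_norm (\<Phi> k)"
    and lim: "(\<lambda>k. cube_sup_norm (\<Phi> k)) \<longlonglongrightarrow> 0"
    and a: "a \<in> F" and \<rho>: "0 < \<rho>"
    and x': "\<forall>k. x k \<in> cball a \<rho> \<and> (\<forall>y \<in> cball a \<rho>. norm (\<Phi> k (x k)) \<le> norm (\<Phi> k y))"
    and D: "\<forall>k. \<rho> * onorm (frechet_derivative (\<Phi> k) (at a)) \<le> norm (\<Phi> k (x k))"
    and s: "strict_mono s"
    and dir: "((\<lambda>k. \<Phi> k a /\<^sub>R norm (\<Phi> k a)) \<circ> s) \<longlonglongrightarrow> \<omega>"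
    using assms unfolding overlapping_direction_def
    by (elim conjE exE) blast
  have \<omega>: "norm \<omega> = 1" using \<open>\<omega> \<in> sphere 0 1\<close> by simp
  have w: "\<alpha> k \<in> words S" "\<beta> k \<in> words S" and \<Phi>: "\<Phi> k = overlap_map S (\<alpha> k) (\<beta> k)" for k
    using w' by auto
  have x: "norm (\<Phi> k (x k)) \<le> norm (\<Phi> k a)" for k using x' \<rho> by simp
  have w0: "\<alpha> k \<in> words0 S" "\<beta> k \<in> words0 S" for k using w words_iff by blast+
  \<comment> \<open>The derivative is controlled by the minimum of the norm over the ball around a,
    hence by the value at its centre a.\<close>
  have lip: "\<rho> * norm (\<Phi> k y - \<Phi> k z) \<le> norm (\<Phi> k a) * norm (y - z)" for k y z
  proof -
    obtain M where M: "\<And>x y. \<Phi> k x - \<Phi> k y = M *v (x - y)"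
      using overlap_map_affine[OF w0] \<Phi> by metis
    have "frechet_derivative (\<Phi> k) (at a) = (*v) M"
      using M by (rule frechet_derivative_affine)
    with D[rule_format, of k] x[of k] have "\<rho> * onorm ((*v) M) \<le> norm (\<Phi> k a)" by simp
    moreover have "norm (\<Phi> k y - \<Phi> k z) \<le> onorm ((*v) M) * norm (y - z)"
      unfolding M by (rule onorm) auto
    ultimately have "\<rho> * norm (\<Phi> k y - \<Phi> k z) \<le> \<rho> * onorm ((*v) M) * norm (y - z)"
      and "\<rho> * onorm ((*v) M) * norm (y - z) \<le> norm (\<Phi> k a) * norm (y - z)"
      using \<rho> by (simp add: mult.assoc, blast intro: mult_right_mono norm_ge_zero)
    then show ?thesis by linarith
  qed
  \<comment> \<open>If the value at a vanished, \<open>lip\<close> would make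
    \<open>\<Phi> k\<close> vanish identically, against the positive sup norm.\<close>
  have apos: "0 < norm (\<Phi> k a)" for k
  proof (rule ccontr)
    assume "\<not> 0 < norm (\<Phi> k a)"
    then have 0: "\<Phi> k a = 0" by simp
    have "\<Phi> k y = 0" for y
    proof -
      have "\<rho> * norm (\<Phi> k y) \<le> 0" using lip[of k y a] 0 by simp
      then show ?thesis using \<rho> by (simp add: mult_le_0_iff)
    qed
    moreover have "(0 :: real ^ 'd) \<in> cbox 0 1" by (simp add: mem_box_cart)
    then have "cbox 0 (1 :: real ^ 'd) \<noteq> {}" by blast
    ultimately have "cube_sup_norm (\<Phi> k) = 0" by (simp add: cube_sup_norm_def)
    with pos[rule_format, of k] show False by simp
  qed
  have alim: "(\<lambda>k. norm (\<Phi> k a)) \<longlonglongrightarrow> 0"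
  proof (rule tendsto_sandwich[OF _ _ tendsto_const])
    show "(\<lambda>k. (1 + 2 * (\<Sum>i\<in>UNIV. \<bar>a $ i\<bar>)) * cube_sup_norm (\<Phi> k)) \<longlonglongrightarrow> 0"
      using tendsto_mult_right_zero[OF lim] by simp
  qed (use norm_overlap_map_le_cube_sup(2)[OF w0] \<Phi> in auto)
  obtain Df where Df: "0 < Df" "\<And>x y. x \<in> F \<Longrightarrow> y \<in> F \<Longrightarrow> norm (x - y) \<le> Df"
    using F_diff_bound by metis
  show ?thesis unfolding translation_dir_def
  proof (intro allI impI)
    fix \<eta>' :: real assume "0 < \<eta>'"
    \<comment> \<open>A third of the error is spent on each of: the variation of
      \<open>\<Phi> k\<close> over a cylinder, the distance of its normalized value at a from
      \<open>\<omega>\<close>, and the rotation left over after correction.\<close>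
    define \<eta> where "\<eta> = \<eta>' / 3"
    have \<eta>: "0 < \<eta>" "\<eta>' = 3 * \<eta>" using \<open>0 < \<eta>'\<close> by (simp_all add: \<eta>_def)
    \<comment> \<open>The bound \<open>\<eta> * \<rho> / Df\<close> makes \<open>\<Phi> k\<close>
      nearly constant on the cylinder of \<open>\<gamma>\<close>; the bound
      \<open>\<eta> * \<rho>\<close> gives the relative Lipschitz estimate after
      conjugation.\<close>
    obtain \<gamma> where \<gamma>: "\<gamma> \<in> words0 S" "a \<in> word_map S \<gamma> ` F"
        "word_ratio S \<gamma> < min (\<eta> * \<rho>) (\<eta> * \<rho> / Df)"
      using small_cylinder[OF a, of "min (\<eta> * \<rho>) (\<eta> * \<rho> / Df)"] \<eta> \<rho> Df(1) by auto
    obtain N where N: "finite N" "N \<subseteq> words0 S" "\<And>h. h \<in> words0 S \<Longrightarrow>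
        \<exists>\<tau>\<in>N. \<forall>x. norm (word_rot S \<tau> *v (word_rot S h *v x) - x) \<le> \<eta> * norm x"
      using word_approx_inverse_finite[OF \<eta>(1)] by metis
    have "N \<noteq> {}" using N(3)[of "[]"] by auto
    \<comment> \<open>The correcting word will magnify by an unknown factor between 1 and
      \<open>1 / \<kappa>'\<close>, so the length is first adjusted to the target
      \<open>\<kappa>' * \<delta>0\<close> instead of \<open>\<delta>0\<close>.\<close>
    define \<kappa>' where "\<kappa>' = Min (word_ratio S ` N)"
    have \<kappa>': "0 < \<kappa>'" "\<And>\<tau>. \<tau> \<in> N \<Longrightarrow> \<kappa>' \<le> word_ratio S \<tau>"
      using N(1,2) \<open>N \<noteq> {}\<close> word_ratio_pos by (auto simp: \<kappa>'_def subset_iff)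
    define c where "c = sim_ratio (S ! 0)"
    have c: "0 < c" "c < 1" using letter length_pos by (auto simp: c_def)
    show "\<exists>\<kappa>>0. \<forall>g\<in>words0 S. \<forall>\<delta>0>0. \<exists>\<delta> \<alpha> \<beta>.
      \<kappa> * \<delta>0 \<le> \<delta> \<and> \<delta> \<le> \<delta>0 \<and> near_translation \<eta>' \<delta> (word_rot S g *v \<omega>) \<alpha> \<beta>"
    proof (rule exI[of _ "c * \<kappa>'"], intro conjI ballI allI impI)
      fix g and \<delta>0 :: real assume g: "g \<in> words0 S" and \<delta>0: "0 < \<delta>0"
      have r\<gamma>: "0 < word_ratio S \<gamma>" using \<gamma> word_ratio_pos by blast
      have "\<forall>\<^sub>F j in sequentially. norm (\<Phi> (s j) a) < word_ratio S \<gamma> * (\<kappa>' * \<delta>0)"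
        using LIMSEQ_subseq_LIMSEQ[OF alim s] r\<gamma> \<kappa>'(1) \<delta>0
        by (intro order_tendstoD(2)[of _ 0]) (auto simp: comp_def)
      moreover have "\<forall>\<^sub>F j in sequentially. dist (\<Phi> (s j) a /\<^sub>R norm (\<Phi> (s j) a)) \<omega> < \<eta>"
        using tendstoD[OF dir \<eta>(1)] by (simp add: comp_def)
      ultimately have "\<forall>\<^sub>F j in sequentially. norm (\<Phi> (s j) a) < word_ratio S \<gamma> * (\<kappa>' * \<delta>0) \<and>
        dist (\<Phi> (s j) a /\<^sub>R norm (\<Phi> (s j) a)) \<omega> < \<eta>" by (rule eventually_conj)
      then obtain k where k: "norm (\<Phi> k a) < word_ratio S \<gamma> * (\<kappa>' * \<delta>0)"
        "norm (\<Phi> k a /\<^sub>R norm (\<Phi> k a) - \<omega>) \<le> \<eta>"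
        unfolding eventually_sequentially by (metis dist_norm less_imp_le order_refl)
      \<comment> \<open>Each repetition of letter 0 in the suffix divides the length by c.\<close>
      obtain m where m: "c * (\<kappa>' * \<delta>0) \<le> norm (\<Phi> k a) / word_ratio S \<gamma> / c ^ m"
        "norm (\<Phi> k a) / word_ratio S \<gamma> / c ^ m \<le> \<kappa>' * \<delta>0"
        using scale_exponent[of c "norm (\<Phi> k a) / word_ratio S \<gamma>" "\<kappa>' * \<delta>0"] c r\<gamma> apos[of k] k(1)
        by (auto simp: field_simps)
      define \<sigma> where "\<sigma> = \<gamma> @ replicate m 0"
      have \<sigma>: "\<sigma> \<in> words0 S" using \<gamma>(1) length_pos by (auto simp: \<sigma>_def)
      have "word_ratio S (replicate m 0) = c ^ m" by (induction m) (auto simp: c_def)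
      then have r\<sigma>: "word_ratio S \<sigma> = word_ratio S \<gamma> * c ^ m" by (simp add: \<sigma>_def)
      obtain \<tau> where \<tau>: "\<tau> \<in> N"
        "\<And>x. norm (word_rot S \<tau> *v (word_rot S (g @ \<sigma>) *v x) - x) \<le> \<eta> * norm x"
        using N(3)[of "g @ \<sigma>"] g \<sigma> by auto
      have \<tau>0: "\<tau> \<in> words0 S" using \<tau>(1) N(2) by blast
      define \<zeta> where "\<zeta> = \<sigma> @ \<tau>"
      have \<zeta>: "\<zeta> \<in> words0 S" using \<sigma> \<tau>0 by (simp add: \<zeta>_def)
      define r where "r = word_ratio S \<zeta>"
      have r: "0 < r" "r = word_ratio S \<gamma> * c ^ m * word_ratio S \<tau>" "r \<le> word_ratio S \<gamma>"
      proof -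
        show "0 < r" using \<zeta> word_ratio_pos by (simp add: r_def)
        show eq: "r = word_ratio S \<gamma> * c ^ m * word_ratio S \<tau>" by (simp add: r_def \<zeta>_def r\<sigma>)
        have "c ^ m * word_ratio S \<tau> \<le> 1"
          using c word_ratio_le_1[OF \<tau>0] word_ratio_pos[OF \<tau>0] by (intro mult_le_one power_le_one) auto
        then show "r \<le> word_ratio S \<gamma>" using r\<gamma> mult_left_le[of _ "word_ratio S \<gamma>"] eq
          by (simp add: mult.assoc)
      qed
      define \<delta> where "\<delta> = norm (\<Phi> k a) / r"
      have \<delta>_eq: "\<delta> = norm (\<Phi> k a) / word_ratio S \<gamma> / c ^ m / word_ratio S \<tau>"
        by (simp add: \<delta>_def r(2))
      have r\<tau>: "0 < word_ratio S \<tau>" "word_ratio S \<tau> \<le> 1" "\<kappa>' \<le> word_ratio S \<tau>"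
        using \<tau>0 word_ratio_pos word_ratio_le_1 \<kappa>'(2)[OF \<tau>(1)] by auto
      have \<delta>l: "c * \<kappa>' * \<delta>0 \<le> \<delta>"
      proof -
        have "c * \<kappa>' * \<delta>0 \<le> norm (\<Phi> k a) / word_ratio S \<gamma> / c ^ m" using m(1) by (simp add: mult.assoc)
        also have "\<dots> \<le> \<delta>" unfolding \<delta>_eq
          using r\<tau> r\<gamma> c by (intro mult_imp_le_div_pos mult_left_le) auto
        finally show ?thesis .
      qed
      have \<delta>u: "\<delta> \<le> \<delta>0"
      proof -
        have "\<delta> \<le> \<kappa>' * \<delta>0 / word_ratio S \<tau>" unfolding \<delta>_eq
          using m(2) r\<tau>(1) by (intro divide_right_mono) auto
        also have "\<dots> \<le> \<delta>0" using r\<tau> \<delta>0 \<kappa>'(1) by (simp add: divide_simps mult.commute mult_left_mono)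
        finally show ?thesis .
      qed
      have ov: "overlap_map S (\<alpha> k @ \<zeta>) (\<beta> k @ \<zeta>) y =
          (1 / r) *\<^sub>R (transpose (word_rot S \<zeta>) *v \<Phi> k (word_map S \<zeta> y))" for y
        using overlap_map_append[OF w0 \<zeta>] \<Phi> by (simp add: r_def)
      have orth: "orthogonal_matrix (word_rot S \<zeta>)" "orthogonal_matrix (word_rot S \<sigma>)"
        using orthogonal_word_rot \<zeta> \<sigma> by auto
      have rot: "norm (word_rot S \<zeta> *v (word_rot S g *v \<omega>) - \<omega>) \<le> \<eta>"
      proof -
        \<comment> \<open>Recurrence makes the product of the rotations of \<open>\<tau>\<close>, g,
          \<open>\<sigma>\<close>, in this order, nearly the identity; the order wanted is
          \<open>\<sigma>\<close>, \<open>\<tau>\<close>, g. Conjugation by the rotation of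
          \<open>\<sigma>\<close> permutes the factors cyclically, which is why the estimate is
          applied to \<open>?v\<close>.\<close>
        let ?v = "transpose (word_rot S \<sigma>) *v \<omega>"
        have "norm (word_rot S \<zeta> *v (word_rot S g *v \<omega>) - \<omega>) =
            norm (word_rot S \<sigma> *v (word_rot S \<tau> *v (word_rot S (g @ \<sigma>) *v ?v) - ?v))"
          by (simp add: \<zeta>_def algebra_simps orthogonal_matrix_cancel[OF orth(2)]
              flip: matrix_vector_mul_assoc)
        also have "\<dots> \<le> \<eta> * norm ?v" using \<tau>(2)[of ?v] by (simp add: orthogonal_matrix_norm[OF orth(2)])
        also have "\<dots> = \<eta>" using orth(2) \<omega> by (simp add: orthogonal_matrix_norm)
        finally show ?thesis .
      qed
      have near: "norm (overlap_map S (\<alpha> k @ \<zeta>) (\<beta> k @ \<zeta>) y - \<delta> *\<^sub>R (word_rot S g *v \<omega>)) \<le> \<eta>' * \<delta>"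
        if y: "y \<in> F" for y
      proof -
        let ?z = "word_map S \<zeta> y" and ?n = "norm (\<Phi> k a)"
          and ?g = "word_rot S \<zeta> *v (word_rot S g *v \<omega>)"
        obtain a' where a': "a' \<in> F" "a = word_map S \<gamma> a'" using \<gamma>(2) by blast
        define y' where "y' = word_map S (replicate m 0 @ \<tau>) y"
        have y': "y' \<in> F" "?z = word_map S \<gamma> y'"
          unfolding y'_def using \<tau>0 length_pos y
          by (auto simp: \<zeta>_def \<sigma>_def simp del: word_map_simps(2,3) intro!: word_map_in_F)
            (simp add: comp_assoc)
        have "norm (?z - a) = word_ratio S \<gamma> * norm (y' - a')"
          unfolding y'(2) a'(2) by (rule norm_word_map_diff[OF \<gamma>(1)])
        also have "\<dots> \<le> word_ratio S \<gamma> * Df" using Df(2)[OF y'(1) a'(1)] r\<gamma> by simp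
        also have "\<dots> \<le> \<eta> * \<rho>" using \<gamma>(3) Df(1) by (simp add: field_simps)
        finally have "?n * norm (?z - a) \<le> \<rho> * (?n * \<eta>)"
          using mult_left_mono[of "norm (?z - a)" "\<eta> * \<rho>" ?n] by (simp add: ac_simps)
        then have "\<rho> * norm (\<Phi> k ?z - \<Phi> k a) \<le> \<rho> * (?n * \<eta>)"
          using lip[of k ?z a] by linarith
        then have e1: "norm (\<Phi> k ?z - \<Phi> k a) \<le> ?n * \<eta>" using \<rho> by simp
        have e2: "norm (\<Phi> k a - ?n *\<^sub>R \<omega>) \<le> ?n * \<eta>"
        proof -
          have "\<Phi> k a - ?n *\<^sub>R \<omega> = ?n *\<^sub>R (\<Phi> k a /\<^sub>R ?n - \<omega>)"
            using apos[of k] by (simp add: algebra_simps)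
          then show ?thesis using k(2) by (simp add: mult_left_mono)
        qed
        have e3: "norm (?n *\<^sub>R \<omega> - ?n *\<^sub>R ?g) \<le> ?n * \<eta>"
          using rot by (simp add: norm_minus_commute mult_left_mono flip: scaleR_diff_right)
        have "\<Phi> k ?z - ?n *\<^sub>R ?g =
            (\<Phi> k ?z - \<Phi> k a) + (\<Phi> k a - ?n *\<^sub>R \<omega>) + (?n *\<^sub>R \<omega> - ?n *\<^sub>R ?g)" by simp
        also have "norm \<dots> \<le> ?n * \<eta> + ?n * \<eta> + ?n * \<eta>"
          by (intro norm_triangle_mono e1 e2 e3)
        finally have e: "norm (\<Phi> k ?z - ?n *\<^sub>R ?g) \<le> \<eta>' * ?n" by (simp add: \<eta>)
        have "overlap_map S (\<alpha> k @ \<zeta>) (\<beta> k @ \<zeta>) y - \<delta> *\<^sub>R (word_rot S g *v \<omega>) =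
            (1 / r) *\<^sub>R (transpose (word_rot S \<zeta>) *v (\<Phi> k ?z - ?n *\<^sub>R ?g))"
          unfolding ov
          by (simp add: \<delta>_def algebra_simps orthogonal_matrix_cancel[OF orth(1)])
        also have "norm \<dots> = norm (\<Phi> k ?z - ?n *\<^sub>R ?g) / r"
          using orth(1) r(1) by (simp add: orthogonal_matrix_norm)
        also have "\<dots> \<le> \<eta>' * \<delta>" using e r(1) by (simp add: \<delta>_def divide_right_mono)
        finally show ?thesis .
      qed
      have lipn: "norm (overlap_map S (\<alpha> k @ \<zeta>) (\<beta> k @ \<zeta>) y - overlap_map S (\<alpha> k @ \<zeta>) (\<beta> k @ \<zeta>) z)
          \<le> \<eta>' * \<delta> * norm (y - z)" for y z
      proof -
        let ?d = "\<Phi> k (word_map S \<zeta> y) - \<Phi> k (word_map S \<zeta> z)" and ?n = "norm (\<Phi> k a)"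
        have "overlap_map S (\<alpha> k @ \<zeta>) (\<beta> k @ \<zeta>) y - overlap_map S (\<alpha> k @ \<zeta>) (\<beta> k @ \<zeta>) z
            = (1 / r) *\<^sub>R (transpose (word_rot S \<zeta>) *v ?d)"
          unfolding ov by (simp add: algebra_simps)
        then have 1: "norm (overlap_map S (\<alpha> k @ \<zeta>) (\<beta> k @ \<zeta>) y -
            overlap_map S (\<alpha> k @ \<zeta>) (\<beta> k @ \<zeta>) z) = norm ?d / r"
          using orth(1) r(1) by (simp add: orthogonal_matrix_norm)
        have "\<rho> * norm ?d \<le> ?n * (r * norm (y - z))"
          using lip[of k "word_map S \<zeta> y" "word_map S \<zeta> z"] norm_word_map_diff[OF \<zeta>, of y z]
          by (simp add: r_def)
        \<comment> \<open>Here \<open>r\<close> is smaller than \<open>\<eta> * \<rho>\<close>.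
          After division by \<open>r\<close> this turns the Lipschitz constant
          \<open>?n / \<rho>\<close> of \<open>\<Phi> k\<close> into a bound by
          \<open>\<eta> * \<delta>\<close>.\<close>
        also have "\<dots> \<le> ?n * ((\<eta> * \<rho>) * norm (y - z))"
          using r(3) \<gamma>(3) by (intro mult_left_mono mult_right_mono) auto
        finally have "\<rho> * norm ?d \<le> \<rho> * (\<eta> * ?n * norm (y - z))" by (simp add: ac_simps)
        then have "norm ?d \<le> \<eta> * ?n * norm (y - z)" using \<rho> by simp
        also have "\<dots> \<le> \<eta>' * ?n * norm (y - z)" using \<eta> by (intro mult_right_mono) auto
        finally have "norm ?d / r \<le> \<eta>' * ?n * norm (y - z) / r"
          using r(1) by (intro divide_right_mono) auto
        then show ?thesis unfolding 1 by (simp add: \<delta>_def)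
      qed
      have "near_translation \<eta>' \<delta> (word_rot S g *v \<omega>) (\<alpha> k @ \<zeta>) (\<beta> k @ \<zeta>)"
        unfolding near_translation_def using near lipn w[of k] \<zeta> by (simp add: words_iff)
      with \<delta>l \<delta>u show "\<exists>\<delta> \<alpha> \<beta>. c * \<kappa>' * \<delta>0 \<le> \<delta> \<and> \<delta> \<le> \<delta>0 \<and>
          near_translation \<eta>' \<delta> (word_rot S g *v \<omega>) \<alpha> \<beta>" by blast
    qed (use c \<kappa>' in auto)
  qed
qed

text \<open>Near translations with displacement and relative error tending to 0 are themselves
  admissible data, with radius 1 and the whole sequence as subsequence. With
  \<open>translation_dir_rot\<close>, this converse makes the set of overlapping directions
  invariant under rotations of words.\<close>

lemma translation_dir_imp_overlapping_direction:
  assumes u: "translation_dir u" "norm u = 1"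
  shows "overlapping_direction S F u"
proof -
  obtain a where a: "a \<in> F" using F_ne by blast
  \<comment> \<open>The summand 3 gives the derivative condition on the ball of radius 1,
    \<open>norm a\<close> keeps the map nonzero at 0 and hence on the cube, and k sends the error to
    0.\<close>
  define \<eta> where "\<eta> k = 1 / (real k + 3 + norm a)" for k
  have \<eta>: "0 < \<eta> k" "3 * \<eta> k \<le> 1" "\<eta> k * (1 + norm a) < 1" for k
  proof -
    have "0 < real k + 3 + norm a" using norm_ge_zero[of a] by linarith
    then show "0 < \<eta> k" "3 * \<eta> k \<le> 1" "\<eta> k * (1 + norm a) < 1"
      by (simp_all add: \<eta>_def divide_simps)
  qed
  have "\<exists>\<delta> \<alpha> \<beta>. 0 < \<delta> \<and> \<delta> \<le> inverse (real (Suc k)) \<and> near_translation (\<eta> k) \<delta> u \<alpha> \<beta>" for k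
  proof -
    obtain \<kappa> where \<kappa>: "0 < \<kappa>" "\<forall>g\<in>words0 S. \<forall>\<delta>0>0. \<exists>\<delta> \<alpha> \<beta>. \<kappa> * \<delta>0 \<le> \<delta> \<and> \<delta> \<le> \<delta>0 \<and>
        near_translation (\<eta> k) \<delta> (word_rot S g *v u) \<alpha> \<beta>"
      using translation_dirE[OF u(1) \<eta>(1)] by blast
    from \<kappa>(2)[rule_format, of "[]" "inverse (real (Suc k))"]
    obtain \<delta> \<alpha> \<beta> where *: "\<kappa> * inverse (real (Suc k)) \<le> \<delta>" "\<delta> \<le> inverse (real (Suc k))"
        "near_translation (\<eta> k) \<delta> u \<alpha> \<beta>" by auto
    have "0 < \<kappa> * inverse (real (Suc k))" using \<kappa>(1) by simp
    with * show ?thesis by (meson less_le_trans)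
  qed
  then obtain \<delta> \<alpha> \<beta> where nt: "\<And>k. 0 < \<delta> k" "\<And>k. \<delta> k \<le> inverse (real (Suc k))"
      "\<And>k. near_translation (\<eta> k) (\<delta> k) u (\<alpha> k) (\<beta> k)"
    by metis
  define \<Phi> where "\<Phi> k = overlap_map S (\<alpha> k) (\<beta> k)" for k
  have w: "\<alpha> k \<in> words S" "\<beta> k \<in> words S"
    and near: "norm (\<Phi> k a - \<delta> k *\<^sub>R u) \<le> \<eta> k * \<delta> k"
    and lip: "norm (\<Phi> k x - \<Phi> k y) \<le> \<eta> k * \<delta> k * norm (x - y)" for k x y
    using nt(3)[of k] a unfolding near_translation_def \<Phi>_def by blast+
  have w0: "\<alpha> k \<in> words0 S" "\<beta> k \<in> words0 S" for k using w words_iff by blast+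
  have lower: "\<delta> k * (1 - \<eta> k * (1 + norm (x - a))) \<le> norm (\<Phi> k x)" for k x
  proof -
    have "\<delta> k = norm (\<Phi> k x - (\<Phi> k x - \<Phi> k a) - (\<Phi> k a - \<delta> k *\<^sub>R u))"
      using u(2) nt(1)[of k] by simp
    also have "\<dots> \<le> norm (\<Phi> k x) + norm (\<Phi> k x - \<Phi> k a) + norm (\<Phi> k a - \<delta> k *\<^sub>R u)"
      by (meson norm_triangle_ineq4 order_trans add_right_mono)
    also have "\<dots> \<le> norm (\<Phi> k x) + \<eta> k * \<delta> k * norm (x - a) + \<eta> k * \<delta> k"
      using near lip by (intro add_mono) auto
    finally show ?thesis by (simp add: algebra_simps)
  qed
  have upper: "norm (\<Phi> k x) \<le> \<delta> k * (2 + norm (x - a))" for k x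
  proof -
    have "\<Phi> k x = (\<Phi> k x - \<Phi> k a) + (\<Phi> k a - \<delta> k *\<^sub>R u) + \<delta> k *\<^sub>R u" by simp
    also have "norm \<dots> \<le> \<eta> k * \<delta> k * norm (x - a) + \<eta> k * \<delta> k + \<delta> k"
      using near lip u(2) nt(1)[of k] by (intro norm_triangle_mono) auto
    also have "\<dots> \<le> 1 * \<delta> k * norm (x - a) + 1 * \<delta> k + \<delta> k"
      using \<eta>[of k] nt(1)[of k] by (intro add_mono mult_right_mono) auto
    finally show ?thesis by (simp add: algebra_simps)
  qed
  have pos: "0 < cube_sup_norm (\<Phi> k)" for k
  proof -
    have "0 < \<delta> k * (1 - \<eta> k * (1 + norm (0 - a)))" using \<eta>(3)[of k] nt(1)[of k] by simp
    also have "\<dots> \<le> norm (\<Phi> k 0)" by (rule lower)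
    also have "\<dots> \<le> cube_sup_norm (\<Phi> k)"
      unfolding \<Phi>_def by (rule norm_overlap_map_le_cube_sup(1)[OF w0]) (simp add: mem_box_cart)
    finally show ?thesis .
  qed
  have sup_le: "cube_sup_norm (\<Phi> k) \<le> (2 + (real CARD('d) + norm a)) * inverse (real (Suc k))" for k
  proof -
    have "cube_sup_norm (\<Phi> k) \<le> \<delta> k * (2 + (real CARD('d) + norm a))"
      unfolding cube_sup_norm_def
    proof (rule cSUP_least)
      have "(0 :: real ^ 'd) \<in> cbox 0 1" by (simp add: mem_box_cart)
      then show "cbox 0 (1 :: real ^ 'd) \<noteq> {}" by blast
      fix x :: "real ^ 'd" assume "x \<in> cbox 0 1"
      then have "(\<Sum>i\<in>UNIV. \<bar>x $ i\<bar>) \<le> (\<Sum>i\<in>(UNIV :: 'd set). 1)"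
        by (intro sum_mono) (simp add: mem_box_cart)
      then have "norm x \<le> CARD('d)" using norm_le_l1_cart[of x] by simp
      then have "norm (x - a) \<le> CARD('d) + norm a" using norm_triangle_ineq4[of x a] by simp
      then have "\<delta> k * (2 + norm (x - a)) \<le> \<delta> k * (2 + (real CARD('d) + norm a))"
        using nt(1)[of k] by simp
      with upper[of k x] show "norm (\<Phi> k x) \<le> \<delta> k * (2 + (real CARD('d) + norm a))" by simp
    qed
    also have "\<dots> \<le> inverse (real (Suc k)) * (2 + (real CARD('d) + norm a))"
      by (intro mult_right_mono nt(2)) auto
    finally show ?thesis by (simp only: mult.commute)
  qed
  have lim: "(\<lambda>k. cube_sup_norm (\<Phi> k)) \<longlonglongrightarrow> 0"
  proof (rule tendsto_sandwich[OF _ _ tendsto_const])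
    show "(\<lambda>k. (2 + (real CARD('d) + norm a)) * inverse (real (Suc k))) \<longlonglongrightarrow> 0"
      by (rule tendsto_mult_right_zero[OF LIMSEQ_inverse_real_of_nat])
  qed (use sup_le pos in \<open>auto intro!: always_eventually less_imp_le\<close>)
  have cont: "continuous_on A (\<lambda>x. norm (\<Phi> k x))" for A k
  proof (intro continuous_on_norm)
    show "continuous_on A (\<Phi> k)"
      using lip[of k] \<eta>(1)[of k] nt(1)[of k]
      by (intro lipschitz_on_continuous_on[of "\<eta> k * \<delta> k"] lipschitz_onI) (auto simp: dist_norm)
  qed
  have "\<exists>x\<in>cball a 1. \<forall>y\<in>cball a 1. norm (\<Phi> k x) \<le> norm (\<Phi> k y)" for k
    by (rule continuous_attains_inf[OF _ _ cont]) auto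
  then obtain x where x: "\<And>k. x k \<in> cball a 1"
      "\<And>k y. y \<in> cball a 1 \<Longrightarrow> norm (\<Phi> k (x k)) \<le> norm (\<Phi> k y)"
    by metis
  have D: "1 * onorm (frechet_derivative (\<Phi> k) (at a)) \<le> norm (\<Phi> k (x k))" for k
  proof -
    obtain M where M: "\<And>x y. \<Phi> k x - \<Phi> k y = M *v (x - y)"
      using overlap_map_affine[OF w0] unfolding \<Phi>_def by blast
    have "onorm ((*v) M) \<le> \<eta> k * \<delta> k"
    proof (rule onorm_bound)
      fix z show "norm (M *v z) \<le> \<eta> k * \<delta> k * norm z" using lip[of k z 0] M[of z 0] by simp
    qed (use \<eta>(1)[of k] nt(1)[of k] in simp)
    also have "\<dots> \<le> \<delta> k * (1 - \<eta> k * (1 + 1))"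
      using \<eta>(2)[of k] nt(1)[of k] by (simp add: mult.commute mult_left_mono)
    also have "\<dots> \<le> \<delta> k * (1 - \<eta> k * (1 + norm (x k - a)))"
      using x(1)[of k] \<eta>(1)[of k] nt(1)[of k]
      by (intro mult_left_mono diff_left_mono) (auto simp: dist_norm norm_minus_commute)
    also have "\<dots> \<le> norm (\<Phi> k (x k))" by (rule lower)
    finally show ?thesis using frechet_derivative_affine[OF M] by simp
  qed
  have dir: "((\<lambda>k. \<Phi> k a /\<^sub>R norm (\<Phi> k a)) \<circ> id) \<longlonglongrightarrow> u"
  proof -
    define v where "v k = \<Phi> k a /\<^sub>R \<delta> k" for k
    have "norm (v k - u) \<le> \<eta> k" for k
    proof -
      have "v k - u = (\<Phi> k a - \<delta> k *\<^sub>R u) /\<^sub>R \<delta> k"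
        using nt(1)[of k] by (simp add: v_def algebra_simps)
      then have "norm (v k - u) = norm (\<Phi> k a - \<delta> k *\<^sub>R u) / \<delta> k"
        using nt(1)[of k] by (simp only: norm_scaleR) (simp add: divide_inverse)
      then show ?thesis using near[of k] nt(1)[of k] by (simp add: pos_divide_le_eq)
    qed
    moreover have "\<eta> k \<le> inverse (real (Suc k))" for k
      unfolding \<eta>_def inverse_eq_divide by (rule divide_left_mono) (simp_all add: add_pos_nonneg)
    ultimately have "norm (v k - u) \<le> inverse (real (Suc k))" for k by (meson order_trans)
    then have "(\<lambda>k. v k - u) \<longlonglongrightarrow> 0"
      by (intro Lim_null_comparison[OF _ LIMSEQ_inverse_real_of_nat] always_eventually) simp
    then have "v \<longlonglongrightarrow> u" using LIM_zero_iff by blast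
    then have "(\<lambda>k. v k /\<^sub>R norm (v k)) \<longlonglongrightarrow> u /\<^sub>R norm u"
      using u(2) by (intro tendsto_intros) auto
    moreover have "v k /\<^sub>R norm (v k) = \<Phi> k a /\<^sub>R norm (\<Phi> k a)" for k
      using nt(1)[of k] by (simp add: v_def)
    ultimately show ?thesis using u(2) by (simp add: comp_def)
  qed
  show ?thesis
    unfolding overlapping_direction_def
    by (rule conjI, use u(2) in simp, rule exI[of _ \<alpha>], rule exI[of _ \<beta>], rule exI[of _ \<Phi>],
        rule exI[of _ a], rule exI[of _ 1], rule exI[of _ x], rule exI[of _ id])
       (use w pos lim a x D dir in \<open>simp add: \<Phi>_def strict_mono_def\<close>)
qed

lemma overlapping_direction_rot:
  assumes "overlapping_direction S F \<omega>" "\<tau> \<in> words0 S"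
  shows "overlapping_direction S F (word_rot S \<tau> *v \<omega>)"
proof -
  have "norm \<omega> = 1" using assms(1) by (simp add: overlapping_direction_def)
  then show ?thesis
    using overlapping_direction_imp_translation_dir[OF assms(1)] assms(2)
    by (intro translation_dir_imp_overlapping_direction translation_dir_rot)
       (simp_all add: orthogonal_matrix_norm[OF orthogonal_word_rot])
qed

section \<open>Nearly translated copies inside a blow-up\<close>

text \<open>One word \<open>\<alpha>\<close> serves all shifts in A, possibly infinitely many: the
  approximate copies of \<open>F\<close> must lie in the same blow-up, while \<open>\<beta>\<close>
  may depend on the shift.\<close>

definition realizable :: "real \<Rightarrow> (real ^ 'd) set \<Rightarrow> bool" where
  "realizable \<epsilon> A \<longleftrightarrow> (\<exists>\<alpha>\<in>words S. \<forall>p\<in>A. \<exists>\<beta>\<in>words S. \<forall>x\<in>F.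
     norm (inv (word_map S \<alpha>) (word_map S \<beta> x) - (x + p)) \<le> \<epsilon>)"

lemma realizable_approx:
  assumes "realizable \<epsilon> A" "\<And>b. b \<in> B \<Longrightarrow> \<exists>a\<in>A. norm (b - a) \<le> e"
  shows "realizable (\<epsilon> + e) B"
proof -
  obtain \<alpha> where \<alpha>: "\<alpha> \<in> words S" "\<And>p. p \<in> A \<Longrightarrow> \<exists>\<beta>\<in>words S. \<forall>x\<in>F.
     norm (inv (word_map S \<alpha>) (word_map S \<beta> x) - (x + p)) \<le> \<epsilon>"
    using assms(1) by (auto simp: realizable_def)
  show ?thesis unfolding realizable_def
  proof (rule bexI[of _ \<alpha>], intro ballI)
    fix b assume "b \<in> B"
    then obtain a where a: "a \<in> A" "norm (b - a) \<le> e" using assms(2) by blast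
    obtain \<beta> where \<beta>: "\<beta> \<in> words S" "\<forall>x\<in>F.
       norm (inv (word_map S \<alpha>) (word_map S \<beta> x) - (x + a)) \<le> \<epsilon>"
      using \<alpha>(2)[OF a(1)] by blast
    have "norm (inv (word_map S \<alpha>) (word_map S \<beta> x) - (x + b)) \<le> \<epsilon> + e" if "x \<in> F" for x
    proof -
      have "inv (word_map S \<alpha>) (word_map S \<beta> x) - (x + b) =
        (inv (word_map S \<alpha>) (word_map S \<beta> x) - (x + a)) - (b - a)" by simp
      also have "norm \<dots> \<le> norm (inv (word_map S \<alpha>) (word_map S \<beta> x) - (x + a)) + norm (b - a)"
        by (rule norm_triangle_ineq4)
      also have "\<dots> \<le> \<epsilon> + e"
        using \<beta>(2) that a(2) by (intro add_mono) auto
      finally show ?thesis .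
    qed
    with \<beta>(1) show "\<exists>\<beta>\<in>words S. \<forall>x\<in>F.
       norm (inv (word_map S \<alpha>) (word_map S \<beta> x) - (x + b)) \<le> \<epsilon> + e" by blast
  qed (rule \<alpha>)
qed

lemma realizable_mono:
  assumes "realizable \<epsilon> A" "B \<subseteq> A" "\<epsilon> \<le> \<epsilon>'"
  shows "realizable \<epsilon>' B"
  using realizable_approx[OF assms(1), of B "\<epsilon>' - \<epsilon>"] assms(2,3) by force

text \<open>If \<open>\<alpha>\<close>, \<open>\<beta>\<close> realize the shift by \<open>p\<close> and \<open>\<alpha>'\<close>, \<open>\<beta>'\<close> is a much smaller near translation, then
  relative to \<open>\<alpha>' @ \<alpha>\<close> the word \<open>\<alpha>' @ \<beta>\<close> still realizes \<open>p\<close>, while \<open>\<beta>' @ \<beta>\<close> adds the displacement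
  magnified by the blow-up of \<open>\<alpha>\<close>.\<close>

lemma realizable_step:
  assumes "translation_dir u" "0 < \<eta>"
  obtains \<kappa> where "0 < \<kappa>" "\<And>t0 \<epsilon> A. 0 < t0 \<Longrightarrow> realizable \<epsilon> A \<Longrightarrow>
    \<exists>t. \<kappa> * t0 \<le> t \<and> t \<le> t0 \<and> realizable (\<epsilon> + \<eta> * t) (A \<union> (\<lambda>p. p + t *\<^sub>R u) ` A)"
proof -
  obtain \<kappa> where \<kappa>: "0 < \<kappa>" "\<forall>g\<in>words0 S. \<forall>\<delta>0>0. \<exists>\<delta> \<alpha> \<beta>.
     \<kappa> * \<delta>0 \<le> \<delta> \<and> \<delta> \<le> \<delta>0 \<and> near_translation \<eta> \<delta> (word_rot S g *v u) \<alpha> \<beta>"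
    using translation_dirE[OF assms] by blast
  have "\<exists>t. \<kappa> * t0 \<le> t \<and> t \<le> t0 \<and> realizable (\<epsilon> + \<eta> * t) (A \<union> (\<lambda>p. p + t *\<^sub>R u) ` A)"
    if t0_pos: "0 < t0" and A: "realizable \<epsilon> A" for t0 \<epsilon> A
  proof -
    obtain \<alpha> where \<alpha>: "\<alpha> \<in> words S" and A': "\<And>p. p \<in> A \<Longrightarrow> \<exists>\<beta>\<in>words S. \<forall>x\<in>F.
        norm (inv (word_map S \<alpha>) (word_map S \<beta> x) - (x + p)) \<le> \<epsilon>"
      using A by (auto simp: realizable_def)
    have \<alpha>0: "\<alpha> \<in> words0 S" using \<alpha> words_iff by blast
    define c where "c = word_ratio S \<alpha>"
    have c: "0 < c" using word_ratio_pos[OF \<alpha>0] by (simp add: c_def)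
    \<comment> \<open>Undoing \<open>\<alpha>\<close> will rotate the displacement back and magnify
      it by \<open>1 / c\<close>; so the direction is rotated by \<open>\<alpha>\<close> beforehand
      and the length is sought near \<open>c * t0\<close>.\<close>
    obtain \<delta> \<alpha>' \<beta>' where \<delta>: "\<kappa> * (c * t0) \<le> \<delta>" "\<delta> \<le> c * t0"
      and nt: "near_translation \<eta> \<delta> (word_rot S \<alpha> *v u) \<alpha>' \<beta>'"
      using \<kappa>(2)[rule_format, of \<alpha> "c * t0"] \<alpha>0 c t0_pos by auto
    define t where "t = \<delta> / c"
    have t: "\<kappa> * t0 \<le> t" "t \<le> t0" using \<delta> c by (auto simp: t_def field_simps)
    have t0: "0 \<le> t" using t \<kappa>(1) t0_pos by (meson less_imp_le mult_pos_pos order_trans)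
    have w': "\<alpha>' \<in> words S" "\<beta>' \<in> words S" "\<alpha>' \<in> words0 S" "\<beta>' \<in> words0 S"
      using nt words_iff by (auto simp: near_translation_def)
    have inv: "inv (word_map S (\<alpha>' @ \<alpha>)) y = inv (word_map S \<alpha>) (inv (word_map S \<alpha>') y)" for y
      using bij_word_map \<alpha>0 w' by (simp add: o_inv_distrib)
    have "realizable (\<epsilon> + \<eta> * t) (A \<union> (\<lambda>p. p + t *\<^sub>R u) ` A)"
      unfolding realizable_def
    proof (rule bexI[of _ "\<alpha>' @ \<alpha>"], intro ballI)
      show "\<alpha>' @ \<alpha> \<in> words S" using w' \<alpha> by (auto simp: words_iff)
      fix q assume q: "q \<in> A \<union> (\<lambda>p. p + t *\<^sub>R u) ` A"
      then obtain p where p: "p \<in> A" "q = p \<or> q = p + t *\<^sub>R u" by auto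
      obtain \<beta> where \<beta>: "\<beta> \<in> words S" and \<beta>p: "\<And>x. x \<in> F \<Longrightarrow>
         norm (inv (word_map S \<alpha>) (word_map S \<beta> x) - (x + p)) \<le> \<epsilon>"
        using A'[OF p(1)] by blast
      have \<beta>0: "\<beta> \<in> words0 S" using \<beta> words_iff by blast
      show "\<exists>\<beta>\<in>words S. \<forall>x\<in>F.
         norm (inv (word_map S (\<alpha>' @ \<alpha>)) (word_map S \<beta> x) - (x + q)) \<le> \<epsilon> + \<eta> * t"
        using p(2)
      proof
        assume "q = p"
        show ?thesis
        proof (rule bexI[of _ "\<alpha>' @ \<beta>"], intro ballI)
          fix x assume "x \<in> F"
          then show "norm (inv (word_map S (\<alpha>' @ \<alpha>)) (word_map S (\<alpha>' @ \<beta>) x) - (x + q)) \<le> \<epsilon> + \<eta> * t"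
            unfolding inv using \<beta>p[of x] w' t0 assms(2) \<open>q = p\<close>
            by (simp add: add_increasing2)
        qed (use w' \<beta> in \<open>auto simp: words_iff\<close>)
      next
        assume q: "q = p + t *\<^sub>R u"
        show ?thesis
        proof (rule bexI[of _ "\<beta>' @ \<beta>"], intro ballI)
          fix x assume x: "x \<in> F"
          \<comment> \<open>The displacement acts at a point of \<open>F\<close>, which is where
            \<open>near_translation\<close> controls it.\<close>
          define y where "y = word_map S \<beta> x"
          have y: "y \<in> F" using word_map_in_F[OF \<beta>0 x] by (simp add: y_def)
          let ?\<Phi> = "overlap_map S \<alpha>' \<beta>'" and ?R = "word_rot S \<alpha>"
          have orth: "orthogonal_matrix ?R" using orthogonal_word_rot[OF \<alpha>0] .
          have "inv (word_map S (\<alpha>' @ \<alpha>)) (word_map S (\<beta>' @ \<beta>) x) - (x + q) =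
            (inv (word_map S \<alpha>) (y + ?\<Phi> y) - inv (word_map S \<alpha>) y)
            - t *\<^sub>R u + (inv (word_map S \<alpha>) y - (x + p))"
            unfolding inv by (simp add: y_def q overlap_map_def)
          also have "(inv (word_map S \<alpha>) (y + ?\<Phi> y) - inv (word_map S \<alpha>) y) - t *\<^sub>R u =
            (1 / c) *\<^sub>R (transpose ?R *v (?\<Phi> y - \<delta> *\<^sub>R (?R *v u)))"
            unfolding inv_word_map_diff[OF \<alpha>0]
            by (simp add: c_def t_def algebra_simps orthogonal_matrix_cancel[OF orth])
          also have "norm (\<dots> + (inv (word_map S \<alpha>) y - (x + p))) \<le> \<eta> * t + \<epsilon>"
          proof (rule norm_triangle_mono)
            have "norm ((1 / c) *\<^sub>R (transpose ?R *v (?\<Phi> y - \<delta> *\<^sub>R (?R *v u)))) =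
                norm (?\<Phi> y - \<delta> *\<^sub>R (?R *v u)) / c"
              using orth c by (simp add: orthogonal_matrix_norm)
            also have "\<dots> \<le> \<eta> * \<delta> / c"
              using nt y c by (intro divide_right_mono) (auto simp: near_translation_def)
            finally show "norm ((1 / c) *\<^sub>R (transpose ?R *v (?\<Phi> y - \<delta> *\<^sub>R (?R *v u)))) \<le> \<eta> * t"
              by (simp add: t_def)
            show "norm (inv (word_map S \<alpha>) y - (x + p)) \<le> \<epsilon>" using \<beta>p[OF x] by (simp add: y_def)
          qed
          also have "\<eta> * t + \<epsilon> = \<epsilon> + \<eta> * t" by simp
          finally show "norm (inv (word_map S (\<alpha>' @ \<alpha>)) (word_map S (\<beta>' @ \<beta>) x) - (x + q)) \<le> \<epsilon> + \<eta> * t" .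
        qed (use w' \<beta> in \<open>auto simp: words_iff\<close>)
      qed
    qed
    with t show ?thesis by blast
  qed
  with \<kappa>(1) show ?thesis by (rule that)
qed

text \<open>A realized segment together with its shift by a step no longer than itself covers a
  longer segment. Step lengths are bounded below, so finitely many reach M, and each step costs
  \<open>\<eta>\<close> times its length, so the total cost is bounded by the distance
  covered.\<close>

lemma realizable_line:
  assumes A: "realizable \<epsilon> A" and u: "translation_dir u" "norm u = 1" and e: "\<epsilon> < \<epsilon>'" and M: "0 \<le> M"
  shows "realizable \<epsilon>' {p + s *\<^sub>R u | p s. p \<in> A \<and> 0 \<le> s \<and> s \<le> M}"
proof -
  define L where "L s = {p + r *\<^sub>R u | p r. p \<in> A \<and> 0 \<le> r \<and> r \<le> s}" for s
  define \<eta> where "\<eta> = (\<epsilon>' - \<epsilon>) / (2 * (M + 1))"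
  \<comment> \<open>Half of the allowed error is for discretizing the initial segment, the other
    half for \<open>\<eta>\<close> times a length of at most \<open>M + 1\<close>; the bound 1
    limits the overshoot beyond M.\<close>
  define t0 where "t0 = min 1 ((\<epsilon>' - \<epsilon>) / 2)"
  have \<eta>: "0 < \<eta>" using e M by (simp add: \<eta>_def)
  have t0: "0 < t0" "t0 \<le> 1" "t0 \<le> (\<epsilon>' - \<epsilon>) / 2" using e unfolding t0_def by (simp_all add: min.coboundedI1) (simp add: min_def)
  obtain \<kappa> where \<kappa>: "0 < \<kappa>" and step: "\<And>t0 \<epsilon> A. 0 < t0 \<Longrightarrow> realizable \<epsilon> A \<Longrightarrow>
    \<exists>t. \<kappa> * t0 \<le> t \<and> t \<le> t0 \<and> realizable (\<epsilon> + \<eta> * t) (A \<union> (\<lambda>p. p + t *\<^sub>R u) ` A)"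
    using realizable_step[OF u(1) \<eta>] by blast
  define Q where "Q s \<longleftrightarrow> realizable (\<epsilon> + t0 + \<eta> * s) (L s)" for s
  obtain s0 where s0: "\<kappa> * t0 \<le> s0" "s0 \<le> t0" "realizable (\<epsilon> + \<eta> * s0) (A \<union> (\<lambda>p. p + s0 *\<^sub>R u) ` A)"
    using step[OF t0(1) A] by blast
  \<comment> \<open>A segment of length \<open>s0 \<le> t0\<close> is approximated within
    \<open>t0\<close> by its starting point alone.\<close>
  have Q0: "Q s0"
  proof -
    have "realizable ((\<epsilon> + \<eta> * s0) + t0) (L s0)"
    proof (rule realizable_approx[OF s0(3)])
      fix b assume "b \<in> L s0"
      then obtain p r where "b = p + r *\<^sub>R u" "p \<in> A" "0 \<le> r" "r \<le> s0" by (auto simp: L_def)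
      then show "\<exists>a\<in>A \<union> (\<lambda>p. p + s0 *\<^sub>R u) ` A. norm (b - a) \<le> t0"
        using u(2) s0(2) by (intro bexI[of _ p]) auto
    qed
    then show ?thesis by (simp add: Q_def ac_simps)
  qed
  \<comment> \<open>Later steps are at most \<open>\<kappa> * t0\<close>, the guaranteed length of
    the initial segment, so the shifted copy leaves no gap; the lower bound on t ensures
    progress.\<close>
  have Qs: "\<exists>t. \<kappa> * (\<kappa> * t0) \<le> t \<and> t \<le> \<kappa> * t0 \<and> Q (s + t)" if s: "\<kappa> * t0 \<le> s" "Q s" for s
  proof -
    have "0 < \<kappa> * t0" using \<kappa> t0 by simp
    from step[OF this s(2)[unfolded Q_def]] obtain t where t: "\<kappa> * (\<kappa> * t0) \<le> t" "t \<le> \<kappa> * t0"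
      "realizable (\<epsilon> + t0 + \<eta> * s + \<eta> * t) (L s \<union> (\<lambda>p. p + t *\<^sub>R u) ` L s)" by blast
    have "L (s + t) \<subseteq> L s \<union> (\<lambda>p. p + t *\<^sub>R u) ` L s"
    proof
      fix b assume "b \<in> L (s + t)"
      then obtain p r where b: "b = p + r *\<^sub>R u" "p \<in> A" "0 \<le> r" "r \<le> s + t" by (auto simp: L_def)
      show "b \<in> L s \<union> (\<lambda>p. p + t *\<^sub>R u) ` L s"
      proof (cases "r \<le> s")
        case False
        then have "p + (r - t) *\<^sub>R u \<in> L s" using b t(2) s(1)
          by (auto simp: L_def intro!: exI[of _ p] exI[of _ "r - t"])
        moreover have "b = (p + (r - t) *\<^sub>R u) + t *\<^sub>R u" by (simp add: b algebra_simps)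
        ultimately show ?thesis by blast
      qed (use b in \<open>auto simp: L_def\<close>)
    qed
    then have "realizable (\<epsilon> + t0 + \<eta> * (s + t)) (L (s + t))"
      by (intro realizable_mono[OF t(3)]) (simp_all add: algebra_simps)
    with t show ?thesis by (auto simp: Q_def)
  qed
  have "\<exists>s. \<kappa> * t0 \<le> s \<and> s \<le> M + 1 \<and> Q s \<and> (M \<le> s \<or> n * (\<kappa> * (\<kappa> * t0)) \<le> s)" for n :: nat
  proof (induction n)
    case 0
    have "0 < \<kappa> * t0" using \<kappa> t0 by simp
    with s0(1) have "0 \<le> s0" by linarith
    then show ?case using s0 Q0 t0(2) M by (intro exI[of _ s0]) auto
  next
    case (Suc n)
    then obtain s where s: "\<kappa> * t0 \<le> s" "s \<le> M + 1" "Q s" "M \<le> s \<or> n * (\<kappa> * (\<kappa> * t0)) \<le> s" by blast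
    show ?case
    proof (cases "M \<le> s")
      case False
      obtain t where t: "\<kappa> * (\<kappa> * t0) \<le> t" "t \<le> \<kappa> * t0" "Q (s + t)" using Qs[OF s(1,3)] by blast
      have "0 < \<kappa> * (\<kappa> * t0)" using \<kappa> t0 by simp
      then have "0 < t" using t(1) by linarith
      then show ?thesis
        using False s t s0 t0 by (intro exI[of _ "s + t"]) (auto simp: algebra_simps)
    qed (use s in blast)
  qed
  moreover obtain n :: nat where "M / (\<kappa> * (\<kappa> * t0)) \<le> n" using real_arch_simple by blast
  then have "M \<le> n * (\<kappa> * (\<kappa> * t0))" using \<kappa> t0 by (simp add: pos_divide_le_eq)
  ultimately obtain s where s: "s \<le> M + 1" "Q s" "M \<le> s" by (meson order_trans)
  have "\<eta> * s \<le> (\<epsilon>' - \<epsilon>) / 2"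
  proof -
    have "\<eta> * s \<le> \<eta> * (M + 1)" using s(1) \<eta> by simp
    also have "\<dots> = (\<epsilon>' - \<epsilon>) / 2" using M by (simp add: \<eta>_def field_simps)
    finally show ?thesis .
  qed
  then have "\<epsilon> + t0 + \<eta> * s \<le> \<epsilon>'" using t0(3) by (simp add: field_simps)
  moreover have "L M \<subseteq> L s" using s(3) unfolding L_def by (blast intro: order_trans)
  ultimately have "realizable \<epsilon>' (L M)"
    by (intro realizable_mono[OF s(2)[unfolded Q_def]])
  then show ?thesis by (simp add: L_def)
qed

text \<open>One direction is added at a time: \<open>realizable_line\<close> accepts any set of
  shifts as its base.\<close>

lemma realizable_parallelepiped:
  assumes "finite X" "\<And>u. u \<in> X \<Longrightarrow> translation_dir u \<and> norm u = 1" "0 < \<epsilon>" "0 \<le> M"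
  shows "realizable \<epsilon> {\<Sum>u\<in>X. s u *\<^sub>R u | s. \<forall>u\<in>X. 0 \<le> s u \<and> s u \<le> M}"
  using assms(1-3)
proof (induction X arbitrary: \<epsilon> rule: finite_induct)
  case empty
  \<comment> \<open>The zero shift must be realized by nonempty words; \<open>[0]\<close> exists
    because \<open>F\<close> is nonempty.\<close>
  have w: "[0] \<in> words S" "[0] \<in> words0 S" using length_pos by (auto simp: words_iff)
  show ?case
    unfolding realizable_def
    using w empty inv_word_map_cancel(1)[OF w(2)] by (auto intro!: bexI[of _ "[0]"])
next
  case (insert u X)
  \<comment> \<open>\<open>realizable_line\<close> needs a strict increase of the error, so half is
    reserved for the new direction.\<close>
  have "realizable (\<epsilon> / 2) {\<Sum>u\<in>X. s u *\<^sub>R u | s. \<forall>u\<in>X. 0 \<le> s u \<and> s u \<le> M}"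
    using insert by (intro insert.IH) auto
  from realizable_line[OF this, of u \<epsilon> M]
  have "realizable \<epsilon> {p + r *\<^sub>R u | p r. p \<in> {\<Sum>u\<in>X. s u *\<^sub>R u | s. \<forall>u\<in>X. 0 \<le> s u \<and> s u \<le> M} \<and> 0 \<le> r \<and> r \<le> M}"
    using insert.prems assms(4) by auto
  then show ?case
  proof (rule realizable_mono)
    show "{\<Sum>u\<in>insert u X. s u *\<^sub>R u | s. \<forall>u\<in>insert u X. 0 \<le> s u \<and> s u \<le> M} \<subseteq>
      {p + r *\<^sub>R u | p r. p \<in> {\<Sum>u\<in>X. s u *\<^sub>R u | s. \<forall>u\<in>X. 0 \<le> s u \<and> s u \<le> M} \<and> 0 \<le> r \<and> r \<le> M}"
    proof (clarify)
      fix s assume s: "\<forall>u\<in>insert u X. 0 \<le> s u \<and> s u \<le> M"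
      have "(\<Sum>u\<in>insert u X. s u *\<^sub>R u) = (\<Sum>u\<in>X. s u *\<^sub>R u) + s u *\<^sub>R u"
        using insert.hyps by simp
      with s show "\<exists>p r. (\<Sum>u\<in>insert u X. s u *\<^sub>R u) = p + r *\<^sub>R u \<and>
          p \<in> {\<Sum>u\<in>X. s u *\<^sub>R u | s. \<forall>u\<in>X. 0 \<le> s u \<and> s u \<le> M} \<and> 0 \<le> r \<and> r \<le> M"
        by blast
    qed
  qed simp
qed

section \<open>Cylinders under the open set condition\<close>

text \<open>The common prefix is removed by injectivity. At the first differing letter the images
  lie in two disjoint first-level images of \<open>U\<close>.\<close>

lemma cylinders_disjoint:
  assumes sub: "\<And>i. i < length S \<Longrightarrow> (S ! i) ` U \<subseteq> U"
    and disj: "\<And>i j. i < length S \<Longrightarrow> j < length S \<Longrightarrow> i \<noteq> j \<Longrightarrow> (S ! i) ` U \<inter> (S ! j) ` U = {}"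
  shows "\<sigma> \<in> words0 S \<Longrightarrow> \<tau> \<in> words0 S \<Longrightarrow> \<nexists>\<rho>. \<tau> = \<sigma> @ \<rho> \<Longrightarrow> \<nexists>\<rho>. \<sigma> = \<tau> @ \<rho> \<Longrightarrow>
    word_map S \<sigma> ` U \<inter> word_map S \<tau> ` U = {}"
proof (induction \<sigma> arbitrary: \<tau>)
  case (Cons i \<sigma>)
  then obtain j \<tau>' where \<tau>: "\<tau> = j # \<tau>'" by (cases \<tau>) auto
  have i: "i < length S" "\<sigma> \<in> words0 S" and j: "j < length S" "\<tau>' \<in> words0 S"
    using Cons.prems \<tau> by auto
  have in_U: "word_map S \<alpha> ` U \<subseteq> U" if "\<alpha> \<in> words0 S" for \<alpha>
    using that
  proof (induction \<alpha>)
    case (Cons a \<alpha>)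
    then have "word_map S \<alpha> ` U \<subseteq> U" "(S ! a) ` U \<subseteq> U" using sub by auto
    then show ?case by (auto simp: image_subset_iff)
  qed simp
  show ?case
  proof (cases "i = j")
    case True
    then have "word_map S \<sigma> ` U \<inter> word_map S \<tau>' ` U = {}"
      using Cons.prems i j \<tau> by (intro Cons.IH) auto
    moreover have "inj (S ! i)" using inj_word_map[of "[i]"] i by simp
    ultimately have "(S ! i) ` (word_map S \<sigma> ` U) \<inter> (S ! i) ` (word_map S \<tau>' ` U) = {}"
      by (metis image_Int image_empty)
    then show ?thesis using True \<tau> by (simp add: image_comp)
  next
    case False
    have "word_map S (i # \<sigma>) ` U \<subseteq> (S ! i) ` U" "word_map S \<tau> ` U \<subseteq> (S ! j) ` U"
      using in_U[OF i(2)] in_U[OF j(2)] \<tau> by auto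
    then show ?thesis using disj[OF i(1) j(1) False] by blast
  qed
qed simp

text \<open>The cut set of a Moran cover: words are stopped when the ratio first drops to r, so
  their cylinders have comparable sizes.\<close>

definition stopping_words :: "real \<Rightarrow> nat list set" where
  "stopping_words r =
     {\<sigma> \<in> words0 S. \<sigma> \<noteq> [] \<and> word_ratio S \<sigma> \<le> r \<and> r < word_ratio S (butlast \<sigma>)}"

text \<open>Dropping the last letter of a proper extension of \<open>\<sigma>\<close> still leaves
  \<open>\<sigma>\<close> as a prefix, so the ratio was already at most r.\<close>

lemma stopping_words_not_prefix:
  assumes "\<sigma> \<in> stopping_words r" "\<sigma> @ \<rho> \<in> stopping_words r"
  shows "\<rho> = []"
proof (rule ccontr)
  assume "\<rho> \<noteq> []"
  then have "butlast (\<sigma> @ \<rho>) = \<sigma> @ butlast \<rho>" by (simp add: butlast_append)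
  moreover have "\<sigma> \<in> words0 S" "butlast \<rho> \<in> words0 S"
    using assms in_set_butlastD by (fastforce simp: stopping_words_def)+
  then have "word_ratio S \<sigma> * word_ratio S (butlast \<rho>) \<le> word_ratio S \<sigma>"
    by (intro mult_left_le word_ratio_le_1 less_imp_le[OF word_ratio_pos])
  ultimately show False using assms by (auto simp: stopping_words_def)
qed

lemma ex_stopping_word:
  assumes "x \<in> F" "0 < r" "r < 1"
  shows "\<exists>\<sigma>\<in>stopping_words r. x \<in> word_map S \<sigma> ` F"
proof -
  obtain \<gamma> where \<gamma>: "\<gamma> \<in> words0 S" "x \<in> word_map S \<gamma> ` F" "word_ratio S \<gamma> < r"
    using small_cylinder[OF assms(1,2)] by blast
  define n where "n = (LEAST n. word_ratio S (take n \<gamma>) \<le> r)"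
  have n: "word_ratio S (take n \<gamma>) \<le> r"
    unfolding n_def by (rule LeastI[of _ "length \<gamma>"]) (use \<gamma>(3) in simp)
  have "n \<le> length \<gamma>" unfolding n_def by (rule Least_le) (use \<gamma>(3) in simp)
  \<comment> \<open>The empty prefix has ratio 1, which exceeds r.\<close>
  have "n \<noteq> 0" using n assms(3) by (intro notI) simp
  then obtain m where m: "n = Suc m" by (cases n) auto
  have "r < word_ratio S (take m \<gamma>)"
    using not_less_Least[of m "\<lambda>n. word_ratio S (take n \<gamma>) \<le> r"] m unfolding n_def by simp
  moreover have "butlast (take n \<gamma>) = take m \<gamma>" using \<open>n \<le> length \<gamma>\<close> m by (simp add: butlast_take)
  moreover have tw: "take n \<gamma> \<in> words0 S" "drop n \<gamma> \<in> words0 S"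
    using \<gamma>(1) set_take_subset[of n \<gamma>] set_drop_subset[of n \<gamma>] by (auto simp: in_lists_conv_set)
  ultimately have "take n \<gamma> \<in> stopping_words r"
    using n \<open>n \<noteq> 0\<close> \<open>n \<le> length \<gamma>\<close> by (auto simp: stopping_words_def)
  moreover have "word_map S \<gamma> = word_map S (take n \<gamma>) \<circ> word_map S (drop n \<gamma>)"
    by (metis append_take_drop_id word_map_simps(3))
  then have "x \<in> word_map S (take n \<gamma>) ` F" using \<gamma>(2) word_map_in_F[OF tw(2)] by auto
  ultimately show ?thesis by blast
qed

text \<open>A packing argument: cylinders of incomparable words contain disjoint images of a fixed
  ball in the open set, of radius comparable to r, so only boundedly many come near a ball of radius
  \<open>r * R\<close>. The last clause later bounds the translation parts of the rescaled
  cylinders.\<close>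

lemma open_set_condition_cover:
  assumes "open_set_condition S"
  obtains c where "0 < c" "c \<le> 1" "\<And>R. \<exists>N. \<forall>r y. 0 < r \<longrightarrow> r < 1 \<longrightarrow>
    (\<exists>\<Sigma>\<subseteq>words0 S. finite \<Sigma> \<and> card \<Sigma> \<le> N \<and> F \<inter> cball y (r * R) \<subseteq> (\<Union>\<sigma>\<in>\<Sigma>. word_map S \<sigma> ` F) \<and>
      (\<forall>\<sigma>\<in>\<Sigma>. c * r \<le> word_ratio S \<sigma> \<and> word_ratio S \<sigma> \<le> r \<and>
        word_map S \<sigma> ` F \<inter> cball y (r * R) \<noteq> {}))"
proof -
  obtain U where U: "U \<noteq> {}" "open U" "(\<Union>i<length S. (S ! i) ` U) \<subseteq> U"
      "disjoint_family_on (\<lambda>i. (S ! i) ` U) {..<length S}"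
    using assms by (auto simp: open_set_condition_def)
  obtain u0 where "u0 \<in> U" using U(1) by blast
  then obtain s where u0: "0 < s" "ball u0 s \<subseteq> U" using openE[OF U(2)] by blast
  have disj: "word_map S \<sigma> ` U \<inter> word_map S \<tau> ` U = {}"
    if "\<sigma> \<in> stopping_words r" "\<tau> \<in> stopping_words r" "\<sigma> \<noteq> \<tau>" for \<sigma> \<tau> r
  proof (rule cylinders_disjoint)
    show "\<sigma> \<in> words0 S" "\<tau> \<in> words0 S" using that by (auto simp: stopping_words_def)
    show "\<nexists>\<rho>. \<tau> = \<sigma> @ \<rho>" "\<nexists>\<rho>. \<sigma> = \<tau> @ \<rho>" using stopping_words_not_prefix that by fastforce+
  qed (use U(3,4) in \<open>auto simp: disjoint_family_on_def\<close>)
  define c where "c = Min ((\<lambda>i. sim_ratio (S ! i)) ` {..<length S})"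
  have ne: "(\<lambda>i. sim_ratio (S ! i)) ` {..<length S} \<noteq> {}" using length_pos by auto
  have c: "c \<le> sim_ratio (S ! i)" if "i < length S" for i
    unfolding c_def using that by (intro Min_le) auto
  have c0: "0 < c" unfolding c_def using ne by (subst Min_gr_iff) (auto simp: letter)
  have c1: "c \<le> 1" using c[OF length_pos] letter(2)[OF length_pos] by simp
  have stop: "c * r \<le> word_ratio S \<sigma>" if \<sigma>: "\<sigma> \<in> stopping_words r" for \<sigma> r
  proof -
    have eq: "\<sigma> = butlast \<sigma> @ [last \<sigma>]" using \<sigma> by (simp add: stopping_words_def)
    have "last \<sigma> < length S"
      using \<sigma> last_in_set[of \<sigma>] by (auto simp: stopping_words_def in_lists_conv_set)
    have "0 < word_ratio S \<sigma>" "word_ratio S \<sigma> \<le> r"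
      using \<sigma> word_ratio_pos by (auto simp: stopping_words_def)
    then have "0 \<le> r" by linarith
    have "c * r \<le> sim_ratio (S ! last \<sigma>) * word_ratio S (butlast \<sigma>)"
      using c[OF \<open>last \<sigma> < length S\<close>] c0 \<sigma> letter(1)[OF \<open>last \<sigma> < length S\<close>] \<open>0 \<le> r\<close>
      by (intro mult_mono') (auto simp: stopping_words_def)
    also have "\<dots> = word_ratio S \<sigma>" by (subst (3) eq) simp
    finally show ?thesis .
  qed
  obtain D where D: "0 < D" "\<And>x. x \<in> F \<Longrightarrow> norm x \<le> D" using F_diff_bound by metis
  \<comment> \<open>The point \<open>u0\<close> of the open set may lie away from \<open>F\<close>;
    K bounds its distance to all points of \<open>F\<close>.\<close>
  define K where "K = norm u0 + D"
  have "\<exists>N. \<forall>r y. 0 < r \<longrightarrow> r < 1 \<longrightarrow>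
    (\<exists>\<Sigma>\<subseteq>words0 S. finite \<Sigma> \<and> card \<Sigma> \<le> N \<and> F \<inter> cball y (r * R) \<subseteq> (\<Union>\<sigma>\<in>\<Sigma>. word_map S \<sigma> ` F) \<and>
      (\<forall>\<sigma>\<in>\<Sigma>. c * r \<le> word_ratio S \<sigma> \<and> word_ratio S \<sigma> \<le> r \<and>
        word_map S \<sigma> ` F \<inter> cball y (r * R) \<noteq> {}))" for R
  proof -
    \<comment> \<open>Points sharing a net ball are less than \<open>c * s\<close> apart; at scale r
      this is at most \<open>s\<close> times the ratio of either word.\<close>
    define e where "e = c * s / 2"
    have "0 < e" using c0 u0 by (simp add: e_def)
    then obtain k where k: "finite k" "cball (0 :: real ^ 'd) (R + K) \<subseteq> (\<Union>x\<in>k. ball x e)"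
      using compact_cball[of "0 :: real ^ 'd" "R + K"] unfolding compact_eq_totally_bounded by blast
    show ?thesis
    proof (rule exI[of _ "card k"], intro allI impI)
      fix r :: real and y :: "real ^ 'd" assume r: "0 < r" "r < 1"
      define \<Sigma> where "\<Sigma> = {\<sigma> \<in> stopping_words r. word_map S \<sigma> ` F \<inter> cball y (r * R) \<noteq> {}}"
      have sub: "\<Sigma> \<subseteq> words0 S" by (auto simp: \<Sigma>_def stopping_words_def)
      define p where "p \<sigma> = (word_map S \<sigma> u0 - y) /\<^sub>R r" for \<sigma>
      have "\<exists>q\<in>k. p \<sigma> \<in> ball q e" if \<sigma>: "\<sigma> \<in> \<Sigma>" for \<sigma>
      proof -
        have \<sigma>0: "\<sigma> \<in> words0 S" using sub \<sigma> by blast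
        obtain f where f: "f \<in> F" "norm (word_map S \<sigma> f - y) \<le> r * R"
          using \<sigma> by (auto simp: \<Sigma>_def dist_norm norm_minus_commute)
        have "norm (word_map S \<sigma> u0 - word_map S \<sigma> f) = word_ratio S \<sigma> * norm (u0 - f)"
          by (rule norm_word_map_diff[OF \<sigma>0])
        also have "\<dots> \<le> r * K"
        proof (rule mult_mono)
          show "word_ratio S \<sigma> \<le> r" using \<sigma> by (simp add: \<Sigma>_def stopping_words_def)
          show "norm (u0 - f) \<le> K" unfolding K_def
            using norm_triangle_ineq4[of u0 f] D(2)[OF f(1)] by linarith
        qed (use r in auto)
        finally have "norm (word_map S \<sigma> u0 - word_map S \<sigma> f + (word_map S \<sigma> f - y)) \<le> r * K + r * R"
          using f(2) by (intro norm_triangle_mono)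
        then have "norm (word_map S \<sigma> u0 - y) \<le> (R + K) * r" by (simp add: algebra_simps)
        moreover have "norm (p \<sigma>) = norm (word_map S \<sigma> u0 - y) / r"
          using r by (simp add: p_def divide_inverse mult.commute)
        ultimately have "norm (p \<sigma>) \<le> R + K" using r by (simp add: pos_divide_le_eq)
        then show ?thesis using k(2) by (auto simp: subset_iff)
      qed
      then obtain q where q: "\<And>\<sigma>. \<sigma> \<in> \<Sigma> \<Longrightarrow> q \<sigma> \<in> k" "\<And>\<sigma>. \<sigma> \<in> \<Sigma> \<Longrightarrow> p \<sigma> \<in> ball (q \<sigma>) e"
        by metis
      \<comment> \<open>Two words sharing a net point would place the image of \<open>u0\<close>
        under the second inside the image of \<open>U\<close> under the first.\<close>
      have inj: "inj_on q \<Sigma>"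
      proof (rule inj_onI, rule ccontr)
        fix \<sigma> \<tau> assume \<sigma>: "\<sigma> \<in> \<Sigma>" and \<tau>: "\<tau> \<in> \<Sigma>" and eq: "q \<sigma> = q \<tau>" and ne: "\<sigma> \<noteq> \<tau>"
        have \<sigma>0: "\<sigma> \<in> words0 S" using sub \<sigma> by blast
        have "dist (p \<sigma>) (q \<sigma>) < e" "dist (p \<tau>) (q \<sigma>) < e"
          using q(2)[OF \<sigma>] q(2)[OF \<tau>] unfolding mem_ball eq by (simp_all only: dist_commute)
        then have "dist (p \<sigma>) (p \<tau>) < e + e" by (rule dist_triangle_less_add)
        also have "dist (p \<sigma>) (p \<tau>) = norm ((word_map S \<sigma> u0 - word_map S \<tau> u0) /\<^sub>R r)"
          by (simp only: dist_norm p_def flip: scaleR_diff_right) simp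
        also have "\<dots> = norm (word_map S \<sigma> u0 - word_map S \<tau> u0) / r"
          using r by (simp add: divide_inverse)
        also have "e + e = c * s" by (simp add: e_def)
        finally have "norm (word_map S \<sigma> u0 - word_map S \<tau> u0) / r < c * s" .
        then have "norm (word_map S \<sigma> u0 - word_map S \<tau> u0) < s * (c * r)"
          using r by (simp add: field_simps)
        also have "\<dots> \<le> s * word_ratio S \<sigma>"
          using stop[of \<sigma> r] \<sigma> u0(1) by (intro mult_left_mono) (auto simp: \<Sigma>_def)
        finally have lt: "norm (word_map S \<sigma> u0 - word_map S \<tau> u0) < s * word_ratio S \<sigma>" .
        define z where "z = inv (word_map S \<sigma>) (word_map S \<tau> u0)"
        have z: "word_map S \<sigma> z = word_map S \<tau> u0" using \<sigma>0 by (simp add: z_def)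
        then have "word_ratio S \<sigma> * norm (u0 - z) < s * word_ratio S \<sigma>"
          using lt norm_word_map_diff[OF \<sigma>0, of u0 z] by simp
        then have "norm (u0 - z) < s" using word_ratio_pos[OF \<sigma>0] by simp
        then have "z \<in> U" using u0(2) by (auto simp: dist_norm)
        then have "word_map S \<tau> u0 \<in> word_map S \<sigma> ` U" using z by (metis imageI)
        moreover have "u0 \<in> U" using u0 by auto
        ultimately show False using disj[of \<sigma> r \<tau>] \<sigma> \<tau> ne by (auto simp: \<Sigma>_def)
      qed
      show "\<exists>\<Sigma>\<subseteq>words0 S. finite \<Sigma> \<and> card \<Sigma> \<le> card k \<and>
        F \<inter> cball y (r * R) \<subseteq> (\<Union>\<sigma>\<in>\<Sigma>. word_map S \<sigma> ` F) \<and>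
        (\<forall>\<sigma>\<in>\<Sigma>. c * r \<le> word_ratio S \<sigma> \<and> word_ratio S \<sigma> \<le> r \<and>
          word_map S \<sigma> ` F \<inter> cball y (r * R) \<noteq> {})"
      proof (intro exI[of _ \<Sigma>] conjI sub)
        show "finite \<Sigma>" using inj q(1) k(1) by (meson image_subsetI inj_on_finite)
        show "card \<Sigma> \<le> card k" using inj q(1) k(1) by (meson image_subsetI card_inj_on_le)
        show "F \<inter> cball y (r * R) \<subseteq> (\<Union>\<sigma>\<in>\<Sigma>. word_map S \<sigma> ` F)"
        proof
          fix x assume x: "x \<in> F \<inter> cball y (r * R)"
          then obtain \<sigma> where "\<sigma> \<in> stopping_words r" "x \<in> word_map S \<sigma> ` F"
            using ex_stopping_word[of x r] r by auto
          then show "x \<in> (\<Union>\<sigma>\<in>\<Sigma>. word_map S \<sigma> ` F)" using x unfolding \<Sigma>_def by blast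
        qed
        show "\<forall>\<sigma>\<in>\<Sigma>. c * r \<le> word_ratio S \<sigma> \<and> word_ratio S \<sigma> \<le> r \<and>
          word_map S \<sigma> ` F \<inter> cball y (r * R) \<noteq> {}"
          using stop by (auto simp: \<Sigma>_def stopping_words_def)
      qed
    qed
  qed
  with c0 c1 show ?thesis by (rule that)
qed

end

section \<open>Limits of blow-ups\<close>

lemma bounded_family_convergent_subsequence:
  fixes f :: "nat \<Rightarrow> nat \<Rightarrow> 'a::heine_borel"
  assumes "\<And>j. j < N \<Longrightarrow> bounded (range (\<lambda>k. f k j))"
  shows "\<exists>s l. strict_mono (s :: nat \<Rightarrow> nat) \<and> (\<forall>j<N. (\<lambda>k. f (s k) j) \<longlonglongrightarrow> l j)"
  using assms
proof (induction N)
  case 0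
  then show ?case by (auto intro!: exI[of _ id] simp: strict_mono_def)
next
  case (Suc N)
  then obtain s l where s: "strict_mono (s :: nat \<Rightarrow> nat)" "\<forall>j<N. (\<lambda>k. f (s k) j) \<longlonglongrightarrow> l j" by auto
  have "bounded (range (\<lambda>k. f (s k) N))"
    by (rule bounded_subset[OF Suc.prems[of N]]) auto
  then obtain x r where r: "strict_mono (r :: nat \<Rightarrow> nat)" "((\<lambda>k. f (s k) N) \<circ> r) \<longlonglongrightarrow> x"
    using bounded_imp_convergent_subsequence by blast
  show ?case
  proof (rule exI[of _ "s \<circ> r"], rule exI[of _ "l(N := x)"], intro conjI allI impI)
    show "strict_mono (s \<circ> r)" using s(1) r(1) by (rule strict_mono_o)
    fix j assume "j < Suc N"
    then show "(\<lambda>k. f ((s \<circ> r) k) j) \<longlonglongrightarrow> (l(N := x)) j"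
      using r(2) LIMSEQ_subseq_LIMSEQ[OF s(2)[rule_format, of j] r(1)]
      by (cases "j = N") (auto simp: comp_def)
  qed
qed

section \<open>Compact parameter sets of similitudes\<close>

type_synonym 'd sim = "real \<times> (real ^ 'd ^ 'd) \<times> (real ^ 'd)"

definition sim_map :: "('d::finite) sim \<Rightarrow> real ^ 'd \<Rightarrow> real ^ 'd" where
  "sim_map p x = fst p *\<^sub>R (fst (snd p) *v x) + snd (snd p)"

text \<open>All conditions are closed and, for nonnegative c and closed V, the set is compact. A
  positive lower bound c keeps limits of similitudes from degenerating, and invariance of V survives
  in the limit.\<close>

definition preserving_sims :: "(real ^ 'd) set \<Rightarrow> real \<Rightarrow> real \<Rightarrow> ('d::finite) sim set" where
  "preserving_sims V c B = {p. c \<le> fst p \<and> fst p \<le> 1 \<and> orthogonal_matrix (fst (snd p)) \<and>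
     (\<forall>v\<in>V. fst (snd p) *v v \<in> V) \<and> norm (snd (snd p)) \<le> B}"

lemma closed_preserving_sims:
  assumes "closed V"
  shows "closed (preserving_sims V c B)"
proof -
  have cont: "continuous_on UNIV (\<lambda>p :: 'a sim. fst (snd p) *v x)" for x
    by (rule bounded_linear.continuous_on[OF bounded_linear_matrix_vector_mult_left])
       (intro continuous_intros)
  have "preserving_sims V c B = {p. c \<le> fst p} \<inter> {p. fst p \<le> 1} \<inter>
      (\<Inter>x. {p. norm (fst (snd p) *v x) = norm x}) \<inter> (\<Inter>v\<in>V. (\<lambda>p. fst (snd p) *v v) -` V) \<inter>
      {p. norm (snd (snd p)) \<le> B}"
    by (auto simp: preserving_sims_def orthogonal_matrix_iff_norm)
  moreover have "closed \<dots>"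
    using assms by (intro closed_Int closed_INT ballI closed_Collect_le closed_Collect_eq
      closed_vimage continuous_intros cont)
  ultimately show ?thesis by simp
qed

lemma bounded_preserving_sims:
  assumes "0 \<le> c"
  shows "bounded (preserving_sims V c B :: ('d::finite) sim set)"
proof -
  have "preserving_sims V c B \<subseteq> cball 0 1 \<times> cball 0 (real CARD('d)) \<times> cball (0 :: real ^ 'd) B"
    using assms norm_orthogonal_matrix_le by (auto simp: preserving_sims_def)
  then show ?thesis by (rule bounded_subset[rotated]) (intro bounded_Times bounded_cball)
qed

text \<open>Convergence of parameters becomes uniform convergence on bounded sets; uniformity
  matters because the point of \<open>F\<close> to which it is applied varies along the
  sequence.\<close>

lemma sim_map_lipschitz_param:
  fixes p q :: "('d::finite) sim" and D :: real
  assumes p: "p \<in> preserving_sims V c B" and q: "q \<in> preserving_sims V c B" and c: "0 \<le> c"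
    and x: "norm x \<le> D"
  shows "norm (sim_map p x - sim_map q x) \<le> (D + CARD('d) * D + 1) * dist p q"
proof -
  have orth: "orthogonal_matrix (fst (snd p))" using p by (simp add: preserving_sims_def)
  have q1: "0 \<le> fst q" "fst q \<le> 1" using q c by (auto simp: preserving_sims_def)
  have d: "\<bar>fst p - fst q\<bar> \<le> dist p q" "norm (fst (snd p) - fst (snd q)) \<le> dist p q"
    "norm (snd (snd p) - snd (snd q)) \<le> dist p q"
    using dist_fst_le[of p q] dist_snd_le[of p q] dist_fst_le[of "snd p" "snd q"]
      dist_snd_le[of "snd p" "snd q"] by (auto simp flip: dist_norm simp: dist_real_def)
  have "sim_map p x - sim_map q x = (fst p - fst q) *\<^sub>R (fst (snd p) *v x) +
      fst q *\<^sub>R ((fst (snd p) - fst (snd q)) *v x) + (snd (snd p) - snd (snd q))"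
    by (simp add: sim_map_def algebra_simps)
  also have "norm \<dots> \<le> dist p q * D + 1 * (CARD('d) * (dist p q * D)) + dist p q"
  proof (intro norm_triangle_mono)
    show "norm ((fst p - fst q) *\<^sub>R (fst (snd p) *v x)) \<le> dist p q * D"
      using d(1) x by (simp add: orthogonal_matrix_norm[OF orth] mult_mono)
    have "norm ((fst (snd p) - fst (snd q)) *v x) \<le> CARD('d) * (norm (fst (snd p) - fst (snd q)) * norm x)"
      by (rule norm_matrix_vector_mult_le)
    also have "\<dots> \<le> CARD('d) * (dist p q * D)" using d(2) x by (intro mult_left_mono mult_mono) auto
    finally show "norm (fst q *\<^sub>R ((fst (snd p) - fst (snd q)) *v x)) \<le> 1 * (CARD('d) * (dist p q * D))"
      using q1 unfolding norm_scaleR by (intro mult_mono) auto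
  qed (rule d)
  finally show ?thesis by (simp add: algebra_simps)
qed

text \<open>Gives all stages of a sequence of finite sets the same index set, so that a convergent
  subsequence can be extracted index by index.\<close>

lemma ex_enumeration_padded:
  assumes "finite G" "card G \<le> N" "G \<subseteq> K" "d \<in> K"
  shows "\<exists>g :: nat \<Rightarrow> 'a. range g \<subseteq> K \<and> G \<subseteq> g ` {..<N}"
proof -
  obtain h where h: "bij_betw h {0..<card G} G" using ex_bij_betw_nat_finite[OF assms(1)] by blast
  define g where "g j = (if j < card G then h j else d)" for j
  have "g ` {0..<card G} = G" using h by (auto simp: g_def bij_betw_def)
  then have "G \<subseteq> g ` {..<N}" using assms(2) by fastforce
  moreover have "range g \<subseteq> K" using h assms(3,4) by (auto simp: g_def bij_betw_def)
  ultimately show ?thesis by blast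
qed

context generating_ifs
begin

text \<open>\<open>a k\<close>, \<open>A k\<close>, \<open>b k\<close> describe blow-ups of
  \<open>F\<close> that contain E approximately. Each is covered near E by at most N rescaled
  cylinders with parameters in one compact set; along a subsequence all N parameters converge. The
  limit images are compact, so a point of E outside their union would stay at positive distance from
  them, contradicting the approximation.\<close>

lemma blow_up_limit_cover:
  assumes osc: "open_set_condition S"
    and V: "closed V" "\<And>\<sigma> v. \<sigma> \<in> words0 S \<Longrightarrow> v \<in> V \<Longrightarrow> word_rot S \<sigma> *v v \<in> V"
    and E: "bounded E"
    and h: "\<And>k :: nat. 0 < a k \<and> a k < 1 \<and> orthogonal_matrix (A k) \<and> (\<forall>v\<in>V. transpose (A k) *v v \<in> V)"
    and cov: "\<And>k z. z \<in> E \<Longrightarrow> \<exists>z'. norm (z - z') \<le> inverse (Suc k) \<and> a k *\<^sub>R (A k *v z') + b k \<in> F"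
  obtains N :: nat and l c B where "0 < c" "\<And>j. l j \<in> preserving_sims V c B" "E \<subseteq> (\<Union>j<N. sim_map (l j) ` F)"
proof -
  obtain c where c: "0 < c" "c \<le> 1" and cyl: "\<And>R. \<exists>N. \<forall>r y. 0 < r \<longrightarrow> r < 1 \<longrightarrow>
    (\<exists>\<Sigma>\<subseteq>words0 S. finite \<Sigma> \<and> card \<Sigma> \<le> N \<and> F \<inter> cball y (r * R) \<subseteq> (\<Union>\<sigma>\<in>\<Sigma>. word_map S \<sigma> ` F) \<and>
      (\<forall>\<sigma>\<in>\<Sigma>. c * r \<le> word_ratio S \<sigma> \<and> word_ratio S \<sigma> \<le> r \<and>
        word_map S \<sigma> ` F \<inter> cball y (r * R) \<noteq> {}))"
    using open_set_condition_cover[OF osc] by metis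
  obtain R0 where R0: "0 < R0" "\<And>z. z \<in> E \<Longrightarrow> norm z \<le> R0" using E bounded_pos by metis
  \<comment> \<open>The approximating points \<open>z'\<close> lie within distance 1 of E.\<close>
  define R where "R = R0 + 1"
  obtain D where D: "0 < D" "\<And>x. x \<in> F \<Longrightarrow> norm x \<le> D" using F_diff_bound by metis
  obtain N where N: "\<And>r y. 0 < r \<Longrightarrow> r < 1 \<Longrightarrow>
    (\<exists>\<Sigma>\<subseteq>words0 S. finite \<Sigma> \<and> card \<Sigma> \<le> N \<and> F \<inter> cball y (r * R) \<subseteq> (\<Union>\<sigma>\<in>\<Sigma>. word_map S \<sigma> ` F) \<and>
      (\<forall>\<sigma>\<in>\<Sigma>. c * r \<le> word_ratio S \<sigma> \<and> word_ratio S \<sigma> \<le> r \<and>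
        word_map S \<sigma> ` F \<inter> cball y (r * R) \<noteq> {}))"
    using cyl[of R] by blast
  \<comment> \<open>A rescaled cylinder meets the ball of radius R around 0, and D bounds the
    distance from that point to the image of 0.\<close>
  define K where "K = preserving_sims V c (D + R)"
  have "\<exists>g :: nat \<Rightarrow> 'd sim. range g \<subseteq> K \<and>
      (\<forall>z\<in>E. \<exists>j<N. \<exists>x\<in>F. norm (z - sim_map (g j) x) \<le> inverse (Suc k))" for k
  proof -
    have ak: "0 < a k" "a k < 1" "orthogonal_matrix (A k)" "\<And>v. v \<in> V \<Longrightarrow> transpose (A k) *v v \<in> V"
      using h[of k] by auto
    obtain \<Sigma> where \<Sigma>: "\<Sigma> \<subseteq> words0 S" "finite \<Sigma>" "card \<Sigma> \<le> N"
      "F \<inter> cball (b k) (a k * R) \<subseteq> (\<Union>\<sigma>\<in>\<Sigma>. word_map S \<sigma> ` F)"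
      "\<And>\<sigma>. \<sigma> \<in> \<Sigma> \<Longrightarrow> c * a k \<le> word_ratio S \<sigma> \<and> word_ratio S \<sigma> \<le> a k \<and>
        word_map S \<sigma> ` F \<inter> cball (b k) (a k * R) \<noteq> {}"
      using N[OF ak(1,2), of "b k"] by metis
    \<comment> \<open>These are the parameters of the cylinder map followed by the inverse of the
      k-th similitude.\<close>
    define G where "G \<sigma> = (word_ratio S \<sigma> / a k, transpose (A k) ** word_rot S \<sigma>,
      (1 / a k) *\<^sub>R (transpose (A k) *v (word_map S \<sigma> 0 - b k)))" for \<sigma>
    have G: "sim_map (G \<sigma>) x = (1 / a k) *\<^sub>R (transpose (A k) *v (word_map S \<sigma> x - b k))"
      if "\<sigma> \<in> \<Sigma>" for \<sigma> x
      using word_map_eq[of \<sigma> x] that \<Sigma>(1) ak(1)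
      by (simp add: sim_map_def G_def algebra_simps subset_iff matrix_vector_mul_assoc)
    have "G ` \<Sigma> \<subseteq> K"
    proof
      fix p assume "p \<in> G ` \<Sigma>"
      then obtain \<sigma> where \<sigma>: "\<sigma> \<in> \<Sigma>" "p = G \<sigma>" by blast
      have \<sigma>0: "\<sigma> \<in> words0 S" using \<sigma>(1) \<Sigma>(1) by blast
      obtain x where x: "x \<in> F" "norm (word_map S \<sigma> x - b k) \<le> a k * R"
        using \<Sigma>(5)[OF \<sigma>(1)] by (auto simp: dist_norm norm_minus_commute)
      have "norm (word_map S \<sigma> 0 - b k) \<le> word_ratio S \<sigma> * norm (0 - x) + a k * R"
        using norm_triangle_ineq[of "word_map S \<sigma> 0 - word_map S \<sigma> x" "word_map S \<sigma> x - b k"]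
          norm_word_map_diff[OF \<sigma>0, of 0 x] x(2) by simp
      also have "\<dots> \<le> a k * D + a k * R"
        using \<Sigma>(5)[OF \<sigma>(1)] D(2)[OF x(1)] ak(1) by (intro add_right_mono mult_mono) auto
      finally have "norm ((1 / a k) *\<^sub>R (transpose (A k) *v (word_map S \<sigma> 0 - b k))) \<le> D + R"
        using ak by (simp add: orthogonal_matrix_norm field_simps)
      moreover have "orthogonal_matrix (transpose (A k) ** word_rot S \<sigma>)"
        using ak(3) orthogonal_word_rot[OF \<sigma>0] by (intro orthogonal_matrix_mul) auto
      ultimately show "p \<in> K"
        using \<Sigma>(5)[OF \<sigma>(1)] ak V(2)[OF \<sigma>0]
        by (simp add: K_def preserving_sims_def \<sigma>(2) G_def field_simps flip: matrix_vector_mul_assoc)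
    qed
    \<comment> \<open>The identity serves as padding; its image of \<open>F\<close> does no harm,
      since only a cover is sought.\<close>
    moreover have "(1, mat 1, 0) \<in> K"
      using c D(1) R0(1) by (auto simp: K_def preserving_sims_def orthogonal_matrix_id R_def)
    moreover have "finite (G ` \<Sigma>)" "card (G ` \<Sigma>) \<le> N"
      using \<Sigma>(2,3) card_image_le[of \<Sigma> G] by auto
    ultimately obtain g :: "nat \<Rightarrow> 'd sim" where g: "range g \<subseteq> K" "G ` \<Sigma> \<subseteq> g ` {..<N}"
      using ex_enumeration_padded[of "G ` \<Sigma>" N K] by metis
    have "\<exists>j<N. \<exists>x\<in>F. norm (z - sim_map (g j) x) \<le> inverse (Suc k)" if z: "z \<in> E" for z
    proof -
      obtain z' where z': "norm (z - z') \<le> inverse (Suc k)" "a k *\<^sub>R (A k *v z') + b k \<in> F"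
        using cov[OF z] by blast
      have "inverse (real (Suc k)) \<le> 1" by (simp add: field_simps)
      then have "norm z' \<le> R"
        using z'(1) R0(2)[OF z] norm_triangle_ineq4[of z "z - z'"] by (simp add: R_def)
      then have "a k *\<^sub>R (A k *v z') + b k \<in> cball (b k) (a k * R)"
        using ak by (simp add: dist_norm orthogonal_matrix_norm)
      with z'(2) \<Sigma>(4) obtain \<sigma> x where \<sigma>: "\<sigma> \<in> \<Sigma>" "x \<in> F" "a k *\<^sub>R (A k *v z') + b k = word_map S \<sigma> x"
        by blast
      have "sim_map (G \<sigma>) x = z'"
        unfolding G[OF \<sigma>(1)] \<sigma>(3)[symmetric]
        using ak(1) by (simp add: matrix_vector_mult_scaleR orthogonal_matrix_cancel[OF ak(3)])
      moreover obtain j where "j < N" "G \<sigma> = g j" using g(2) \<sigma>(1) by blast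
      ultimately show ?thesis using z'(1) \<sigma>(2) by auto
    qed
    with g(1) show ?thesis by blast
  qed
  then obtain g :: "nat \<Rightarrow> nat \<Rightarrow> 'd sim" where gK: "\<And>k j. g k j \<in> K"
    and g: "\<And>k z. z \<in> E \<Longrightarrow> \<exists>j<N. \<exists>x\<in>F. norm (z - sim_map (g k j) x) \<le> inverse (Suc k)"
    by (metis range_subsetD)
  have K: "closed K" "bounded K" unfolding K_def
    using closed_preserving_sims[OF V(1)] bounded_preserving_sims[of c] c(1) by auto
  have "bounded (range (\<lambda>k. g k j))" for j by (rule bounded_subset[OF K(2)]) (use gK in auto)
  then obtain s l0 where s: "strict_mono (s :: nat \<Rightarrow> nat)" and l0: "\<And>j. j < N \<Longrightarrow> (\<lambda>k. g (s k) j) \<longlonglongrightarrow> l0 j"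
    using bounded_family_convergent_subsequence[of N g] by blast
  have l0K: "l0 j \<in> K" if "j < N" for j
    using closed_sequentially[OF K(1) _ l0[OF that]] gK by blast
  \<comment> \<open>The default beyond N is any member of K, so that membership holds for every
    index.\<close>
  define l where "l j = (if j < N then l0 j else g 0 0)" for j
  have l: "l j \<in> K" for j using l0K gK by (simp add: l_def)
  have lim: "(\<lambda>k. g (s k) j) \<longlonglongrightarrow> l j" if "j < N" for j using l0[OF that] that by (simp add: l_def)
  have "E \<subseteq> (\<Union>j<N. sim_map (l j) ` F)"
  proof (rule ccontr)
    assume "\<not> ?thesis"
    then obtain z where z: "z \<in> E" "z \<notin> (\<Union>j<N. sim_map (l j) ` F)" by blast
    have "compact (sim_map p ` F)" for p :: "'d sim"
      unfolding sim_map_def[abs_def]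
      by (intro compact_continuous_image compact_F continuous_intros matrix_vector_mult_linear_continuous_on)
    then have "closed (\<Union>j<N. sim_map (l j) ` F)" by (intro closed_UN) (auto simp: compact_imp_closed)
    then obtain d where d: "0 < d" "ball z d \<subseteq> - (\<Union>j<N. sim_map (l j) ` F)"
      using z(2) open_contains_ball by (metis ComplI open_Compl)
    define C where "C = D + CARD('d) * D + 1"
    have C: "0 < C" using D(1) by (simp add: C_def add_pos_nonneg)
    have "\<forall>\<^sub>F k in sequentially. \<forall>j\<in>{..<N}. dist (g (s k) j) (l j) < d / 2 / C"
      using lim d(1) C by (intro eventually_ball_finite) (auto intro!: tendstoD)
    moreover have "\<forall>\<^sub>F k in sequentially. inverse (real (Suc (s k))) < d / 2"
      using LIMSEQ_subseq_LIMSEQ[OF LIMSEQ_inverse_real_of_nat s] d(1)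
      by (intro order_tendstoD(2)[of _ 0]) (auto simp: comp_def)
    ultimately have "\<forall>\<^sub>F k in sequentially. (\<forall>j\<in>{..<N}. dist (g (s k) j) (l j) < d / 2 / C) \<and>
        inverse (real (Suc (s k))) < d / 2" by (rule eventually_conj)
    then obtain k where k: "\<And>j. j < N \<Longrightarrow> dist (g (s k) j) (l j) < d / 2 / C"
      "inverse (real (Suc (s k))) < d / 2"
      unfolding eventually_sequentially by (metis order_refl lessThan_iff)
    obtain j x where j: "j < N" "x \<in> F" "norm (z - sim_map (g (s k) j) x) \<le> inverse (Suc (s k))"
      using g[OF z(1)] by blast
    have "norm (sim_map (g (s k) j) x - sim_map (l j) x) \<le> C * dist (g (s k) j) (l j)"
      unfolding C_def
      by (rule sim_map_lipschitz_param[OF gK[unfolded K_def] l[unfolded K_def] less_imp_le[OF c(1)] D(2)[OF j(2)]])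
    also have "\<dots> < d / 2" using k(1)[OF j(1)] C by (simp add: field_simps)
    finally have "norm ((z - sim_map (g (s k) j) x) + (sim_map (g (s k) j) x - sim_map (l j) x)) < d / 2 + d / 2"
      using j(3) k(2) by (intro norm_triangle_lt add_strict_mono) auto
    then have "sim_map (l j) x \<in> ball z d" by (simp add: dist_norm)
    with d(2) j(1,2) show False by blast
  qed
  with c(1) l show ?thesis unfolding K_def by (rule that)
qed

end

section \<open>Assouad dimension and orthogonal projection\<close>

lemma dist_similarity:
  fixes A :: "real ^ 'd ^ 'd"
  assumes "0 < c" "orthogonal_matrix A"
  shows "dist (c *\<^sub>R (A *v x) + b) (c *\<^sub>R (A *v y) + b) = c * dist x y"
proof -
  have "c *\<^sub>R (A *v x) + b - (c *\<^sub>R (A *v y) + b) = c *\<^sub>R (A *v (x - y))"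
    by (simp add: algebra_simps)
  then show ?thesis using assms by (simp add: dist_norm orthogonal_matrix_norm)
qed

lemma cover_similarity_image:
  fixes A :: "real ^ 'd ^ 'd"
  assumes c: "0 < c" and A: "orthogonal_matrix A"
    and T: "finite T" "card T = n" "G \<subseteq> (\<Union>z\<in>T. cball z r)"
  shows "\<exists>T. finite T \<and> card T = n \<and> (\<lambda>x. c *\<^sub>R (A *v x) + b) ` G \<subseteq> (\<Union>z\<in>T. cball z (c * r))"
proof -
  let ?f = "\<lambda>x. c *\<^sub>R (A *v x) + b"
  note dist = dist_similarity[OF c A, of _ b]
  have "inj ?f"
  proof (rule injI)
    fix x y assume "?f x = ?f y"
    then show "x = y" using dist[of x y] c by simp
  qed
  then have "card (?f ` T) = n" using T(2) by (simp add: card_image inj_on_subset)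
  moreover have "?f ` G \<subseteq> (\<Union>z\<in>?f ` T. cball z (c * r))"
  proof
    fix y assume "y \<in> ?f ` G"
    then obtain x where x: "x \<in> G" "y = ?f x" by blast
    obtain z where z: "z \<in> T" "dist z x \<le> r" using x(1) T(3) by auto
    have "dist (?f z) y \<le> c * r" unfolding x(2) dist using z(2) c by simp
    then show "y \<in> (\<Union>z\<in>?f ` T. cball z (c * r))" using z(1) by auto
  qed
  ultimately show ?thesis using T(1) by (intro exI[of _ "?f ` T"]) auto
qed

lemma similarity_inverse:
  fixes A :: "real ^ 'd ^ 'd"
  assumes "0 < c" "orthogonal_matrix A"
  shows "(1 / c) *\<^sub>R (transpose A *v (c *\<^sub>R (A *v x) + b)) + - ((1 / c) *\<^sub>R (transpose A *v b)) = x"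
  using assms(1) by (simp add: algebra_simps matrix_vector_mult_scaleR orthogonal_matrix_cancel[OF assms(2)])

text \<open>Covers are carried over in both directions with equal cardinality, so the two
  \<open>LEAST\<close> predicates agree for every n.\<close>

lemma covering_number_similarity:
  fixes A :: "real ^ 'd ^ 'd"
  assumes c: "0 < c" and A: "orthogonal_matrix A"
  shows "covering_number (c * r) ((\<lambda>x. c *\<^sub>R (A *v x) + b) ` G) = covering_number r G"
proof -
  let ?f = "\<lambda>x. c *\<^sub>R (A *v x) + b"
    and ?g = "\<lambda>x. (1 / c) *\<^sub>R (transpose A *v x) + - ((1 / c) *\<^sub>R (transpose A *v b))"
  have gf: "?g ` ?f ` G = G" by (simp only: image_image similarity_inverse[OF assms] image_ident)
  have "(\<exists>T. finite T \<and> card T = n \<and> G \<subseteq> (\<Union>z\<in>T. cball z r)) \<longleftrightarrow>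
    (\<exists>T. finite T \<and> card T = n \<and> ?f ` G \<subseteq> (\<Union>z\<in>T. cball z (c * r)))" for n
  proof
    assume "\<exists>T. finite T \<and> card T = n \<and> ?f ` G \<subseteq> (\<Union>z\<in>T. cball z (c * r))"
    then obtain T where T: "finite T" "card T = n" "?f ` G \<subseteq> (\<Union>z\<in>T. cball z (c * r))" by blast
    have "\<exists>T. finite T \<and> card T = n \<and> ?g ` ?f ` G \<subseteq> (\<Union>z\<in>T. cball z (1 / c * (c * r)))"
      by (rule cover_similarity_image[OF _ _ T]) (use assms in auto)
    then show "\<exists>T. finite T \<and> card T = n \<and> G \<subseteq> (\<Union>z\<in>T. cball z r)"
      unfolding gf using c by simp
  next
    assume "\<exists>T. finite T \<and> card T = n \<and> G \<subseteq> (\<Union>z\<in>T. cball z r)"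
    then obtain T where T: "finite T" "card T = n" "G \<subseteq> (\<Union>z\<in>T. cball z r)" by blast
    then show "\<exists>T. finite T \<and> card T = n \<and> ?f ` G \<subseteq> (\<Union>z\<in>T. cball z (c * r))"
      by (rule cover_similarity_image[OF assms])
  qed
  then show ?thesis by (simp add: covering_number_def)
qed

text \<open>The quotient \<open>R / r\<close> is scale invariant, so an exponent admissible for E
  stays admissible with the same constant.\<close>

lemma assouad_dim_similarity_le:
  fixes A :: "real ^ 'd ^ 'd"
  assumes c: "0 < c" and A: "orthogonal_matrix A"
  shows "assouad_dim ((\<lambda>x. c *\<^sub>R (A *v x) + b) ` E) \<le> assouad_dim E"
proof -
  let ?f = "\<lambda>x. c *\<^sub>R (A *v x) + b"
  note dist = dist_similarity[OF c A, of _ b]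
  have "\<forall>r R. 0 < r \<and> r < R \<longrightarrow>
     (\<forall>x\<in>?f ` E. real (covering_number r (cball x R \<inter> ?f ` E)) \<le> C * (R / r) powr s)"
    if C: "\<forall>r R. 0 < r \<and> r < R \<longrightarrow>
     (\<forall>x\<in>E. real (covering_number r (cball x R \<inter> E)) \<le> C * (R / r) powr s)" for C s
  proof (intro allI impI ballI)
    fix r R :: real and x assume r: "0 < r \<and> r < R" and "x \<in> ?f ` E"
    then obtain e where e: "e \<in> E" "x = ?f e" by blast
    have "cball x R \<inter> ?f ` E = ?f ` (cball e (R / c) \<inter> E)"
    proof -
      have "?f y \<in> cball x R \<longleftrightarrow> y \<in> cball e (R / c)" for y
        unfolding mem_cball e(2) dist using c by (simp add: pos_le_divide_eq mult.commute)
      then show ?thesis by blast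
    qed
    then have "covering_number r (cball x R \<inter> ?f ` E) = covering_number (r / c) (cball e (R / c) \<inter> E)"
      using covering_number_similarity[OF assms, of "r / c"] c by simp
    also have "real \<dots> \<le> C * ((R / c) / (r / c)) powr s"
      using C[rule_format, of "r / c" "R / c" e] r c e(1) by (simp add: divide_strict_right_mono)
    also have "(R / c) / (r / c) = R / r" using c by simp
    finally show "real (covering_number r (cball x R \<inter> ?f ` E)) \<le> C * (R / r) powr s" .
  qed
  then show ?thesis unfolding assouad_dim_def by (intro Inf_superset_mono) blast
qed

lemma assouad_dim_similarity:
  fixes A :: "real ^ 'd ^ 'd"
  assumes "0 < c" "orthogonal_matrix A"
  shows "assouad_dim ((\<lambda>x. c *\<^sub>R (A *v x) + b) ` E) = assouad_dim E"
proof (rule antisym[OF assouad_dim_similarity_le[OF assms]])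
  let ?f = "\<lambda>x. c *\<^sub>R (A *v x) + b"
    and ?g = "\<lambda>x. (1 / c) *\<^sub>R (transpose A *v x) + - ((1 / c) *\<^sub>R (transpose A *v b))"
  have gf: "?g ` ?f ` E = E" by (simp only: image_image similarity_inverse[OF assms] image_ident)
  have "assouad_dim (?g ` ?f ` E) \<le> assouad_dim (?f ` E)"
    by (rule assouad_dim_similarity_le) (use assms in auto)
  then show "assouad_dim E \<le> assouad_dim (?f ` E)" unfolding gf .
qed

section \<open>Orthogonal projection and invariant subspaces\<close>

lemma orthogonal_projection_comp_eq:
  assumes "subspace V" "v \<in> V" "w \<in> orthogonal_comp V"
  shows "orthogonal_projection (orthogonal_comp V) (v + w) = w"
  unfolding orthogonal_projection_def
proof (rule the_equality)
  show "w \<in> orthogonal_comp V \<and> (\<forall>u\<in>orthogonal_comp V. orthogonal (v + w - w) u)"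
    using assms by (simp add: orthogonal_comp_def)
  fix y assume y: "y \<in> orthogonal_comp V \<and> (\<forall>u\<in>orthogonal_comp V. orthogonal (v + w - y) u)"
  then have d: "w - y \<in> orthogonal_comp V"
    using assms(3) subspace_diff[OF subspace_orthogonal_comp] by blast
  then have "(v + w - y) \<bullet> (w - y) = 0" "v \<bullet> (w - y) = 0"
    using y assms(2) by (auto simp: orthogonal_def orthogonal_comp_def)
  then have "(w - y) \<bullet> (w - y) = 0" by (simp add: algebra_simps inner_commute)
  then show "y = w" by simp
qed

lemma orthogonal_projection_comp:
  fixes x :: "real ^ 'd"
  assumes "subspace V"
  defines "w \<equiv> orthogonal_projection (orthogonal_comp V) x"
  shows "w \<in> orthogonal_comp V" "x - w \<in> V" "norm w \<le> norm x" "norm (x - w) \<le> norm x"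
proof -
  obtain y z where yz: "y \<in> span V" "\<And>u. u \<in> span V \<Longrightarrow> orthogonal z u" "x = y + z"
    using orthogonal_subspace_decomp_exists by blast
  have y: "y \<in> V" using yz(1) assms(1) by (metis span_eq_iff)
  have z: "z \<in> orthogonal_comp V"
    using yz(2) by (auto simp: orthogonal_comp_def orthogonal_commute span_base)
  have w: "w = z" unfolding w_def yz(3) by (rule orthogonal_projection_comp_eq[OF assms(1) y z])
  show "w \<in> orthogonal_comp V" "x - w \<in> V" using w y z yz(3) by simp_all
  have "(norm x)\<^sup>2 = (norm y)\<^sup>2 + (norm z)\<^sup>2"
    unfolding yz(3) using yz(1,2) by (intro norm_add_Pythagorean) (simp add: orthogonal_commute)
  then have "(norm z)\<^sup>2 \<le> (norm x)\<^sup>2" "(norm y)\<^sup>2 \<le> (norm x)\<^sup>2" by simp_all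
  then show "norm w \<le> norm x" "norm (x - w) \<le> norm x"
    using w yz(3) by (simp_all add: power2_le_iff_abs_le)
qed

lemma orthogonal_projection_comp_diff:
  fixes x y :: "real ^ 'd"
  assumes "subspace V"
  defines "\<pi> \<equiv> orthogonal_projection (orthogonal_comp V)"
  shows "\<pi> x - \<pi> y = \<pi> (x - y)"
proof -
  note * = orthogonal_projection_comp[OF assms(1), folded \<pi>_def]
  have "(x - \<pi> x) - (y - \<pi> y) \<in> V" by (intro subspace_diff assms *)
  moreover have "\<pi> x - \<pi> y \<in> orthogonal_comp V" by (intro subspace_diff subspace_orthogonal_comp *)
  ultimately have "\<pi> (((x - \<pi> x) - (y - \<pi> y)) + (\<pi> x - \<pi> y)) = \<pi> x - \<pi> y"
    unfolding \<pi>_def by (rule orthogonal_projection_comp_eq[OF assms(1)])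
  then show ?thesis by (simp add: algebra_simps)
qed

text \<open>An injective linear map of the finite-dimensional V into itself is onto, so the inverse,
  here the transpose, preserves V too. Preservation of inner products then transfers both
  invariances to the complement.\<close>

lemma orthogonal_matrix_invariant:
  fixes A :: "real ^ 'd ^ 'd"
  assumes A: "orthogonal_matrix A" and V: "subspace V" "\<And>v. v \<in> V \<Longrightarrow> A *v v \<in> V"
  shows "v \<in> V \<Longrightarrow> transpose A *v v \<in> V"
    and "w \<in> orthogonal_comp V \<Longrightarrow> A *v w \<in> orthogonal_comp V"
    and "w \<in> orthogonal_comp V \<Longrightarrow> transpose A *v w \<in> orthogonal_comp V"
proof -
  have lin: "linear ((*v) A)" by simp
  have "inj ((*v) A)" using orthogonal_matrix_cancel(1)[OF A] by (metis injI)
  then have "dim ((*v) A ` V) = dim V" by (intro dim_image_eq lin) (rule inj_on_subset, auto)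
  moreover have "(*v) A ` V \<subseteq> V" using V(2) by blast
  ultimately have "(*v) A ` V = V"
    by (intro subspace_dim_equal linear_subspace_image lin V(1)) auto
  then show t: "transpose A *v v \<in> V" if "v \<in> V" for v
    using that orthogonal_matrix_cancel(1)[OF A] by (metis imageE)
  show "A *v w \<in> orthogonal_comp V" if w: "w \<in> orthogonal_comp V"
  proof -
    have "v \<bullet> (A *v w) = 0" if "v \<in> V" for v
      using orthogonal_matrix_inner[OF A, of "transpose A *v v" w] t[OF that] w
      by (simp add: orthogonal_matrix_cancel(2)[OF A] orthogonal_comp_def orthogonal_def)
    then show ?thesis by (simp add: orthogonal_comp_def orthogonal_def)
  qed
  show "transpose A *v w \<in> orthogonal_comp V" if w: "w \<in> orthogonal_comp V"
  proof -
    have "v \<bullet> (transpose A *v w) = 0" if "v \<in> V" for v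
      using orthogonal_matrix_inner[OF A, of v "transpose A *v w"] V(2)[OF that] w
      by (simp add: orthogonal_matrix_cancel(2)[OF A] orthogonal_comp_def orthogonal_def)
    then show ?thesis by (simp add: orthogonal_comp_def orthogonal_def)
  qed
qed

section \<open>Products inside self-similar sets\<close>

text \<open>A finite Baire argument: if the last closed set misses a point of E, restrict E to a
  ball avoiding that set and continue with one set fewer.\<close>

lemma ex_relatively_open_piece:
  fixes E :: "'a::metric_space set"
  assumes "\<And>j. j < N \<Longrightarrow> closed (C j)" "E \<noteq> {}" "E \<subseteq> (\<Union>j<(N::nat). C j)"
  shows "\<exists>j<N. \<exists>z\<in>E. \<exists>r>0. ball z r \<inter> E \<subseteq> C j"
  using assms
proof (induction N arbitrary: E)
  case (Suc N)
  show ?case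
  proof (cases "E \<subseteq> C N")
    case True
    obtain z where "z \<in> E" using Suc.prems(2) by blast
    with True show ?thesis by (intro exI[of _ N] conjI bexI[of _ z] exI[of _ 1]) auto
  next
    case False
    then obtain z where z: "z \<in> E" "z \<in> - C N" by blast
    have "open (- C N)" using Suc.prems(1)[of N] by (simp add: open_Compl)
    then obtain r where r: "0 < r" "ball z r \<subseteq> - C N" using z(2) by (rule openE)
    have "\<exists>j<N. \<exists>z'\<in>E \<inter> ball z r. \<exists>r'>0. ball z' r' \<inter> (E \<inter> ball z r) \<subseteq> C j"
    proof (rule Suc.IH)
      show "E \<inter> ball z r \<noteq> {}" using z(1) r(1) by auto
      show "E \<inter> ball z r \<subseteq> (\<Union>j<N. C j)"
      proof
        fix y assume y: "y \<in> E \<inter> ball z r"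
        then obtain j where "j < Suc N" "y \<in> C j" using Suc.prems(3) by blast
        moreover have "y \<notin> C N" using y r(2) by blast
        ultimately show "y \<in> (\<Union>j<N. C j)" by (auto simp: less_Suc_eq)
      qed
    qed (use Suc.prems(1) in auto)
    then obtain j z' r' where j: "j < N" "z' \<in> E" "z' \<in> ball z r" "0 < r'"
      "ball z' r' \<inter> (E \<inter> ball z r) \<subseteq> C j" by blast
    obtain r'' where r'': "0 < r''" "ball z' r'' \<subseteq> ball z r" using openE[OF open_ball j(3)] by blast
    have "ball z' (min r' r'') \<inter> E \<subseteq> C j"
    proof
      fix y assume y: "y \<in> ball z' (min r' r'') \<inter> E"
      then have "y \<in> ball z' r'" "y \<in> ball z r" using r''(2) by auto
      then show "y \<in> C j" using j(5) y by blast
    qed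
    then show ?thesis using j r''(1)
      by (intro exI[of _ j] conjI bexI[of _ z'] exI[of _ "min r' r''"]) auto
  qed
qed simp

context generating_ifs
begin

lemma word_ratio_less_1:
  assumes "\<alpha> \<in> words S" shows "word_ratio S \<alpha> < 1"
proof -
  obtain i \<beta> where \<alpha>: "\<alpha> = i # \<beta>" "i < length S" "\<beta> \<in> words0 S"
    using assms words_iff by (cases \<alpha>) auto
  then have "word_ratio S \<alpha> \<le> sim_ratio (S ! i)"
    using letter(1) word_ratio_le_1 by (simp add: mult_left_le less_imp_le)
  then show ?thesis using letter(2)[OF \<alpha>(2)] by simp
qed

lemma norm_overlapping_direction: "overlapping_direction S F \<omega> \<Longrightarrow> norm \<omega> = 1"
  by (simp add: overlapping_direction_def)

lemma overlap_span_rot: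
  assumes "\<sigma> \<in> words0 S" "v \<in> span {\<omega>. overlapping_direction S F \<omega>}"
  shows "word_rot S \<sigma> *v v \<in> span {\<omega>. overlapping_direction S F \<omega>}"
proof -
  have "word_rot S \<sigma> *v v \<in> (*v) (word_rot S \<sigma>) ` span {\<omega>. overlapping_direction S F \<omega>}"
    using assms(2) by (rule imageI)
  also have "\<dots> = span ((*v) (word_rot S \<sigma>) ` {\<omega>. overlapping_direction S F \<omega>})"
    by (simp add: linear_span_image)
  also have "\<dots> \<subseteq> span {\<omega>. overlapping_direction S F \<omega>}"
    using overlapping_direction_rot[OF _ assms(1)] by (intro span_mono) auto
  finally show ?thesis .
qed

text \<open>The convex hull of 0 and X has affine hull \<open>span X\<close> and a relative interior
  point. Its coefficients lie between 0 and 1, so its M-fold dilate lies in the parallelepiped, and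
  the radius of the ball grows linearly with M.\<close>

lemma ball_in_parallelepiped:
  fixes X :: "(real ^ 'd) set"
  assumes "finite X"
  obtains v0 e where "v0 \<in> span X" "0 < e" "\<forall>M>0. \<forall>v\<in>span X. norm (v - M *\<^sub>R v0) < M * e \<longrightarrow>
    v \<in> {\<Sum>u\<in>X. s u *\<^sub>R u | s. \<forall>u\<in>X. 0 \<le> s u \<and> s u \<le> M}"
proof -
  let ?H = "convex hull (insert 0 X)"
  have "rel_interior ?H \<noteq> {}" by (simp add: rel_interior_eq_empty)
  then obtain v0 e where v0: "v0 \<in> ?H" "0 < e" "ball v0 e \<inter> affine hull ?H \<subseteq> ?H"
    using mem_rel_interior_ball by blast
  have aff: "affine hull ?H = span X"
    by (simp add: affine_hull_span_0 hull_inc)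
  show ?thesis
  proof (rule that)
    show "v0 \<in> span X" using v0(1) aff hull_subset by fast
    show "0 < e" by (rule v0)
    show "\<forall>M>0. \<forall>v\<in>span X. norm (v - M *\<^sub>R v0) < M * e \<longrightarrow>
      v \<in> {\<Sum>u\<in>X. s u *\<^sub>R u | s. \<forall>u\<in>X. 0 \<le> s u \<and> s u \<le> M}"
    proof (intro allI ballI impI)
      fix M :: real and v assume M: "0 < M" and v: "v \<in> span X" "norm (v - M *\<^sub>R v0) < M * e"
      have "v0 - (1 / M) *\<^sub>R v = (- 1 / M) *\<^sub>R (v - M *\<^sub>R v0)" using M by (simp add: algebra_simps)
      then have "norm (v0 - (1 / M) *\<^sub>R v) = norm (v - M *\<^sub>R v0) / M"
        using M by (simp only: norm_scaleR) simp
      then have "norm (v0 - (1 / M) *\<^sub>R v) < e" using v(2) M by (simp add: pos_divide_less_eq mult.commute)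
      then have "(1 / M) *\<^sub>R v \<in> ?H" using v0(3) v(1) aff by (auto simp: dist_norm span_scale)
      then obtain u where u: "\<forall>x\<in>insert 0 X. 0 \<le> u x" "sum u (insert 0 X) = 1"
          "(\<Sum>x\<in>insert 0 X. u x *\<^sub>R x) = (1 / M) *\<^sub>R v"
        using assms by (auto simp: convex_hull_finite simp del: insert_iff)
      have le: "u x \<le> 1" if "x \<in> X" for x
        using member_le_sum[of x "insert 0 X" u] that assms u(1,2) by auto
      have "(\<Sum>x\<in>insert 0 X. u x *\<^sub>R x) = (\<Sum>x\<in>X. u x *\<^sub>R x)"
        using assms by (intro sum.mono_neutral_right) auto
      then have eq: "(\<Sum>x\<in>X. u x *\<^sub>R x) = (1 / M) *\<^sub>R v" using u(3) by metis
      have "v = M *\<^sub>R (\<Sum>x\<in>X. u x *\<^sub>R x)" unfolding eq using M by simp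
      also have "\<dots> = (\<Sum>x\<in>X. (M * u x) *\<^sub>R x)" by (simp add: scaleR_sum_right)
      finally show "v \<in> {\<Sum>u\<in>X. s u *\<^sub>R u | s. \<forall>u\<in>X. 0 \<le> s u \<and> s u \<le> M}"
        using u(1) le M by (intro CollectI exI[of _ "\<lambda>x. M * u x"]) (auto simp: mult_left_le)
    qed
  qed
qed

text \<open>The point \<open>v + \<pi> x\<close> is x shifted by \<open>v - (x - \<pi> x)\<close>, a
  vector of V. So an approximate copy of \<open>F\<close> for every shift in a large enough ball of
  V contains approximations to the whole product.\<close>

lemma blow_up_near_product:
  fixes V defines "V \<equiv> span {\<omega>. overlapping_direction S F \<omega>}"
  obtains v0 where "v0 \<in> V" "\<And>\<epsilon>. 0 < \<epsilon> \<Longrightarrow> \<exists>\<alpha>\<in>words S. \<forall>v\<in>V. \<forall>x\<in>F. norm (v - v0) < 1 \<longrightarrow>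
    (\<exists>z. norm (v + orthogonal_projection (orthogonal_comp V) x - z) \<le> \<epsilon> \<and> word_map S \<alpha> z \<in> F)"
proof -
  have V: "subspace V" by (simp add: V_def)
  define \<pi> where "\<pi> = orthogonal_projection (orthogonal_comp V)"
  obtain X where X: "X \<subseteq> {\<omega>. overlapping_direction S F \<omega>}" "independent X"
      "{\<omega>. overlapping_direction S F \<omega>} \<subseteq> span X"
    using maximal_independent_subset by blast
  have fin: "finite X" using X(2) by (rule independent_imp_finite)
  have span: "span X = V" 
  proof
    show "span X \<subseteq> V" unfolding V_def by (rule span_mono[OF X(1)])
    show "V \<subseteq> span X" unfolding V_def by (rule span_minimal[OF X(3) subspace_span])
  qed
  obtain v1 e where v1: "v1 \<in> V" "0 < e" "\<forall>M>0. \<forall>v\<in>V. norm (v - M *\<^sub>R v1) < M * e \<longrightarrow>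
    v \<in> {\<Sum>u\<in>X. s u *\<^sub>R u | s. \<forall>u\<in>X. 0 \<le> s u \<and> s u \<le> M}"
    using ball_in_parallelepiped[OF fin] unfolding span by blast
  obtain D where D: "0 < D" "\<And>x. x \<in> F \<Longrightarrow> norm x \<le> D" using F_diff_bound by metis
  \<comment> \<open>The ball in the parallelepiped gets radius \<open>1 + D\<close>: 1 for v and D
    for the component of x in V.\<close>
  define M where "M = (1 + D) / e"
  have M: "0 < M" "M * e = 1 + D" using v1(2) D(1) by (auto simp: M_def)
  show ?thesis
  proof (rule that[of "M *\<^sub>R v1"])
    show "M *\<^sub>R v1 \<in> V" using V v1(1) by (rule subspace_scale)
    fix \<epsilon> :: real assume "0 < \<epsilon>"
    have "realizable \<epsilon> {\<Sum>u\<in>X. s u *\<^sub>R u | s. \<forall>u\<in>X. 0 \<le> s u \<and> s u \<le> M}"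
    proof (rule realizable_parallelepiped[OF fin _ \<open>0 < \<epsilon>\<close>])
      fix u assume "u \<in> X"
      then have "overlapping_direction S F u" using X(1) by blast
      then show "translation_dir u \<and> norm u = 1"
        by (auto intro: overlapping_direction_imp_translation_dir norm_overlapping_direction)
    qed (use M(1) in simp)
    then obtain \<alpha> where \<alpha>: "\<alpha> \<in> words S" "\<And>p. p \<in> {\<Sum>u\<in>X. s u *\<^sub>R u | s. \<forall>u\<in>X. 0 \<le> s u \<and> s u \<le> M} \<Longrightarrow>
        \<exists>\<beta>\<in>words S. \<forall>x\<in>F. norm (inv (word_map S \<alpha>) (word_map S \<beta> x) - (x + p)) \<le> \<epsilon>"
      unfolding realizable_def by blast
    have "\<exists>z. norm (v + \<pi> x - z) \<le> \<epsilon> \<and> word_map S \<alpha> z \<in> F"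
      if v: "v \<in> V" "norm (v - M *\<^sub>R v1) < 1" and x: "x \<in> F" for v x
    proof -
      define p where "p = v - (x - \<pi> x)"
      have \<pi>: "x - \<pi> x \<in> V" "norm (x - \<pi> x) \<le> D"
        using orthogonal_projection_comp[OF V, of x] D(2)[OF x] by (auto simp: \<pi>_def)
      have "norm (p - M *\<^sub>R v1) \<le> norm (v - M *\<^sub>R v1) + norm (x - \<pi> x)"
        using norm_triangle_ineq4[of "v - M *\<^sub>R v1" "x - \<pi> x"] by (simp add: p_def algebra_simps)
      then have "norm (p - M *\<^sub>R v1) < M * e" using v(2) \<pi>(2) M(2) by simp
      then obtain \<beta> where \<beta>: "\<beta> \<in> words S"
          "norm (inv (word_map S \<alpha>) (word_map S \<beta> x) - (x + p)) \<le> \<epsilon>"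
        using \<alpha>(2)[OF v1(3)[rule_format, OF M(1), of p]] subspace_diff[OF V v(1) \<pi>(1)] x by (auto simp: p_def)
      have "v + \<pi> x = x + p" by (simp add: p_def)
      moreover have "word_map S \<beta> x \<in> F" using \<beta>(1) x words_iff word_map_in_F by blast
      moreover have "\<alpha> \<in> words0 S" using \<alpha>(1) words_iff by blast
      ultimately show ?thesis using \<beta>(2)
        by (intro exI[of _ "inv (word_map S \<alpha>) (word_map S \<beta> x)"])
          (simp add: norm_minus_commute)
    qed
    with \<alpha>(1) show "\<exists>\<alpha>\<in>words S. \<forall>v\<in>V. \<forall>x\<in>F. norm (v - M *\<^sub>R v1) < 1 \<longrightarrow>
      (\<exists>z. norm (v + orthogonal_projection (orthogonal_comp V) x - z) \<le> \<epsilon> \<and> word_map S \<alpha> z \<in> F)"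
      unfolding \<pi>_def by blast
  qed
qed

end

text \<open>Appending families only enlarges overlap spaces and sets of neighbour maps, so a maximal
  family stays maximal and failure of weak separation persists. Keeping \<open>S1\<close> inside S
  makes its rotations rotations of S, which preserve the overlap space.\<close>

lemma ex_maximal_generating_ifs:
  assumes S1: "generates S1 F" and S2: "generates S2 F" "\<not> weak_separation S2"
  obtains S T where "S = T @ S1" "generates S F" "\<not> weak_separation S"
    "overlap_space F = overlap_space_of S F"
proof -
  let ?d = "\<lambda>S. dim (overlap_space_of S F)"
  obtain S0 where S0: "is_arg_max ?d (\<lambda>S. generates S F) S0" using ex_overlap_space[OF S1] by blast
  define T where "T = S2 @ S0"
  define S where "S = T @ S1"
  have gen: "generates S F"
    unfolding S_def T_def using S0 S1 S2 by (intro generates_append) (auto simp: is_arg_max_def)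
  have "neighbour_maps S2 \<subseteq> neighbour_maps (S2 @ (S0 @ S1))"
    unfolding neighbour_maps_def using word_map_append_left[of _ S2 "S0 @ S1"]
    by (smt (verit) Collect_mono)
  then have "closure (neighbour_maps S2 - {id}) \<subseteq> closure (neighbour_maps S - {id})"
    by (intro closure_mono) (auto simp: S_def T_def)
  then have nws: "\<not> weak_separation S" using S2(2) by (auto simp: weak_separation_def)
  have "overlap_space_of S0 F \<subseteq> overlap_space_of S F"
    unfolding S_def T_def using overlap_space_of_append by (meson order_trans)
  then have "?d S0 \<le> ?d S" by (rule dim_subset)
  moreover have "?d T' \<le> ?d S0" if "generates T' F" for T'
    using S0 that by (auto simp: is_arg_max_def not_less)
  ultimately have "is_arg_max ?d (\<lambda>S. generates S F) S"
    using gen by (auto simp: is_arg_max_def not_less intro: order_trans)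
  then have "overlap_space F = overlap_space_of S F" by (rule overlap_space_eqI)
  with S_def gen nws show ?thesis by (rule that)
qed

text \<open>This relies on \<open>sim_rot\<close> being chosen from the map alone and not from its
  position in a list.\<close>

lemma word_rot_append_right: "word_rot (T @ S) (map (\<lambda>i. length T + i) \<sigma>) = word_rot S \<sigma>"
  by (induction \<sigma>) (auto simp: nth_append)

theorem theorem7p2:
  fixes F :: "(real ^ 'd) set"
  assumes "\<not> contained_in_hyperplane F"
    and "\<exists>S. generates S F \<and> open_set_condition S"
    and "\<exists>S. generates S F \<and> \<not> weak_separation S"
  shows "\<exists>Q C. nontrivial_cube (overlap_dim F) Q \<and> Q \<subseteq> overlap_space F \<and>
           C \<subseteq> orthogonal_comp (overlap_space F) \<and>
           assouad_dim C =
             assouad_dim (orthogonal_projection (orthogonal_comp (overlap_space F)) ` F) \<and>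
           {q + c | q c. q \<in> Q \<and> c \<in> C} \<subseteq> F"
proof -
  obtain S1 S2 where S1: "generates S1 F" "open_set_condition S1"
    and S2: "generates S2 F" "\<not> weak_separation S2" using assms(2,3) by blast
  obtain S T where S: "S = T @ S1" "generates S F" "\<not> weak_separation S"
    "overlap_space F = overlap_space_of S F"
    using ex_maximal_generating_ifs[OF S1(1) S2] by blast
  interpret S: generating_ifs S F by unfold_locales (rule S)
  interpret S1: generating_ifs S1 F by unfold_locales (rule S1)
  define V where "V = overlap_space F"
  have V_eq: "V = span {\<omega>. overlapping_direction S F \<omega>}"
    using S(3,4) by (simp add: V_def overlap_space_of_def)
  have V: "subspace V" by (simp add: V_eq)
  define \<pi> where "\<pi> = orthogonal_projection (orthogonal_comp V)"
  note proj = orthogonal_projection_comp[OF V, folded \<pi>_def]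
  note proj_diff = orthogonal_projection_comp_diff[OF V, folded \<pi>_def]
  note proj_eq = orthogonal_projection_comp_eq[OF V, folded \<pi>_def]
  have rot: "word_rot S \<sigma> *v v \<in> V" if "\<sigma> \<in> words0 S" "v \<in> V" for \<sigma> v
    using S.overlap_span_rot that unfolding V_eq by blast
  have rot1: "word_rot S1 \<sigma> *v v \<in> V" if "\<sigma> \<in> words0 S1" "v \<in> V" for \<sigma> v
  proof -
    have "map (\<lambda>i. length T + i) \<sigma> \<in> words0 S" using that(1) S(1) by auto
    from rot[OF this that(2)] show ?thesis unfolding S(1) word_rot_append_right .
  qed
  obtain v0 where v0: "v0 \<in> V" and approx: "\<And>\<epsilon>. 0 < \<epsilon> \<Longrightarrow> \<exists>\<alpha>\<in>words S. \<forall>v\<in>V. \<forall>x\<in>F. norm (v - v0) < 1 \<longrightarrow>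
    (\<exists>z. norm (v + \<pi> x - z) \<le> \<epsilon> \<and> word_map S \<alpha> z \<in> F)"
    using S.blow_up_near_product unfolding V_eq[symmetric] \<pi>_def[symmetric] by metis
  define E where "E = {v + \<pi> x | v x. v \<in> V \<and> norm (v - v0) < 1 \<and> x \<in> F}"
  obtain D where D: "0 < D" "\<And>x y. x \<in> F \<Longrightarrow> y \<in> F \<Longrightarrow> norm (x - y) \<le> D" "\<And>x. x \<in> F \<Longrightarrow> norm x \<le> D"
    using S.F_diff_bound by metis
  have "\<exists>\<alpha>\<in>words S. \<forall>v\<in>V. \<forall>x\<in>F. norm (v - v0) < 1 \<longrightarrow>
    (\<exists>z. norm (v + \<pi> x - z) \<le> inverse (Suc k) \<and> word_map S \<alpha> z \<in> F)" for k
    by (rule approx) simp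
  then obtain \<alpha> where \<alpha>: "\<And>k. \<alpha> k \<in> words S"
    "\<And>k v x. v \<in> V \<Longrightarrow> x \<in> F \<Longrightarrow> norm (v - v0) < 1 \<Longrightarrow>
      \<exists>z. norm (v + \<pi> x - z) \<le> inverse (Suc k) \<and> word_map S (\<alpha> k) z \<in> F"
    by metis
  have \<alpha>0: "\<alpha> k \<in> words0 S" for k using \<alpha>(1)[of k] words_iff by blast
  \<comment> \<open>The blow-ups come from words of S, the covering cylinders from
    \<open>S1\<close>; both kinds of rotations preserve V.\<close>
  obtain N :: nat and l c B where c: "0 < c" and l: "\<And>j. l j \<in> preserving_sims V c B"
    and cover: "E \<subseteq> (\<Union>j<N. sim_map (l j) ` F)"
  proof (rule S1.blow_up_limit_cover[OF S1(2), of V E "\<lambda>k. word_ratio S (\<alpha> k)"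
        "\<lambda>k. word_rot S (\<alpha> k)" "\<lambda>k. word_map S (\<alpha> k) 0"])
    show "closed V" by (rule closed_subspace[OF V])
    show "bounded E" unfolding bounded_iff
    proof (intro exI[of _ "norm v0 + 1 + D"] ballI)
      fix z assume "z \<in> E"
      then obtain v x where z: "z = v + \<pi> x" "norm (v - v0) < 1" "x \<in> F" by (auto simp: E_def)
      have "norm v \<le> norm v0 + 1" using z(2) norm_triangle_sub[of v v0] by simp
      moreover have "norm (\<pi> x) \<le> D" using proj(3)[of x] D(3)[OF z(3)] by simp
      ultimately show "norm z \<le> norm v0 + 1 + D"
        unfolding z(1) by (intro norm_triangle_mono)
    qed
    show "0 < word_ratio S (\<alpha> k) \<and> word_ratio S (\<alpha> k) < 1 \<and> orthogonal_matrix (word_rot S (\<alpha> k)) \<and>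
        (\<forall>v\<in>V. transpose (word_rot S (\<alpha> k)) *v v \<in> V)" for k
      using S.word_ratio_pos[OF \<alpha>0] S.word_ratio_less_1[OF \<alpha>(1)] S.orthogonal_word_rot[OF \<alpha>0]
        orthogonal_matrix_invariant(1)[OF S.orthogonal_word_rot[OF \<alpha>0] V rot[OF \<alpha>0]] by blast
    show "\<exists>z'. norm (z - z') \<le> inverse (Suc k) \<and>
        word_ratio S (\<alpha> k) *\<^sub>R (word_rot S (\<alpha> k) *v z') + word_map S (\<alpha> k) 0 \<in> F" if "z \<in> E" for k z
      using that \<alpha>(2)[of _ _ k] unfolding S.word_map_eq[OF \<alpha>0, symmetric] by (auto simp: E_def)
  qed (use rot1 in blast)+
  have closed: "closed (sim_map p ` F)" for p :: "'d sim"
    unfolding sim_map_def[abs_def]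
    by (intro compact_imp_closed compact_continuous_image S.compact_F continuous_intros
        matrix_vector_mult_linear_continuous_on)
  obtain x0 where "x0 \<in> F" using S.F_ne by blast
  then have "v0 + \<pi> x0 \<in> E"
    using v0 unfolding E_def by (intro CollectI exI[of _ v0] exI[of _ x0]) auto
  then obtain j z r where z: "z \<in> E" and r: "0 < r" "ball z r \<inter> E \<subseteq> sim_map (l j) ` F"
    using ex_relatively_open_piece[of N "\<lambda>j. sim_map (l j) ` F" E, OF closed _ cover] by blast
  obtain a A b where lj: "l j = (a, A, b)" by (cases "l j")
  have A: "orthogonal_matrix A" "\<And>v. v \<in> V \<Longrightarrow> A *v v \<in> V" and a: "0 < a"
    using l[of j] c by (auto simp: preserving_sims_def lj)
  note AV = orthogonal_matrix_invariant[OF A(1) V A(2)]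
  obtain v1 x1 where v1: "v1 \<in> V" "norm (v1 - v0) < 1" and x1: "x1 \<in> F" and z_eq: "z = v1 + \<pi> x1"
    using z by (auto simp: E_def)
  \<comment> \<open>A cylinder through \<open>x1\<close> so small that its projection stays within
    \<open>r / 2\<close> of the projection of \<open>x1\<close>.\<close>
  obtain \<gamma> where \<gamma>: "\<gamma> \<in> words0 S" "x1 \<in> word_map S \<gamma> ` F" "word_ratio S \<gamma> < r / 2 / D"
    using S.small_cylinder[OF x1, of "r / 2 / D"] r(1) D(1) by auto
  let ?R = "word_rot S \<gamma>"
  note R = S.orthogonal_word_rot[OF \<gamma>(1)]
  note RV = orthogonal_matrix_invariant[OF R V rot[OF \<gamma>(1)]]
  have near_x1: "norm (\<pi> (word_map S \<gamma> x) - \<pi> x1) < r / 2" if x: "x \<in> F" for x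
  proof -
    obtain y where y: "y \<in> F" "x1 = word_map S \<gamma> y" using \<gamma>(2) by blast
    have "norm (\<pi> (word_map S \<gamma> x) - \<pi> x1) \<le> norm (word_map S \<gamma> x - x1)"
      unfolding proj_diff by (rule proj(3))
    also have "\<dots> = word_ratio S \<gamma> * norm (x - y)"
      unfolding y(2) by (rule S.norm_word_map_diff[OF \<gamma>(1)])
    also have "\<dots> \<le> word_ratio S \<gamma> * D"
      using D(2)[OF x y(1)] S.word_ratio_pos[OF \<gamma>(1)] by simp
    also have "\<dots> < r / 2" using \<gamma>(3) D(1) by (simp add: pos_less_divide_eq)
    finally show ?thesis .
  qed
  \<comment> \<open>Since the rotation preserves V and its complement, projecting commutes with the
    word map up to a translation: the projection of the cylinder is a similar copy of the projection
    of \<open>F\<close>.\<close>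
  have proj_word: "\<pi> (word_map S \<gamma> x) = word_ratio S \<gamma> *\<^sub>R (?R *v \<pi> x) + \<pi> (word_map S \<gamma> 0)" for x
  proof -
    let ?v = "word_ratio S \<gamma> *\<^sub>R (?R *v (x - \<pi> x)) + (word_map S \<gamma> 0 - \<pi> (word_map S \<gamma> 0))"
      and ?w = "word_ratio S \<gamma> *\<^sub>R (?R *v \<pi> x) + \<pi> (word_map S \<gamma> 0)"
    have "?v \<in> V" by (intro subspace_add subspace_scale V rot \<gamma> proj)
    moreover have "?w \<in> orthogonal_comp V"
      by (intro subspace_add subspace_scale subspace_orthogonal_comp RV proj)
    ultimately have "\<pi> (?v + ?w) = ?w" by (rule proj_eq)
    moreover have "?v + ?w = word_map S \<gamma> x"
      by (subst S.word_map_eq[OF \<gamma>(1), of x]) (simp add: algebra_simps)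
    ultimately show ?thesis by simp
  qed
  obtain Bs where Bs: "Bs \<subseteq> V" "pairwise orthogonal Bs" "\<And>x. x \<in> Bs \<Longrightarrow> norm x = 1"
      "independent Bs" "card Bs = dim V"
    using orthonormal_basis_subspace[OF V] by metis
  have fin: "finite Bs" using Bs(4) by (rule independent_imp_finite)
  \<comment> \<open>The first bound keeps the translate inside the ball around z, the second inside
    the unit ball of V around \<open>v0\<close>.\<close>
  define \<delta> where "\<delta> = min (r / 2) (1 - norm (v1 - v0))"
  have \<delta>: "0 < \<delta>" using r(1) v1(2) by (simp add: \<delta>_def)
  \<comment> \<open>Points of a cube of side s have norm at most \<open>card Bs * s\<close>; the
    added 1 gives strictness and covers an empty basis.\<close>
  define s where "s = \<delta> / (a * (card Bs + 1))"
  have s: "0 < s" using \<delta> a by (simp add: s_def)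
  \<comment> \<open>The V-component of the preimage of z under the limit similitude, whose
    translation part is split as \<open>b - \<pi> b\<close> and \<open>\<pi> b\<close>.\<close>
  define y0 where "y0 = (1 / a) *\<^sub>R (transpose A *v (v1 - (b - \<pi> b)))"
  have y0: "y0 \<in> V" unfolding y0_def by (intro subspace_scale V AV subspace_diff v1 proj)
  define Q where "Q = {y0 + (\<Sum>u\<in>Bs. t u *\<^sub>R u) | t. \<forall>u\<in>Bs. 0 \<le> t u \<and> t u \<le> s}"
  \<comment> \<open>By \<open>f_eq\<close>, this sends \<open>\<pi> x\<close> to the complementary
    component of the preimage of the projected cylinder point.\<close>
  let ?f = "\<lambda>w. (word_ratio S \<gamma> / a) *\<^sub>R ((transpose A ** ?R) *v w)
      + (1 / a) *\<^sub>R (transpose A *v (\<pi> (word_map S \<gamma> 0) - \<pi> b))"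
  define C where "C = ?f ` \<pi> ` F"
  have f_eq: "?f (\<pi> x) = (1 / a) *\<^sub>R (transpose A *v (\<pi> (word_map S \<gamma> x) - \<pi> b))" for x
    unfolding proj_word[of x] by (simp add: algebra_simps matrix_vector_mul_assoc)
  have "nontrivial_cube (overlap_dim F) Q"
    unfolding nontrivial_cube_def
    by (rule exI[of _ Bs], rule exI[of _ y0], rule exI[of _ s])
       (use fin Bs s in \<open>auto simp: Q_def overlap_dim_def V_def\<close>)
  moreover have "Q \<subseteq> V"
    unfolding Q_def using Bs(1) by (auto intro!: subspace_add subspace_sum subspace_scale V y0)
  moreover have "C \<subseteq> orthogonal_comp V"
    unfolding C_def image_image f_eq
    by (auto intro!: subspace_scale subspace_orthogonal_comp AV subspace_diff proj)
  moreover have "assouad_dim C = assouad_dim (\<pi> ` F)"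
    unfolding C_def using S.word_ratio_pos[OF \<gamma>(1)] a A(1) R
    by (intro assouad_dim_similarity orthogonal_matrix_mul) auto
  moreover have "{q + c | q c. q \<in> Q \<and> c \<in> C} \<subseteq> F"
  proof clarify
    fix q w assume "q \<in> Q" "w \<in> C"
    then obtain t x where t: "\<forall>u\<in>Bs. 0 \<le> t u \<and> t u \<le> s" "q = y0 + (\<Sum>u\<in>Bs. t u *\<^sub>R u)"
      and x: "x \<in> F" "w = ?f (\<pi> x)" by (auto simp: Q_def C_def)
    define y where "y = (\<Sum>u\<in>Bs. t u *\<^sub>R u)"
    define z' where "z' = (v1 + a *\<^sub>R (A *v y)) + \<pi> (word_map S \<gamma> x)"
    have "norm y \<le> (\<Sum>u\<in>Bs. s)"
      unfolding y_def using t(1) Bs(3) by (intro sum_norm_le) auto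
    then have "a * norm y \<le> a * (card Bs * s)" using a by simp
    also have "\<dots> < a * ((card Bs + 1) * s)" using a s by simp
    also have "\<dots> = \<delta>" using a by (simp add: s_def)
    finally have small: "norm (a *\<^sub>R (A *v y)) < \<delta>" using a by (simp add: orthogonal_matrix_norm[OF A(1)])
    have "y \<in> V" unfolding y_def using Bs(1) by (auto intro!: subspace_sum subspace_scale V)
    then have "v1 + a *\<^sub>R (A *v y) \<in> V" by (intro subspace_add subspace_scale V v1 A(2))
    moreover have "norm (v1 + a *\<^sub>R (A *v y) - v0) < 1"
      using norm_triangle_ineq[of "v1 - v0" "a *\<^sub>R (A *v y)"] small
      by (simp add: \<delta>_def algebra_simps)
    ultimately have "z' \<in> E"
      unfolding E_def z'_def using S.word_map_in_F[OF \<gamma>(1) x(1)] by blast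
    moreover have "norm (a *\<^sub>R (A *v y) + (\<pi> (word_map S \<gamma> x) - \<pi> x1)) < r / 2 + r / 2"
      using small near_x1[OF x(1)] by (intro norm_triangle_lt add_strict_mono) (auto simp: \<delta>_def)
    then have "z' \<in> ball z r"
      by (simp add: z'_def z_eq dist_norm norm_minus_commute algebra_simps)
    ultimately obtain x' where x': "x' \<in> F" "z' = sim_map (l j) x'" using r(2) by blast
    \<comment> \<open>The point \<open>z'\<close> lies in the piece of E covered by the image of
      \<open>F\<close> under \<open>l j\<close>, so injectivity of this similitude identifies
      \<open>q + w\<close> with a point of \<open>F\<close>.\<close>
    have "sim_map (l j) (q + w) = z'"
      unfolding sim_map_def lj t(2) x(2) f_eq y0_def z'_def y_def[symmetric]
      using a by (simp add: matrix_vector_right_distrib matrix_vector_mult_scaleR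
          orthogonal_matrix_cancel[OF A(1)] scaleR_add_right)
    then have "a *\<^sub>R (A *v (q + w)) = a *\<^sub>R (A *v x')" using x'(2) by (simp add: sim_map_def lj)
    then have "q + w = x'" using a orthogonal_matrix_cancel(1)[OF A(1)] by (metis less_irrefl scaleR_cancel_left)
    with x'(1) show "q + w \<in> F" by simp
  qed
  ultimately show ?thesis unfolding \<pi>_def V_def by blast
qed

end
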